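(* Let $k$ be a field, $r\ge 1$, and let $\mathcal X\subset\mathbb Z^r$ be a Cubist subset. Then $V_{\mathcal X}\text{-mod}$ is a (graded) highest weight category with respect to the partial order $\succeq^{op}$ on $\mathcal X$ opposite to the standard partial order $\succeq$.
   Context: Combinatorics. $\epsilon_1,\dots,\epsilon_r$ is the standard basis of $\mathbb Z^r$; $x\le y$ means $y-x$ has nonnegative coordinates; $x[n]=x+n(\epsilon_1+\cdots+\epsilon_r)$. A subset $\mathcal X\subset\mathbb Z^r$ is Cubist if $\mathcal X=\mathcal X^-\setminus\mathcal X^-[-1]$ for some nonempty proper ideal (down-closed subset) $\mathcal X^-$ of $(\mathbb Z^r,\le)$. For $1\le i\le r$ put $F_i=\{\sum_{j<i}a_j\epsilon_j-\sum_{j>i}a_j\epsilon_j : a_j\in\{0,1\}\}$. For each $x\in\mathcal X$ there is a unique $i$ with $x+F_i\subseteq\mathcal X$; put $\lambda x=x+F_i$. The standard partial order $\succeq$ on $\mathcal X$ is generated by $x\succeq y$ for $y\in\lambda x$. Algebras. Paths in quivers are composed from left to right (for an arrow $a$ from $x$ to $y$, $a=e_xae_y$). $V_r$ is the graded $k$-algebra (arrows in degree 1) given by the quiver with vertices (idempotents) $f_x$, $x\in\mathbb Z^r$, arrows $\alpha_{x,i}$ from $x$ to $x+\epsilon_i$ and $\beta_{x,i}$ from $x$ to $x-\epsilon_i$ ($1\le i\le r$), with relations, for all $x\in\mathbb Z^r$: $\alpha_{x,i}\alpha_{x+\epsilon_i,j}=\alpha_{x,j}\alpha_{x+\epsilon_j,i}$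 and $\beta_{x,i}\beta_{x-\epsilon_i,j}=\beta_{x,j}\beta_{x-\epsilon_j,i}$ for $i\ne j$; $\alpha_{x,i}\beta_{x+\epsilon_i,j}=\beta_{x,j}\alpha_{x-\epsilon_j,i}$ for all $1\le i,j\le r$; and $\sum_{i=1}^r\beta_{x,i}\alpha_{x-\epsilon_i,i}=0$. Put $V_{\mathcal X}=\sum_{x,y\in\mathcal X}f_xV_rf_y$. Module conventions. Let $A=\bigoplus_{i\ge0}A_i$ be a graded $k$-algebra with orthogonal idempotents $e_s$ ($s\in\mathcal R$) forming a basis of $A_0$, $A=\bigoplus_{s,t}e_sAe_t$, and $\dim e_sA_i<\infty$. Modules are graded left modules $M=\bigoplus_i M_i$ with $M=\bigoplus_s e_sM$; $M\langle n\rangle_i=M_{i-n}$. $A\text{-mod}$ is the category of graded modules $M$ with $\dim e_sM_i<\infty$ for all $s,i$ and $M_i=0$ for $i\ll0$, with degree-preserving homomorphisms. Given a partial order $\preceq$ on $\mathcal R$, the standard module is $\Delta_A(s)=Ae_s/\sum_{t\succ s}Ae_tAe_s$. One says that $A\text{-mod}$ is a graded highest weight category with respect to the order if for all $s$: (i) $e_t\Delta_A(s)=0$ whenever $t\not\preceq s$; (ii) $\ker(Ae_s\twoheadrightarrow\Delta_A(s))$ has a filtration in which each section is isomorphic to $\Delta_A(t)\langle n\rangle$ for some $t\succ s$ and $n\in\mathbb Z$ (the filtration is not required to be finite, and intervals of the poset are not required to be finite). Here $A=V_{\mathcal X}$, with idempotents $f_x$, $x\in\mathcal X$. *)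

theory Defs
  imports "HOL-Analysis.Analysis" "HOL-Library.Poly_Mapping"
begin

section \<open>Cubist subsets and the standard partial order\<close>

text \<open>A nonempty finite linearly ordered type \<open>'r\<close> plays the role of the index set
  $\{1,\dots,r\}$, so that \<open>int ^ 'r\<close> is $\mathbb{Z}^r$ with its coordinatewise order and
  \<open>axis i 1\<close> is $\epsilon_i$.\<close>

definition shift :: "int \<Rightarrow> int ^ 'r::finite \<Rightarrow> int ^ 'r" where
  "shift n x = x + vec n"

definition is_ideal :: "'a::order set \<Rightarrow> bool" where
  "is_ideal I \<longleftrightarrow> (\<forall>x\<in>I. \<forall>y. y \<le> x \<longrightarrow> y \<in> I)"

definition Cubist :: "(int ^ 'r::finite) set \<Rightarrow> bool" where
  "Cubist X \<longleftrightarrow> (\<exists>I. is_ideal I \<and> I \<noteq> {} \<and> I \<noteq> UNIV \<and> X = I - shift (- 1) ` I)"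

definition facet :: "'r \<Rightarrow> (int ^ 'r::{finite,linorder}) set" where
  "facet i = {(\<Sum>j\<in>{..<i}. axis j (a j)) - (\<Sum>j\<in>{i<..}. axis j (a j)) | a. \<forall>j. a j \<in> {0, 1}}"

definition lam :: "(int ^ 'r::{finite,linorder}) set \<Rightarrow> int ^ 'r::{finite,linorder} \<Rightarrow> (int ^ 'r::{finite,linorder}) set" where
  "lam X x = (+) x ` facet (THE i. (+) x ` facet i \<subseteq> X)"

text \<open>Orders are relations \<open>r\<close> with \<open>(x, y) \<in> r\<close> meaning that \<open>x\<close> is below \<open>y\<close>;
  here \<open>(y, x)\<close> belongs to the order generated by \<open>x \<succeq> y\<close> for \<open>y \<in> lam X x\<close>.\<close>

definition standard_order :: "(int ^ 'r::{finite,linorder}) set \<Rightarrow> (int ^ 'r::{finite,linorder}) rel" where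
  "standard_order X = Restr ({(y, x). x \<in> X \<and> y \<in> lam X x}\<^sup>*) X"


section \<open>The path algebra of the quiver underlying $V_r$\<close>

text \<open>Every vertex $x \in \mathbb{Z}^r$ is the source of exactly one arrow $\alpha_{x,i}$ and one
  arrow $\beta_{x,i}$ for each $i$. A path is therefore determined by its source and the sequence
  of labels of its arrows, read from left to right, and every such pair is a path.\<close>

datatype 'r label = Alpha 'r | Beta 'r

type_synonym 'r path = "(int ^ 'r) \<times> 'r label list"

fun move :: "int ^ 'r::finite \<Rightarrow> 'r label \<Rightarrow> int ^ 'r" where
  "move x (Alpha i) = x + axis i 1"
| "move x (Beta i) = x - axis i 1"

definition source :: "'r path \<Rightarrow> int ^ 'r::finite" where
  "source p = fst p"

definition target :: "'r path \<Rightarrow> int ^ 'r::finite" where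
  "target p = foldl move (fst p) (snd p)"

type_synonym ('r, 'k) path_algebra = "'r path \<Rightarrow>\<^sub>0 'k"

definition pmult :: "('r::finite, 'k::field) path_algebra \<Rightarrow> ('r, 'k) path_algebra \<Rightarrow> ('r, 'k) path_algebra"
    (infixl \<open>\<odot>\<close> 70) where
  "f \<odot> g = (\<Sum>p\<in>Poly_Mapping.keys f. \<Sum>q\<in>Poly_Mapping.keys g.
     if target p = source q
     then Poly_Mapping.single (source p, snd p @ snd q) (Poly_Mapping.lookup f p * Poly_Mapping.lookup g q)
     else 0)"

definition pscale :: "'k::field \<Rightarrow> ('r::finite, 'k) path_algebra \<Rightarrow> ('r, 'k) path_algebra" where
  "pscale c f = Poly_Mapping.map ((*) c) f"

definition pvertex :: "int ^ 'r::finite \<Rightarrow> ('r, 'k::field) path_algebra" where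
  "pvertex x = Poly_Mapping.single (x, []) 1"

definition alpha :: "int ^ 'r::finite \<Rightarrow> 'r \<Rightarrow> ('r, 'k::field) path_algebra" where
  "alpha x i = Poly_Mapping.single (x, [Alpha i]) 1"

definition beta :: "int ^ 'r::finite \<Rightarrow> 'r \<Rightarrow> ('r, 'k::field) path_algebra" where
  "beta x i = Poly_Mapping.single (x, [Beta i]) 1"

definition relators :: "('r::finite, 'k::field) path_algebra set" where
  "relators =
     {alpha x i \<odot> alpha (x + axis i 1) j - alpha x j \<odot> alpha (x + axis j 1) i | x i j. i \<noteq> j} \<union>
     {beta x i \<odot> beta (x - axis i 1) j - beta x j \<odot> beta (x - axis j 1) i | x i j. i \<noteq> j} \<union>
     {alpha x i \<odot> beta (x + axis i 1) j - beta x j \<odot> alpha (x - axis j 1) i | x i j. True} \<union>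
     {\<Sum>i\<in>UNIV. beta x i \<odot> alpha (x - axis i 1) i | x. True}"

inductive_set relation_ideal :: "('r::finite, 'k::field) path_algebra set" where
  zero: "0 \<in> relation_ideal"
| relator: "f \<in> relators \<Longrightarrow> f \<in> relation_ideal"
| add: "f \<in> relation_ideal \<Longrightarrow> g \<in> relation_ideal \<Longrightarrow> f + g \<in> relation_ideal"
| scale: "f \<in> relation_ideal \<Longrightarrow> pscale c f \<in> relation_ideal"
| mult_left: "f \<in> relation_ideal \<Longrightarrow> g \<odot> f \<in> relation_ideal"
| mult_right: "f \<in> relation_ideal \<Longrightarrow> f \<odot> g \<in> relation_ideal"

lemma lookup_pscale [simp]: "Poly_Mapping.lookup (pscale c f) p = c * Poly_Mapping.lookup f p"
  unfolding pscale_def by transfer (simp add: when_def)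

lemma pscale_eqs:
  "pscale c (f + g) = pscale c f + pscale c g"
  "pscale c (f - g) = pscale c f - pscale c g"
  "pscale (c + d) f = pscale c f + pscale d f"
  "pscale c (pscale d f) = pscale (c * d) f"
  "pscale 1 f = f"
  "pscale (- 1) f = - f"
  "pscale c 0 = 0"
  "pscale c (Poly_Mapping.single p d) = Poly_Mapping.single p (c * d)"
  by (rule poly_mapping_eqI,
      simp add: lookup_add lookup_minus lookup_uminus algebra_simps lookup_single when_def)+

lemma pmult_eq_sum:
  assumes "finite S" "finite T" "Poly_Mapping.keys f \<subseteq> S" "Poly_Mapping.keys g \<subseteq> T"
  shows "f \<odot> g = (\<Sum>p\<in>S. \<Sum>q\<in>T.
     if target p = source q
     then Poly_Mapping.single (source p, snd p @ snd q) (Poly_Mapping.lookup f p * Poly_Mapping.lookup g q)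
     else 0)"
proof -
  let ?h = "\<lambda>p q. if target p = source q
     then Poly_Mapping.single (source p, snd p @ snd q) (Poly_Mapping.lookup f p * Poly_Mapping.lookup g q)
     else 0"
  have "(\<Sum>q\<in>Poly_Mapping.keys g. ?h p q) = (\<Sum>q\<in>T. ?h p q)" for p
    by (rule sum.mono_neutral_left) (use assms in \<open>auto simp: in_keys_iff\<close>)
  moreover have "(\<Sum>p\<in>Poly_Mapping.keys f. \<Sum>q\<in>T. ?h p q) = (\<Sum>p\<in>S. \<Sum>q\<in>T. ?h p q)"
    by (rule sum.mono_neutral_left) (use assms in \<open>auto simp: in_keys_iff intro!: sum.neutral\<close>)
  ultimately show ?thesis
    by (simp add: pmult_def)
qed

lemma pmult_add_left: "(f + f') \<odot> g = f \<odot> g + f' \<odot> g"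
proof -
  let ?S = "Poly_Mapping.keys f \<union> Poly_Mapping.keys f'" and ?T = "Poly_Mapping.keys g"
  have "Poly_Mapping.keys (f + f') \<subseteq> ?S"
    by (rule Poly_Mapping.keys_add)
  then show ?thesis
    by (simp add: pmult_eq_sum[of ?S ?T] sum.distrib[symmetric] lookup_add distrib_right single_add
        cong: if_cong)
      (intro sum.cong refl, simp)
qed

lemma pmult_add_right: "f \<odot> (g + g') = f \<odot> g + f \<odot> g'"
proof -
  let ?S = "Poly_Mapping.keys f" and ?T = "Poly_Mapping.keys g \<union> Poly_Mapping.keys g'"
  have "Poly_Mapping.keys (g + g') \<subseteq> ?T"
    by (rule Poly_Mapping.keys_add)
  then show ?thesis
    by (simp add: pmult_eq_sum[of ?S ?T] sum.distrib[symmetric] lookup_add distrib_left single_add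
        cong: if_cong)
      (intro sum.cong refl, simp)
qed

lemma pmult_zero [simp]: "0 \<odot> g = 0" "f \<odot> 0 = 0"
  by (simp_all add: pmult_def)

lemma pmult_sum_left: "sum h S \<odot> g = (\<Sum>s\<in>S. h s \<odot> g)"
  by (induction S rule: infinite_finite_induct) (simp_all add: pmult_add_left)

lemma pmult_sum_right: "f \<odot> sum h S = (\<Sum>s\<in>S. f \<odot> h s)"
  by (induction S rule: infinite_finite_induct) (simp_all add: pmult_add_right)

lemma pmult_single:
  "Poly_Mapping.single p c \<odot> Poly_Mapping.single q d =
   (if target p = source q then Poly_Mapping.single (source p, snd p @ snd q) (c * d) else 0)"
  by (subst pmult_eq_sum[of "{p}" "{q}"]) simp_all

lemma pmult_minus_left: "(f - f') \<odot> g = f \<odot> g - f' \<odot> g"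
  by (metis pmult_add_left add_diff_cancel diff_add_cancel)

lemma pmult_minus_right: "f \<odot> (g - g') = f \<odot> g - f \<odot> g'"
  by (metis pmult_add_right add_diff_cancel diff_add_cancel)

lemma pscale_sum: "pscale c (sum h S) = (\<Sum>s\<in>S. pscale c (h s))"
  by (induction S rule: infinite_finite_induct) (simp_all add: pscale_eqs)

lemma path_algebra_expand:
  fixes f :: "('r::finite, 'k::field) path_algebra"
  shows "f = (\<Sum>p\<in>Poly_Mapping.keys f. Poly_Mapping.single p (Poly_Mapping.lookup f p))"
  by (rule poly_mapping_eqI)
    (auto simp: lookup_sum lookup_single when_def in_keys_iff)

lemma pmult_assoc: "(f \<odot> g) \<odot> h = f \<odot> (g \<odot> h)"
proof -
  have *: "(Poly_Mapping.single p a \<odot> Poly_Mapping.single q b) \<odot> Poly_Mapping.single s c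
      = Poly_Mapping.single p a \<odot> (Poly_Mapping.single q b \<odot> Poly_Mapping.single s c)"
    for p q s :: "'r::finite path" and a b c :: "'k::field"
    by (auto simp: pmult_single source_def target_def mult.assoc)
  show ?thesis
    by (subst (1 2) path_algebra_expand[of f], subst (1 2) path_algebra_expand[of g],
        subst (1 2) path_algebra_expand[of h])
      (simp only: pmult_sum_left pmult_sum_right *)
qed

lemma pmult_scale_left: "pscale c f \<odot> g = pscale c (f \<odot> g)"
proof -
  have "Poly_Mapping.keys (pscale c f) \<subseteq> Poly_Mapping.keys f"
    by (auto simp: in_keys_iff)
  then show ?thesis
    by (simp add: pmult_eq_sum[of "Poly_Mapping.keys f" "Poly_Mapping.keys g"] pscale_sum)
      (intro sum.cong refl, simp add: pscale_eqs mult.assoc)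
qed

lemma pmult_scale_right: "f \<odot> pscale c g = pscale c (f \<odot> g)"
proof -
  have "Poly_Mapping.keys (pscale c g) \<subseteq> Poly_Mapping.keys g"
    by (auto simp: in_keys_iff)
  then show ?thesis
    by (simp add: pmult_eq_sum[of "Poly_Mapping.keys f" "Poly_Mapping.keys g"] pscale_sum)
      (intro sum.cong refl, simp add: pscale_eqs mult_ac)
qed

lemma relation_ideal_uminus: "f \<in> relation_ideal \<Longrightarrow> - f \<in> relation_ideal"
  using relation_ideal.scale[of f "- 1"] by (simp add: pscale_eqs)

lemma relation_ideal_diff: "f \<in> relation_ideal \<Longrightarrow> g \<in> relation_ideal \<Longrightarrow> f - g \<in> relation_ideal"
  using relation_ideal.add[of f "- g"] relation_ideal_uminus[of g] by simp


section \<open>The algebra $V_r$\<close>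

quotient_type (overloaded) ('r, 'k) V = "('r::finite, 'k::field) path_algebra" /
  "\<lambda>f g. f - g \<in> relation_ideal"
  morphisms rep_V class_V
proof (rule equivpI)
  show "reflp (\<lambda>f g :: ('r, 'k) path_algebra. f - g \<in> relation_ideal)"
    by (simp add: reflp_def relation_ideal.zero)
  show "symp (\<lambda>f g :: ('r, 'k) path_algebra. f - g \<in> relation_ideal)"
    using relation_ideal_uminus by (fastforce intro: sympI)
  show "transp (\<lambda>f g :: ('r, 'k) path_algebra. f - g \<in> relation_ideal)"
    by (rule transpI) (use relation_ideal.add in fastforce)
qed

instantiation V :: (finite, field) ring
begin

lift_definition zero_V :: "('a, 'b) V" is 0 .

lift_definition plus_V :: "('a, 'b) V \<Rightarrow> ('a, 'b) V \<Rightarrow> ('a, 'b) V" is "(+)"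
  by (simp add: add_diff_add relation_ideal.add)

lift_definition uminus_V :: "('a, 'b) V \<Rightarrow> ('a, 'b) V" is uminus
  using relation_ideal_uminus by fastforce

lift_definition minus_V :: "('a, 'b) V \<Rightarrow> ('a, 'b) V \<Rightarrow> ('a, 'b) V" is "(-)"
  using relation_ideal_diff by (fastforce simp: algebra_simps)

lift_definition times_V :: "('a, 'b) V \<Rightarrow> ('a, 'b) V \<Rightarrow> ('a, 'b) V" is "(\<odot>)"
proof -
  fix f f' g g' :: "('a, 'b) path_algebra"
  assume "f - f' \<in> relation_ideal" "g - g' \<in> relation_ideal"
  then have "(f - f') \<odot> g + f' \<odot> (g - g') \<in> relation_ideal"
    by (intro relation_ideal.add relation_ideal.mult_left relation_ideal.mult_right)
  then show "f \<odot> g - f' \<odot> g' \<in> relation_ideal"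
    by (simp add: pmult_minus_left pmult_minus_right)
qed

instance
  by standard
    (transfer; simp add: relation_ideal.zero pmult_assoc pmult_add_left pmult_add_right algebra_simps)+

end

lift_definition V_scale :: "'k::field \<Rightarrow> ('r::finite, 'k) V \<Rightarrow> ('r, 'k) V" is pscale
  using relation_ideal.scale by (fastforce simp: pscale_eqs(2)[symmetric])

lift_definition V_idem :: "int ^ 'r::finite \<Rightarrow> ('r, 'k::field) V" is pvertex .

definition V_comp :: "nat \<Rightarrow> ('r::finite, 'k::field) V set" where
  "V_comp n = {class_V f | f. \<forall>p\<in>Poly_Mapping.keys f. length (snd p) = n}"

interpretation V: vector_space "V_scale :: 'k::field \<Rightarrow> ('r::finite, 'k) V \<Rightarrow> ('r, 'k) V"
  by standard (transfer; simp add: pscale_eqs relation_ideal.zero)+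

definition V_Cubist :: "(int ^ 'r::finite) set \<Rightarrow> ('r, 'k::field) V set" where
  "V_Cubist X = V.span {V_idem x * v * V_idem y | x v y. x \<in> X \<and> y \<in> X}"

definition V_Cubist_comp :: "(int ^ 'r::finite) set \<Rightarrow> nat \<Rightarrow> ('r, 'k::field) V set" where
  "V_Cubist_comp X n = V_Cubist X \<inter> V_comp n"


section \<open>Graded algebras with idempotents and their graded modules\<close>

text \<open>The algebra is a subalgebra \<open>A\<close> of an ambient (not necessarily unital) algebra structure
  on the type \<open>'a\<close>; \<open>comp i\<close> is its homogeneous component of degree \<open>i\<close>.\<close>

locale graded_algebra = vector_space scale
  for scale :: "'k::field \<Rightarrow> 'a::ring \<Rightarrow> 'a" +
  fixes A :: "'a set" and comp :: "nat \<Rightarrow> 'a set" and R :: "'s set" and e :: "'s \<Rightarrow> 'a"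
  assumes scale_mult_left: "\<lbrakk>a \<in> A; b \<in> A\<rbrakk> \<Longrightarrow> scale c a * b = scale c (a * b)"
    and scale_mult_right: "\<lbrakk>a \<in> A; b \<in> A\<rbrakk> \<Longrightarrow> a * scale c b = scale c (a * b)"
    and subspace_A: "subspace A"
    and mult_closed: "\<lbrakk>a \<in> A; b \<in> A\<rbrakk> \<Longrightarrow> a * b \<in> A"
    and subspace_comp: "subspace (comp i)"
    and comp_subset: "comp i \<subseteq> A"
    and comp_mult: "\<lbrakk>a \<in> comp i; b \<in> comp j\<rbrakk> \<Longrightarrow> a * b \<in> comp (i + j)"
    and comp_direct: "a \<in> A \<Longrightarrow>
      \<exists>!d. (\<forall>i. d i \<in> comp i) \<and> finite {i. d i \<noteq> 0} \<and> a = (\<Sum>i | d i \<noteq> 0. d i)"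
    and idempotent: "s \<in> R \<Longrightarrow> e s * e s = e s"
    and orthogonal: "\<lbrakk>s \<in> R; t \<in> R; s \<noteq> t\<rbrakk> \<Longrightarrow> e s * e t = 0"
    and inj_e: "inj_on e R"
    and independent_e: "independent (e ` R)"
    and span_e: "span (e ` R) = comp 0"
    and Peirce: "a \<in> A \<Longrightarrow> \<exists>S. finite S \<and> S \<subseteq> R \<and> a = (\<Sum>s\<in>S. \<Sum>t\<in>S. e s * a * e t)"
    and finite_dim: "s \<in> R \<Longrightarrow> \<exists>B. finite B \<and> (*) (e s) ` comp i \<subseteq> span B"

record ('k, 'a, 'm) graded_module =
  mcarrier :: "'m set"
  mzero :: 'm
  madd :: "'m \<Rightarrow> 'm \<Rightarrow> 'm"
  mscale :: "'k \<Rightarrow> 'm \<Rightarrow> 'm"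
  mact :: "'a \<Rightarrow> 'm \<Rightarrow> 'm"
  mcomp :: "int \<Rightarrow> 'm set"

definition mshift :: "('k, 'a, 'm) graded_module \<Rightarrow> int \<Rightarrow> ('k, 'a, 'm) graded_module"
    (\<open>_\<langle>_\<rangle>\<close> [1000, 0] 1000) where
  "M\<langle>n\<rangle> = M\<lparr>mcomp := \<lambda>i. mcomp M (i - n)\<rparr>"

definition graded_iso ::
    "'a set \<Rightarrow> ('k, 'a, 'm) graded_module \<Rightarrow> ('k, 'a, 'n) graded_module \<Rightarrow> bool" where
  "graded_iso A M N \<longleftrightarrow> (\<exists>\<phi>. bij_betw \<phi> (mcarrier M) (mcarrier N) \<and>
     (\<forall>x\<in>mcarrier M. \<forall>y\<in>mcarrier M. \<phi> (madd M x y) = madd N (\<phi> x) (\<phi> y)) \<and>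
     (\<forall>c. \<forall>x\<in>mcarrier M. \<phi> (mscale M c x) = mscale N c (\<phi> x)) \<and>
     (\<forall>a\<in>A. \<forall>x\<in>mcarrier M. \<phi> (mact M a x) = mact N a (\<phi> x)) \<and>
     (\<forall>i. \<phi> ` mcomp M i = mcomp N i))"

context graded_algebra
begin

definition proj :: "'s \<Rightarrow> 'a set" where
  "proj s = {a * e s | a. a \<in> A}"

text \<open>Graded left submodules of the regular module \<open>A\<close>.\<close>

definition graded_submodule :: "'a set \<Rightarrow> bool" where
  "graded_submodule M \<longleftrightarrow> M \<subseteq> A \<and> subspace M \<and> (\<forall>a\<in>A. \<forall>x\<in>M. a * x \<in> M) \<and>
     M = span (\<Union>i. M \<inter> comp i)"

text \<open>The subquotient \<open>M / N\<close> of the regular module, whose elements are the cosets of \<open>N\<close>.\<close>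

definition subquotient :: "'a set \<Rightarrow> 'a set \<Rightarrow> ('k, 'a, 'a set) graded_module" where
  "subquotient M N =
     \<lparr>mcarrier = (\<lambda>x. x +o N) ` M,
      mzero = N,
      madd = (\<lambda>C D. C + D),
      mscale = (\<lambda>c C. scale c ` C + N),
      mact = (\<lambda>a C. (*) a ` C + N),
      mcomp = (\<lambda>i. (\<lambda>x. x +o N) ` (if i < 0 then {0} else M \<inter> comp (nat i)))\<rparr>"

text \<open>For the order \<open>ord\<close> on \<open>R\<close>, \<open>standard_kernel ord s\<close> is $\sum_{t \succ s} A e_t A e_s$, the kernel of
  the projection from $A e_s$ to the standard module.\<close>

definition standard_kernel :: "'s rel \<Rightarrow> 's \<Rightarrow> 'a set" where
  "standard_kernel ord s = span {a * e t * b * e s | a t b.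
     a \<in> A \<and> b \<in> A \<and> t \<in> R \<and> (s, t) \<in> ord \<and> t \<noteq> s}"

definition standard :: "'s rel \<Rightarrow> 's \<Rightarrow> ('k, 'a, 'a set) graded_module" where
  "standard ord s = subquotient (proj s) (standard_kernel ord s)"

text \<open>A filtration of a graded module \<open>K\<close> is a family of graded submodules, containing \<open>K\<close> and
  \<open>0\<close>, that is well-ordered by reverse inclusion (a union belonging to the subfamily is its
  largest member) and closed under intersections; no bound is put on its order type. Finite
  filtrations and filtrations $K = K_0 \supseteq K_1 \supseteq \cdots$ with
  $\bigcap_n K_n = 0$ are special cases, but they do not suffice in general, because intervals of
  the poset may be infinite. The sections are the quotients of consecutive members.\<close>

definition filtration :: "'a set set \<Rightarrow> 'a set \<Rightarrow> bool" where
  "filtration \<F> K \<longleftrightarrow> (\<forall>M\<in>\<F>. graded_submodule M \<and> M \<subseteq> K) \<and> K \<in> \<F> \<and> {0} \<in> \<F> \<and>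
     (\<forall>\<G>\<subseteq>\<F>. \<G> \<noteq> {} \<longrightarrow> \<Union>\<G> \<in> \<G> \<and> \<Inter>\<G> \<in> \<F>)"

definition consecutive :: "'a set set \<Rightarrow> 'a set \<Rightarrow> 'a set \<Rightarrow> bool" where
  "consecutive \<F> M N \<longleftrightarrow> M \<in> \<F> \<and> N \<in> \<F> \<and> N \<subset> M \<and> \<not> (\<exists>L\<in>\<F>. N \<subset> L \<and> L \<subset> M)"

end

text \<open>Every module below is a subquotient of some $A e_s$ by graded submodules, so it has
  finite-dimensional pieces $e_t M_i$, is bounded below, and satisfies $M = \bigoplus_t e_t M$.\<close>

locale graded_highest_weight_category = graded_algebra scale A comp R e
  for scale :: "'k::field \<Rightarrow> 'a::ring \<Rightarrow> 'a" and A :: "'a set" and comp :: "nat \<Rightarrow> 'a set"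
    and R :: "'s set" and e :: "'s \<Rightarrow> 'a" +
  fixes ord :: "'s rel"
  assumes partial_order: "partial_order_on R ord"
    and standard_support: "\<lbrakk>s \<in> R; t \<in> R; (t, s) \<notin> ord; x \<in> mcarrier (standard ord s)\<rbrakk> \<Longrightarrow>
      mact (standard ord s) (e t) x = mzero (standard ord s)"
    and standard_filtration: "s \<in> R \<Longrightarrow>
      \<exists>\<F>. filtration \<F> (standard_kernel ord s) \<and>
        (\<forall>M N. consecutive \<F> M N \<longrightarrow>
          (\<exists>t\<in>R. \<exists>n. (s, t) \<in> ord \<and> t \<noteq> s \<and>
            graded_iso A (subquotient M N) ((standard ord t)\<langle>n\<rangle>)))"

end

theory Submission
  imports Defs
begin

text \<open>All arrows of $V_r$ commute, so $f_yV_rf_s$ is a copy of $k[u_1,\dots,u_r]/(\sum_j u_j)$ with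
  $u_j = a_jb_j$, generated by the geodesics from \<open>y\<close> to \<open>s\<close>. For $t \in \mathcal X$ with
  $t + F_i \subseteq \mathcal X$, the standard module of \<open>t\<close> has a one-dimensional piece, spanned by
  the geodesics, at each $y \in \mathcal X$ with $y_j \le t_j$ for $j < i$ and $y_j \ge t_j$ for
  $j > i$ (\<open>supp y t\<close>). The products of a geodesic from \<open>y\<close> to \<open>t\<close> with a geodesic from \<open>t\<close> to \<open>s\<close>,
  where \<open>supp y t\<close> and \<open>supp s t\<close>, form a basis of $f_yV_rf_s$. They span: any other path through
  \<open>t\<close> is modulo $\sum_j u_j$ a combination of paths through points of $\lambda t \setminus \{t\}$. They are
  independent because their number in each degree is the dimension of that degree; the numbers are
  computed by a discrete divergence theorem on the ideal $\mathcal X^-$. The span of the products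
  with \<open>t\<close> in a lower set of a suitable total order is a submodule, and removing the top \<open>t\<close> splits
  off a shift of the standard module of \<open>t\<close>. By Dickson's lemma every nonempty set of points \<open>t\<close> with
  \<open>supp s t\<close> has a top, whence the filtration is well-ordered.\<close>

section \<open>Cubist sets and their order\<close>

text \<open>For \<open>x\<close> in \<open>X\<close>, consider the lattice path from
  \<open>x\<close> to \<open>x + vec 1\<close> that takes one step in each coordinate, in increasing
  order. It starts inside \<open>I\<close> and ends outside, so it crosses the boundary exactly
  once, in the direction of the facet of \<open>x\<close>. Points of \<open>X\<close> thus
  correspond to lattice edges that leave \<open>I\<close>, and counts over \<open>X\<close> become
  fluxes through the boundary of \<open>I\<close>.

  Rewriting with the relations proves spanning but says nothing about independence. Spanning and the
  count together give independence in k[u] modulo the multiples of the sum of the u_j, and a dual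
  functional carries it over to \<open>V_r\<close>.

  The obstacle for the filtration is that infinitely many points \<open>t\<close> may satisfy
  \<open>supp s t\<close>, so removing them one at a time need not come to an end. The layers are
  therefore indexed by all lower sets of the total order. Two facts then suffice: every nonempty set
  of such points has a greatest element, which turns unions into members, and coordinates with
  respect to the basis turn intersections of layers into layers of intersections.\<close>

lemma dickson:
  fixes f :: "nat \<Rightarrow> 'a::finite \<Rightarrow> nat"
  shows "\<exists>m n. m < n \<and> (\<forall>j. f m j \<le> f n j)"
proof -
  have sub: "\<exists>\<psi>. strict_mono \<psi> \<and> incseq (\<lambda>n. h (\<psi> n))" for h :: "nat \<Rightarrow> nat"
  proof -
    obtain \<psi> where \<psi>: "strict_mono \<psi>" "monoseq (\<lambda>n. h (\<psi> n))"
      using seq_monosub by blast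
    show ?thesis
    proof (cases "incseq (\<lambda>n. h (\<psi> n))")
      case False
      then have dec: "decseq (\<lambda>n. h (\<psi> n))"
        using \<psi>(2) by (simp add: monoseq_iff)
      define v where "v = (LEAST v. \<exists>n. h (\<psi> n) = v)"
      have "\<exists>n. h (\<psi> n) = v"
        unfolding v_def by (rule LeastI_ex) blast
      then obtain n0 where n0: "h (\<psi> n0) = v" by blast
      have ge: "v \<le> h (\<psi> n)" for n
        unfolding v_def by (rule Least_le) blast
      \<comment> \<open>A decreasing sequence that has reached its least value stays there, so its
        tail is constant and hence also increasing.\<close>
      have "h (\<psi> (n0 + n)) = v" for n
        using ge[of "n0 + n"] decseqD[OF dec, of n0 "n0 + n"] n0 by simp
      then have "incseq (\<lambda>n. h ((\<psi> \<circ> (+) n0) n))"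
        by (simp add: incseq_def)
      moreover have "strict_mono (\<psi> \<circ> (+) n0)"
        using \<psi>(1) by (simp add: strict_mono_def)
      ultimately show ?thesis by blast
    qed (use \<psi> in blast)
  qed
  have "\<exists>\<phi>. strict_mono \<phi> \<and> (\<forall>j\<in>A. incseq (\<lambda>n. f (\<phi> n) j))" if "finite A" for A
    using that
  proof (induction A)
    case empty
    then show ?case using strict_mono_id by blast
  next
    case (insert a A)
    then obtain \<phi> where \<phi>: "strict_mono \<phi>" "\<forall>j\<in>A. incseq (\<lambda>n. f (\<phi> n) j)"
      by blast
    obtain \<psi> where \<psi>: "strict_mono \<psi>" "incseq (\<lambda>n. f (\<phi> (\<psi> n)) a)"
      using sub[of "\<lambda>n. f (\<phi> n) a"] by blast
    have "incseq (\<lambda>n. f (\<phi> (\<psi> n)) j)" if "j \<in> A" for j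
      using \<phi>(2) that strict_mono_less_eq[OF \<psi>(1)] by (simp add: incseq_def)
    then have "strict_mono (\<phi> \<circ> \<psi>) \<and> (\<forall>j\<in>insert a A. incseq (\<lambda>n. f ((\<phi> \<circ> \<psi>) n) j))"
      using \<phi>(1) \<psi> by (simp add: strict_mono_o)
    then show ?case by blast
  qed
  from this[of UNIV] obtain \<phi> where "strict_mono \<phi>" "\<forall>j. incseq (\<lambda>n. f (\<phi> n) j)"
    by auto
  then have "\<phi> 0 < \<phi> 1 \<and> (\<forall>j. f (\<phi> 0) j \<le> f (\<phi> 1) j)"
    by (simp add: strict_mono_def incseq_def)
  then show ?thesis by blast
qed

text \<open>The colour will be the direction of a point: keys can be compared coordinate by
  coordinate only between points of equal direction.\<close>

lemma dickson_coloured: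
  fixes f :: "nat \<Rightarrow> 'a::finite \<Rightarrow> nat" and c :: "nat \<Rightarrow> 'c::finite"
  shows "\<exists>m n. m < n \<and> c m = c n \<and> (\<forall>j. f m j \<le> f n j)"
proof -
  obtain k where k: "infinite {n. c n = k}"
    using pigeonhole_infinite[of UNIV c] by auto
  define h where "h = enumerate {n. c n = k}"
  have h: "strict_mono h" "c (h n) = k" for n
    using k strict_mono_enumerate enumerate_in_set[OF k] by (auto simp: h_def)
  obtain m n where "m < n" "\<forall>j. f (h m) j \<le> f (h n) j"
    using dickson[of "\<lambda>n. f (h n)"] by blast
  then have "h m < h n \<and> c (h m) = c (h n) \<and> (\<forall>j. f (h m) j \<le> f (h n) j)"
    using h by (simp add: strict_mono_def)
  then show ?thesis by blast
qed

section \<open>Lexicographic comparison\<close>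

lemma first_difference:
  fixes f g :: "'r::{finite,linorder} \<Rightarrow> 'b"
  assumes "f \<noteq> g"
  obtains j where "f j \<noteq> g j" "\<forall>k<j. f k = g k"
proof
  let ?D = "{j. f j \<noteq> g j}"
  have ne: "?D \<noteq> {}" using assms by auto
  show "f (Min ?D) \<noteq> g (Min ?D)"
    using Min_in[OF _ ne] by simp
  show "\<forall>k<Min ?D. f k = g k"
    using Min_le[of ?D] by (metis (mono_tags, lifting) finite leD mem_Collect_eq)
qed

definition lexless :: "('r::{finite,linorder} \<Rightarrow> 'b::linorder) \<Rightarrow> ('r \<Rightarrow> 'b) \<Rightarrow> bool" where
  "lexless f g \<longleftrightarrow> (\<exists>j. f j < g j \<and> (\<forall>k<j. f k = g k))"

lemma lexless_irrefl: "\<not> lexless f f"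
  by (simp add: lexless_def)

lemma lexless_trans:
  assumes "lexless f g" "lexless g h"
  shows "lexless f h"
proof -
  obtain i j where i: "f i < g i" "\<forall>k<i. f k = g k" and j: "g j < h j" "\<forall>k<j. g k = h k"
    using assms by (auto simp: lexless_def)
  have "f (min i j) < h (min i j) \<and> (\<forall>k<min i j. f k = h k)"
    using i j by (cases i j rule: linorder_cases) (auto simp: min_def)
  then show ?thesis by (auto simp: lexless_def)
qed

lemma lexless_total:
  assumes "f \<noteq> g"
  shows "lexless f g \<or> lexless g f"
proof -
  obtain j where j: "f j \<noteq> g j" "\<forall>k<j. f k = g k"
    using first_difference[OF assms] .
  then show ?thesis
    unfolding lexless_def by (cases "f j" "g j" rule: linorder_cases) auto
qed

section \<open>Facets in coordinates, and the taxicab distance\<close>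

lemma facet_iff:
  "f \<in> facet i \<longleftrightarrow> (\<forall>j. (j < i \<longrightarrow> f $ j \<in> {0, 1}) \<and> (j = i \<longrightarrow> f $ j = 0) \<and> (i < j \<longrightarrow> f $ j \<in> {0, -1}))"
  (is "_ \<longleftrightarrow> ?R f")
proof -
  have comp: "((\<Sum>j\<in>{..<i}. axis j (a j)) - (\<Sum>j\<in>{i<..}. axis j (a j))) $ k
      = (if k < i then a k else if k = i then 0 else - a k)" for a :: "'a \<Rightarrow> int" and k
    by (auto simp: axis_def sum.delta' cong: if_cong)
  show ?thesis
  proof
    assume "f \<in> facet i"
    then obtain a where "f = (\<Sum>j\<in>{..<i}. axis j (a j)) - (\<Sum>j\<in>{i<..}. axis j (a j))"
      "\<forall>j. a j \<in> {0, 1}"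
      unfolding facet_def by blast
    then show "?R f"
      by (simp only: comp) auto
  next
    assume R: "?R f"
    define a where "a j = \<bar>f $ j\<bar>" for j
    have "f $ k = (if k < i then a k else if k = i then 0 else - a k)" for k
      using R[rule_format, of k] by (cases k i rule: linorder_cases) (auto simp: a_def)
    then have "f = (\<Sum>j\<in>{..<i}. axis j (a j)) - (\<Sum>j\<in>{i<..}. axis j (a j))"
      by (simp only: vec_eq_iff comp) simp
    moreover have "\<forall>j. a j \<in> {0, 1}"
    proof
      fix j show "a j \<in> {0, 1}"
        using R[rule_format, of j] by (cases j i rule: linorder_cases) (auto simp: a_def)
    qed
    ultimately show "f \<in> facet i"
      unfolding facet_def by blast
  qed
qed

definition dist1 :: "(int, 'r::finite) vec \<Rightarrow> (int, 'r) vec \<Rightarrow> nat" where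
  "dist1 x y = (\<Sum>j\<in>UNIV. nat \<bar>x $ j - y $ j\<bar>)"

lemma dist1_axis_less:
  assumes "x $ j < y $ j"
  shows "dist1 (x + axis j 1) y < dist1 x y"
  unfolding dist1_def using assms
  by (intro sum_strict_mono_ex1) (auto simp: axis_def)

lemma dist1_axis_less':
  assumes "y $ j < x $ j"
  shows "dist1 (x - axis j 1) y < dist1 x y"
  unfolding dist1_def using assms
  by (intro sum_strict_mono_ex1) (auto simp: axis_def)

section \<open>The direction of a point of a Cubist set\<close>

locale cubist =
  fixes I X :: "(int ^ 'r::{finite,linorder}) set"
  assumes ideal: "is_ideal I"
    and mem_X: "x \<in> X \<longleftrightarrow> x \<in> I \<and> x + vec 1 \<notin> I"
begin

lemma idealD: "x \<in> I \<Longrightarrow> (\<And>j. y $ j \<le> x $ j) \<Longrightarrow> y \<in> I"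
  using ideal by (auto simp: is_ideal_def less_eq_vec_def)

text \<open>The points \<open>x + before i\<close> are the starting points of the steps of the
  monotone path from \<open>x\<close> to \<open>x + vec 1\<close>; also, \<open>x + before i\<close>
  is the greatest point of \<open>x + facet i\<close>.\<close>

definition before :: "'r \<Rightarrow> (int, 'r) vec" where
  "before i = (\<chi> j. of_bool (j < i))"

lemma before_nth [simp]: "before i $ j = of_bool (j < i)"
  by (simp add: before_def)

text \<open>The step in direction \<open>i\<close> is the one that leaves \<open>I\<close>. By
  \<open>facet_in_X_iff\<close> this reduces the inclusion of a whole facet to two memberships in
  \<open>I\<close>.\<close>

definition has_dir :: "(int, 'r) vec \<Rightarrow> 'r \<Rightarrow> bool" where
  "has_dir x i \<longleftrightarrow> x + before i \<in> I \<and> x + before i + axis i 1 \<notin> I"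

definition dir :: "(int, 'r) vec \<Rightarrow> 'r" where
  "dir x = (THE i. has_dir x i)"

lemma before_less: "i < k \<Longrightarrow> x + before k \<in> I \<Longrightarrow> x + before i + axis i 1 \<in> I"
  by (erule idealD) (auto simp: axis_def)

lemma has_dir_unique: "has_dir x i \<Longrightarrow> has_dir x k \<Longrightarrow> i = k"
  by (metis before_less has_dir_def linorder_neqE)

lemma has_dir_X:
  assumes "has_dir x i"
  shows "x \<in> X"
proof -
  have "x \<in> I"
    using assms by (intro idealD[of "x + before i" x]) (auto simp: has_dir_def)
  moreover have "x + before i + axis i 1 \<in> I" if "x + vec 1 \<in> I"
    using that by (rule idealD) (auto simp: axis_def)
  ultimately show ?thesis
    using assms by (auto simp: mem_X has_dir_def)
qed

text \<open>Take the first step that ends outside \<open>I\<close>. It starts at \<open>x\<close> or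
  at the end of the preceding step, and both lie in \<open>I\<close>.\<close>

lemma has_dir_exists:
  assumes "x \<in> X"
  shows "\<exists>i. has_dir x i"
proof -
  let ?D = "{i. x + before i + axis i 1 \<notin> I}"
  have "before (Max UNIV) + axis (Max UNIV) 1 = (vec 1 :: (int, 'r) vec)"
    by (auto simp: vec_eq_iff axis_def not_less intro: antisym)
  then have ne: "?D \<noteq> {}"
    using assms unfolding mem_X by (metis (mono_tags, lifting) add.assoc empty_iff mem_Collect_eq)
  define i where "i = Min ?D"
  have i: "i \<in> ?D" using Min_in[OF _ ne] by (simp add: i_def)
  have lt: "x + before k + axis k 1 \<in> I" if "k < i" for k
    using Min_le[of ?D k] that unfolding i_def by (metis (mono_tags, lifting) finite leD mem_Collect_eq)
  have "x + before i \<in> I"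
  proof (cases "{..<i} = {}")
    case True
    then have "before i = 0" by (auto simp: vec_eq_iff)
    then show ?thesis using assms by (simp add: mem_X)
  next
    case False
    define k where "k = Max {..<i}"
    have k: "k < i" "\<And>j. j < i \<Longrightarrow> j \<le> k"
      using Max_in[of "{..<i}"] False by (auto simp: k_def)
    then have "x + before i = x + before k + axis k 1"
      by (auto simp: vec_eq_iff axis_def) (meson le_less not_le)
    then show ?thesis using lt[OF k(1)] by metis
  qed
  then show ?thesis using i by (auto simp: has_dir_def)
qed

lemma dir_eq: "has_dir x i \<Longrightarrow> dir x = i"
  unfolding dir_def using has_dir_unique by blast

lemma dir: "x \<in> X \<Longrightarrow> has_dir x (dir x)"
  using has_dir_exists dir_eq by metis

lemma has_dirD: "has_dir x i \<Longrightarrow> x + before i \<in> I" "has_dir x i \<Longrightarrow> x + before i + axis i 1 \<notin> I"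
  by (simp_all add: has_dir_def)

text \<open>The cube \<open>x + facet i\<close> has greatest point \<open>x + before i\<close>, and
  its least point shifted by \<open>vec 1\<close> is \<open>x + before i + axis i 1\<close>. As
  \<open>I\<close> is an ideal, these two extreme points decide for the whole cube.\<close>

lemma facet_in_X_iff:
  assumes "x \<in> X"
  shows "(+) x ` facet i \<subseteq> X \<longleftrightarrow> has_dir x i"
proof
  assume sub: "(+) x ` facet i \<subseteq> X"
  have "before i \<in> facet i"
    by (auto simp: facet_iff)
  then have 1: "x + before i \<in> I" using sub mem_X by blast
  have "(\<chi> j. - of_bool (i < j)) \<in> facet i"
    by (auto simp: facet_iff)
  then have "x + (\<chi> j. - of_bool (i < j)) \<in> X" using sub by blast
  then have "x + (\<chi> j. - of_bool (i < j)) + vec 1 \<notin> I" using mem_X by blast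
  moreover have "x + (\<chi> j. - of_bool (i < j)) + vec 1 = x + before i + axis i 1"
    by (auto simp: vec_eq_iff axis_def)
  ultimately show "has_dir x i" using 1 unfolding has_dir_def by metis
next
  assume d: "has_dir x i"
  show "(+) x ` facet i \<subseteq> X"
  proof clarify
    fix f :: "(int, 'r) vec" assume f: "f \<in> facet i"
    note f' = f[unfolded facet_iff, rule_format]
    have "f $ j \<le> before i $ j \<and> (before i + axis i 1) $ j \<le> f $ j + 1" for j
      using f'[of j] by (cases j i rule: linorder_cases) (auto simp: axis_def)
    then have "x + f \<in> I" "\<not> x + f + vec 1 \<in> I"
      using has_dirD[OF d] idealD[of "x + before i" "x + f"]
        idealD[of "x + f + vec 1" "x + before i + axis i 1"] by (auto simp: add.assoc)
    then show "x + f \<in> X" by (simp add: mem_X)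
  qed
qed

lemma lam_eq: "x \<in> X \<Longrightarrow> lam X x = (+) x ` facet (dir x)"
  by (simp add: lam_def dir_def facet_in_X_iff)

lemma lam_subset: "x \<in> X \<Longrightarrow> lam X x \<subseteq> X"
  using lam_eq facet_in_X_iff dir by metis

lemma lam_up: "x \<in> X \<Longrightarrow> j < dir x \<Longrightarrow> x + axis j 1 \<in> lam X x"
  by (simp add: lam_eq) (auto simp: facet_iff axis_def intro!: image_eqI[of _ _ "axis j 1"])

lemma lam_down: "x \<in> X \<Longrightarrow> dir x < j \<Longrightarrow> x - axis j 1 \<in> lam X x"
  by (simp add: lam_eq) (auto simp: facet_iff axis_def intro!: image_eqI[of _ _ "- axis j 1"])

section \<open>Supports, and a total refinement of the standard order\<close>

definition supp :: "(int, 'r) vec \<Rightarrow> (int, 'r) vec \<Rightarrow> bool" where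
  "supp y t \<longleftrightarrow> (\<forall>j. (j < dir t \<longrightarrow> y $ j \<le> t $ j) \<and> (dir t < j \<longrightarrow> t $ j \<le> y $ j))"

lemma supp_refl: "supp t t"
  by (simp add: supp_def)

text \<open>Comparing keys lexicographically, smaller keys being higher, refines the standard order to a
  total order. The parity of the key at \<open>j \<le> dir x\<close> makes ties in \<open>x $ j\<close> go by whether \<open>j < dir x\<close>.\<close>

definition key :: "(int, 'r) vec \<Rightarrow> 'r \<Rightarrow> int" where
  "key x j = (if j < dir x then 2 * x $ j + 1 else if j = dir x then 2 * x $ j else - x $ j)"

definition below :: "(int, 'r) vec \<Rightarrow> (int, 'r) vec \<Rightarrow> bool" where
  "below x y \<longleftrightarrow> lexless (key y) (key x)"

lemma below_irrefl: "\<not> below x x"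
  by (simp add: below_def lexless_irrefl)

lemma below_trans: "below x y \<Longrightarrow> below y z \<Longrightarrow> below x z"
  unfolding below_def by (rule lexless_trans)

text \<open>Parity separates directions: at the smaller of two distinct directions one key is even
  and the other odd. With equal directions the coordinates can be read off.\<close>

lemma key_inj:
  assumes "key x = key y"
  shows "x = y"
proof -
  have "\<not> dir x < dir y" if "key x = key y" for x y
    using fun_cong[OF that, of "dir x"] by (auto simp: key_def) presburger
  then have d: "dir x = dir y"
    using assms by (metis linorder_neqE)
  have "x $ j = y $ j" for j
    using fun_cong[OF assms, of j] d by (auto simp: key_def split: if_splits)
  then show ?thesis by (simp add: vec_eq_iff)
qed

lemma below_total: "x \<noteq> y \<Longrightarrow> below x y \<or> below y x"
  unfolding below_def using lexless_total key_inj by metis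

text \<open>The first coordinate \<open>j\<close> in which \<open>y\<close> differs from
  \<open>x\<close> decides, except when \<open>j > dir x\<close> and the direction also grows; then
  coordinate \<open>dir x\<close> decides, where the key turns from even to odd.\<close>

lemma below_move:
  assumes x: "x \<in> X" and y: "y \<in> lam X x" "y \<noteq> x"
  shows "below y x"
proof -
  define i where "i = dir x"
  obtain f where f: "f \<in> facet i" "y = x + f"
    using y(1) lam_eq[OF x] by (auto simp: i_def)
  note f' = f(1)[unfolded facet_iff, rule_format]
  have yX: "y \<in> X" using lam_subset[OF x] y(1) by blast
  have "vec_nth f \<noteq> (\<lambda>_. 0)" using y(2) f(2) by (auto simp: vec_eq_iff)
  then obtain j where j: "f $ j \<noteq> 0" "\<forall>k<j. f $ k = 0"
    by (rule first_difference)
  have dx: "x + before i \<in> I" using dir[OF x] by (simp add: has_dir_def i_def)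
  have dir_ge: "k \<le> dir y" if "y + before k \<in> I" for k
    using before_less[of "dir y" k y] dir[OF yX] that by (meson has_dirD(2) not_le)
  show ?thesis
  proof (cases "j < i")
    case True
    then have fj: "f $ j = 1" using f'[of j] j(1) by auto
    have "y + before j \<in> I"
    proof (rule idealD[OF dx])
      fix k show "(y + before j) $ k \<le> (x + before i) $ k"
        using True j(2)[rule_format, of k] f'[of k] f(2)
        by (cases k i rule: linorder_cases; cases "k < j") auto
    qed
    then have ij: "j \<le> dir y" by (rule dir_ge)
    have "key x k = key y k" if "k < j" for k
      using that ij True j(2)[rule_format, OF that] f(2) by (auto simp: key_def i_def)
    \<comment> \<open>The move raises \<open>2 * x $ j\<close> by 2, which outweighs the summand 1
      that is lost if \<open>dir y = j\<close>.\<close>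
    moreover have "key x j < key y j"
      using ij True fj f(2) by (auto simp: key_def i_def)
    ultimately show ?thesis unfolding below_def lexless_def by blast
  next
    case False
    then have ij: "i < j" using f'[of j] j(1) by (metis linorder_neqE)
    have fneg: "f $ k \<le> 0" for k
      using ij j(2)[rule_format, of k] f'[of k] by (cases k i rule: linorder_cases) auto
    have "y + before i \<in> I"
      by (rule idealD[OF dx]) (use f(2) fneg in auto)
    then have iy: "i \<le> dir y" by (rule dir_ge)
    have eq: "key x k = key y k" if "k < i" for k
      using that iy ij j(2)[rule_format, of k] f(2) by (auto simp: key_def i_def)
    show ?thesis
    proof (cases "dir y = i")
      case True
      have "key x k = key y k" if "k < j" for k
        using that iy ij j(2)[rule_format, of k] f(2) True by (auto simp: key_def i_def)
      moreover have "key x j < key y j"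
        using ij True f(2) f'[of j] j(1) by (auto simp: key_def i_def)
      ultimately show ?thesis unfolding below_def lexless_def by blast
    next
      case False
      then have "key x i < key y i"
        using iy j(2)[rule_format, OF ij] f(2) by (auto simp: key_def i_def)
      then show ?thesis using eq unfolding below_def lexless_def by blast
    qed
  qed
qed

text \<open>The step is a unit step in one coordinate that brings \<open>y\<close> nearer to
  \<open>t\<close> and stays in \<open>lam X y\<close>. If there is none, \<open>y\<close> and
  \<open>t\<close> agree in all coordinates that are smaller than both directions or larger than
  both, and then the places where their paths leave \<open>I\<close> contradict each other unless
  \<open>y = t\<close>.\<close>

lemma supp_step:
  assumes y: "y \<in> X" and t: "t \<in> X" and yt: "supp y t" "y \<noteq> t"
  shows "\<exists>z\<in>lam X y. supp z t \<and> dist1 z t < dist1 y t"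
proof -
  define i k where "i = dir t" and "k = dir y"
  note dt = has_dirD[OF dir[OF t], folded i_def] and dy = has_dirD[OF dir[OF y], folded k_def]
  have yt': "\<And>j. j < i \<Longrightarrow> y $ j \<le> t $ j" "\<And>j. i < j \<Longrightarrow> t $ j \<le> y $ j"
    using yt by (auto simp: supp_def i_def)
  have up: ?thesis if "j < k" "j \<le> i" "y $ j < t $ j" for j
    using that yt(1) dist1_axis_less[of y j t] lam_up[OF y, of j]
    by (intro bexI[of _ "y + axis j 1"]) (auto simp: supp_def i_def k_def axis_def)
  have down: ?thesis if "k < j" "i \<le> j" "t $ j < y $ j" for j
    using that yt(1) dist1_axis_less'[of t j y] lam_down[OF y, of j]
    by (intro bexI[of _ "y - axis j 1"]) (auto simp: supp_def i_def k_def axis_def)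
  show ?thesis
  proof (rule ccontr)
    assume no: "\<not> ?thesis"
    have lo: "y $ j = t $ j" if "j < k" "j < i" for j
      using up[of j] no that yt'(1)[of j] by force
    have hi: "y $ j = t $ j" if "k < j" "i < j" for j
      using down[of j] no that yt'(2)[of j] by force
    consider "k = i" | "k < i" | "i < k" by (rule linorder_cases)
    then show False
    proof cases
      case 1
      have eq: "y $ j = t $ j" if "j \<noteq> i" for j
        using lo[of j] hi[of j] 1 that by (metis linorder_neqE)
      have "\<not> y $ i < t $ i"
        using dy(2) idealD[OF dt(1), of "y + before k + axis k 1"] eq 1 by (force simp: axis_def)
      moreover have "\<not> t $ i < y $ i"
        using dt(2) idealD[OF dy(1), of "t + before i + axis i 1"] eq 1 by (force simp: axis_def)
      ultimately have "y = t" using eq by (metis linorder_neqE vec_eq_iff)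
      then show False using yt(2) by simp
    next
      case 2
      \<comment> \<open>Now \<open>y\<close> is at most \<open>t\<close> in every coordinate. The
        step by which the path of \<open>y\<close> leaves \<open>I\<close> would therefore end below
        \<open>t + before i\<close>, which is in \<open>I\<close>.\<close>
      have yi: "y $ i \<le> t $ i" using down[of i] no 2 by force
      have "y $ j \<le> t $ j" for j
        using yi hi[of j] yt'(1)[of j] 2 by (cases j i rule: linorder_cases) auto
      then have "y + before k + axis k 1 \<in> I"
        using 2 by (intro idealD[OF dt(1)]) (auto simp: axis_def add_mono)
      then show False using dy(2) by simp
    next
      case 3
      have yi: "t $ i \<le> y $ i" using up[of i] no 3 by force
      have "t $ j \<le> y $ j" for j
        using yi lo[of j] yt'(2)[of j] 3 by (cases j i rule: linorder_cases) auto
      then have "t + before i + axis i 1 \<in> I"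
        using 3 by (intro idealD[OF dy(1)]) (auto simp: axis_def add_mono)
      then show False using dt(2) by simp
    qed
  qed
qed

lemma supp_imp_order:
  assumes "y \<in> X" "t \<in> X" "supp y t"
  shows "(t, y) \<in> standard_order X"
proof -
  have "(t, y) \<in> {(y, x). x \<in> X \<and> y \<in> lam X x}\<^sup>*"
    using assms(1,3)
  proof (induction "dist1 y t" arbitrary: y rule: less_induct)
    case less
    show ?case
    proof (cases "y = t")
      case False
      then obtain z where z: "z \<in> lam X y" "supp z t" "dist1 z t < dist1 y t"
        using supp_step less.prems assms(2) by blast
      then have "z \<in> X" using lam_subset less.prems(1) by blast
      then have "(t, z) \<in> {(y, x). x \<in> X \<and> y \<in> lam X x}\<^sup>*"
        using less.hyps z by blast
      moreover have "(z, y) \<in> {(y, x). x \<in> X \<and> y \<in> lam X x}"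
        using z(1) less.prems(1) by simp
      ultimately show ?thesis by (rule rtrancl_into_rtrancl)
    qed simp
  qed
  then show ?thesis using assms by (simp add: standard_order_def)
qed

lemma order_imp_below:
  assumes "(y, x) \<in> standard_order X" "y \<noteq> x"
  shows "below y x"
proof -
  have "(y, x) \<in> {(y, x). x \<in> X \<and> y \<in> lam X x}\<^sup>*"
    using assms(1) by (simp add: standard_order_def)
  then have "y = x \<or> below y x"
  proof induction
    case (step z w)
    then show ?case using below_move[of w z] below_trans[of y z w] by auto
  qed simp
  then show ?thesis using assms(2) by simp
qed

lemma partial_order_standard_order: "partial_order_on X (standard_order X)"
proof -
  have "antisym (standard_order X)"
  proof (rule antisymI)
    fix x y
    assume "(x, y) \<in> standard_order X" "(y, x) \<in> standard_order X"
    then show "x = y"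
      using order_imp_below[of x y] order_imp_below[of y x] below_trans[of x y x] below_irrefl
      by auto
  qed
  moreover have "trans (standard_order X)"
    unfolding standard_order_def by (intro trans_Restr trans_rtrancl)
  moreover have "refl_on X (standard_order X)" "standard_order X \<subseteq> X \<times> X"
    by (auto simp: standard_order_def refl_on_def)
  ultimately show ?thesis
    by (simp add: partial_order_on_def preorder_on_def)
qed

text \<open>In an infinite ascending chain some later point has the same direction \<open>i\<close>
  as an earlier one and is at least as far from \<open>s\<close> in every coordinate. The side of
  \<open>s\<close> is fixed by the support condition, so off \<open>i\<close> this cannot make the
  key smaller. The decrease must occur in coordinate \<open>i\<close>, and then the later path
  leaves \<open>I\<close> at a point that lies below a point of \<open>I\<close>.\<close>

lemma supported_has_top:
  assumes T: "T \<subseteq> {t \<in> X. supp s t}" and ne: "T \<noteq> {}"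
  shows "\<exists>t\<in>T. \<forall>u\<in>T. u = t \<or> below u t"
proof -
  define r where "r = {(x, y). x \<in> T \<and> y \<in> T \<and> below y x}"
  have "wf r"
    unfolding wf_iff_no_infinite_down_chain
  proof
    assume "\<exists>f. \<forall>i. (f (Suc i), f i) \<in> r"
    then obtain f where f: "\<And>i. (f (Suc i), f i) \<in> r" by blast
    have fT: "f n \<in> T" for n using f[of n] by (simp add: r_def)
    have chain: "below (f m) (f n)" if "m < n" for m n
      using that
    proof (induction n)
      case (Suc n)
      then show ?case using f[of n] below_trans[of "f m" "f n" "f (Suc n)"]
        by (cases "m = n") (auto simp: r_def)
    qed simp
    obtain m n where mn: "m < n" "dir (f m) = dir (f n)"
      and le: "\<And>j. nat \<bar>f m $ j - s $ j\<bar> \<le> nat \<bar>f n $ j - s $ j\<bar> \<or> j = dir (f m)"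
      using dickson_coloured[of "\<lambda>n. dir (f n)" "\<lambda>n j. nat \<bar>f n $ j - s $ j\<bar>"] by blast
    define i where "i = dir (f m)"
    have sm: "f m \<in> X" "supp s (f m)" and sn: "f n \<in> X" "supp s (f n)"
      using fT T by auto
    have lo: "f m $ j \<le> f n $ j" if "j < i" for j
      using le[of j] that sm(2) sn(2) mn(2) by (force simp: supp_def i_def)
    have hi: "f n $ j \<le> f m $ j" if "i < j" for j
      using le[of j] that sm(2) sn(2) mn(2) by (force simp: supp_def i_def)
    obtain j where j: "key (f n) j < key (f m) j" "\<forall>k<j. key (f n) k = key (f m) k"
      using chain[OF mn(1)] by (auto simp: below_def lexless_def)
    have ij: "i \<le> j"
    proof (rule leI, rule notI)
      assume "j < i"
      then show False using j(1) lo[of j] mn(2) by (simp add: key_def i_def)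
    qed
    have ij': "j \<le> i"
    proof (rule leI, rule notI)
      assume "i < j"
      then show False using j(1) hi[of j] mn(2) by (auto simp: key_def i_def split: if_splits)
    qed
    have "j = i" using ij ij' by simp
    have "f m $ k = f n $ k" if "k < i" for k
      using j(2)[rule_format, of k] \<open>j = i\<close> that mn(2) by (simp add: key_def i_def)
    moreover have "f n $ i < f m $ i"
      using j(1) \<open>j = i\<close> mn(2) by (simp add: key_def i_def)
    ultimately have "(f n + before i + axis i 1) $ k \<le> (f m + before i) $ k" for k
      using hi[of k] by (cases k i rule: linorder_cases) (auto simp: axis_def)
    then have "f n + before i + axis i 1 \<in> I"
      using idealD has_dirD(1)[OF dir[OF sm(1)]] unfolding i_def by blast
    then show False
      using has_dirD(2)[OF dir[OF sn(1)]] mn(2) by (simp add: i_def)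
  qed
  then obtain t where t: "t \<in> T" "\<And>u. (u, t) \<in> r \<Longrightarrow> u \<notin> T"
    using ne wfE_min[of r] by (metis equals0I)
  have "u = t \<or> below u t" if "u \<in> T" for u
    using t(2)[of u] that t(1) below_total[of u t] by (auto simp: r_def)
  then show ?thesis using t(1) by blast
qed

end

section \<open>Counting facets\<close>

lemma finite_box: "finite {v :: (int, 'r::finite) vec. \<forall>j. a j \<le> v $ j \<and> v $ j \<le> b j}"
proof -
  have "vec_nth ` {v :: (int, 'r) vec. \<forall>j. a j \<le> v $ j \<and> v $ j \<le> b j} \<subseteq> PiE UNIV (\<lambda>j. {a j..b j})"
    by auto
  then show ?thesis
    by (rule finite_imageD[OF finite_subset]) (auto simp: inj_on_def vec_nth_inject intro: finite_PiE)
qed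

definition weight :: "(nat, 'r::finite) vec \<Rightarrow> nat" where
  "weight n = (\<Sum>j\<in>UNIV. n $ j)"

lemma weight_axis [simp]: "weight (n + axis i (Suc 0)) = Suc (weight n)"
  by (simp add: weight_def sum.distrib axis_def)

lemma weight_le: "n $ j \<le> weight n"
  unfolding weight_def by (rule member_le_sum) auto

lemma finite_weight: "finite {n :: (nat, 'r::finite) vec. weight n = d}"
proof -
  have "vec_nth ` {n :: (nat, 'r) vec. weight n = d} \<subseteq> PiE UNIV (\<lambda>j. {0..d})"
    using weight_le by auto
  then show ?thesis
    by (rule finite_imageD[OF finite_subset]) (auto simp: inj_on_def vec_nth_inject intro: finite_PiE)
qed

text \<open>The index set is an arbitrary finite linear order, so the telescoping proceeds by
  adjoining maximal elements to initial segments.\<close>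

lemma sum_telescope_atMost:
  fixes F :: "'r::{finite,linorder} set \<Rightarrow> 'a::ab_group_add"
  shows "(\<Sum>i\<in>UNIV. F {..<i} - F {..i}) = F {} - F UNIV"
proof -
  have "(\<forall>x\<in>A. \<forall>y<x. y \<in> A) \<longrightarrow> (\<Sum>i\<in>A. F {..<i} - F {..i}) = F {} - F A" if "finite A" for A
    using that
  proof (induction rule: finite_linorder_max_induct)
    case empty
    then show ?case by simp
  next
    case (insert b A)
    show ?case
    proof
      assume down: "\<forall>x\<in>insert b A. \<forall>y<x. y \<in> insert b A"
      have A: "A = {..<b}"
        using insert.hyps(2) down by auto
      then have "\<forall>x\<in>A. \<forall>y<x. y \<in> A" by auto
      moreover have "insert b {..<b} = {..b}" by auto
      ultimately have "insert b A = {..b}" "(\<Sum>i\<in>A. F {..<i} - F {..i}) = F {} - F {..<b}"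
        using insert.IH A by auto
      then show "(\<Sum>i\<in>insert b A. F {..<i} - F {..i}) = F {} - F (insert b A)"
        using insert.hyps A by (subst sum.insert) auto
    qed
  qed
  from this[of UNIV] show ?thesis by simp
qed

text \<open>The exponent of the monomial in $u_j = a_j b_j$ that measures the detour made by a geodesic
  from \<open>y\<close> to \<open>t\<close> followed by a geodesic from \<open>t\<close> to \<open>s\<close>.\<close>

definition detour :: "(int, 'r::finite) vec \<Rightarrow> (int, 'r) vec \<Rightarrow> (int, 'r) vec \<Rightarrow> (nat, 'r) vec" where
  "detour y t s = (\<chi> j. nat (t $ j - max (y $ j) (s $ j)) + nat (min (y $ j) (s $ j) - t $ j))"

lemma detour_nth: "detour y t s $ j = nat (t $ j - max (y $ j) (s $ j)) + nat (min (y $ j) (s $ j) - t $ j)"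
  by (simp add: detour_def)

lemma finite_detour: "finite {t. weight (detour y t s) \<le> d}"
proof -
  have "{t. weight (detour y t s) \<le> d}
      \<subseteq> {t. \<forall>j. min (y $ j) (s $ j) - int d \<le> t $ j \<and> t $ j \<le> max (y $ j) (s $ j) + int d}"
  proof (intro subsetI CollectI allI)
    fix t j assume "t \<in> {t. weight (detour y t s) \<le> d}"
    then have "detour y t s $ j \<le> d"
      using weight_le[of "detour y t s" j] by simp
    then show "min (y $ j) (s $ j) - int d \<le> t $ j \<and> t $ j \<le> max (y $ j) (s $ j) + int d"
      unfolding detour_nth by linarith
  qed
  then show ?thesis by (rule finite_subset) (rule finite_box)
qed

lemma card_disjoint_Un3:
  assumes "finite S" "S = A \<union> B \<union> C" "A \<inter> B = {}" "A \<inter> C = {}" "B \<inter> C = {}"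
  shows "card S = card A + card B + card C"
  using assms by (simp add: card_Un_disjoint Int_Un_distrib2)

context cubist
begin

section \<open>Detour monomials: spanning and counting\<close>

definition tops :: "(int, 'r) vec \<Rightarrow> (int, 'r) vec \<Rightarrow> (int, 'r) vec set" where
  "tops y s = {t \<in> X. supp y t \<and> supp s t}"

text \<open>The relation is taken modulo an arbitrary \<open>Z\<close> so that the result serves
  both k[u], where \<open>Z\<close> consists of multiples of the sum of the u_j, and
  \<open>V_r\<close>, where the relation holds exactly. The bound on the detour says that the
  monomial \<open>e\<close> factors through \<open>t\<close>; the rewriting moves \<open>t\<close>
  down until nothing but a detour is left.\<close>

lemma monomial_in_span:
  fixes scale :: "'k::field \<Rightarrow> 'b::ab_group_add \<Rightarrow> 'b" and f :: "(nat, 'r) vec \<Rightarrow> 'b"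
  assumes vs: "vector_space scale"
    and rel: "\<And>n. weight n + 1 = d \<Longrightarrow> (\<Sum>i\<in>UNIV. f (n + axis i 1)) \<in> Z"
    and "t \<in> X" "\<And>j. detour y t s $ j \<le> e $ j" "weight e = d"
  shows "f e \<in> module.span scale
    ({f (detour y u s) | u. u \<in> tops y s \<and> (u = t \<or> below u t) \<and> weight (detour y u s) = d} \<union> Z)"
  using assms(3-)
\<comment> \<open>Infinitely many points may lie below \<open>t\<close>; only finitely many of them
  have a detour of weight at most \<open>d\<close>.\<close>
proof (induction "card {u. below u t \<and> weight (detour y u s) \<le> d}" arbitrary: t e rule: less_induct)
  case less
  interpret vector_space scale by (rule vs)
  let ?S = "\<lambda>t. {f (detour y u s) | u. u \<in> tops y s \<and> (u = t \<or> below u t) \<and> weight (detour y u s) = d} \<union> Z"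
  define i where "i = dir t"
  have step: "f e' \<in> span (?S t)"
    if z: "z \<in> lam X t" "z \<noteq> t" "\<And>j. detour y z s $ j \<le> e' $ j" "weight e' = d" for z e'
  proof -
    have zt: "below z t" using below_move[OF \<open>t \<in> X\<close> z(1,2)] .
    have zX: "z \<in> X" using lam_subset[OF \<open>t \<in> X\<close>] z(1) by blast
    have zd: "weight (detour y z s) \<le> d"
      unfolding z(4)[symmetric] weight_def by (rule sum_mono) (rule z(3))
    have "{u. below u z \<and> weight (detour y u s) \<le> d} \<subset> {u. below u t \<and> weight (detour y u s) \<le> d}"
      using zt zd below_trans below_irrefl by blast
    moreover have "finite {u. below u t \<and> weight (detour y u s) \<le> d}"
      by (rule finite_subset[OF _ finite_detour[of y s d]]) auto
    ultimately have "f e' \<in> span (?S z)"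
      using less.hyps[OF psubset_card_mono] zX z(3,4) by blast
    moreover have "?S z \<subseteq> ?S t" using zt below_trans by blast
    ultimately show ?thesis using span_mono by blast
  qed
  \<comment> \<open>A unit step of \<open>t\<close> in coordinate \<open>j\<close> lengthens the
    detour there by at most one. This is paid for by a surplus of \<open>e'\<close> at
    \<open>j\<close>, or costs nothing while \<open>t\<close> has not yet passed both
    \<open>y\<close> and \<open>s\<close>.\<close>
  have up: "f e' \<in> span (?S t)"
    if "j < i" "detour y t s $ j < e' $ j \<or> t $ j < max (y $ j) (s $ j)"
      "\<And>k. detour y t s $ k \<le> e' $ k" "weight e' = d" for j e'
  proof (rule step)
    show "t + axis j 1 \<in> lam X t" using lam_up \<open>t \<in> X\<close> that(1) by (simp add: i_def)
    show "t + axis j 1 \<noteq> t" by (simp add: vec_eq_iff axis_def)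
    show "detour y (t + axis j 1) s $ k \<le> e' $ k" for k
      using that(2) that(3)[of k] by (auto simp: detour_nth axis_def)
  qed fact
  have down: "f e' \<in> span (?S t)"
    if "i < j" "detour y t s $ j < e' $ j \<or> min (y $ j) (s $ j) < t $ j"
      "\<And>k. detour y t s $ k \<le> e' $ k" "weight e' = d" for j e'
  proof (rule step)
    show "t - axis j 1 \<in> lam X t" using lam_down \<open>t \<in> X\<close> that(1) by (simp add: i_def)
    show "t - axis j 1 \<noteq> t" by (simp add: vec_eq_iff axis_def)
    show "detour y (t - axis j 1) s $ k \<le> e' $ k" for k
      using that(2) that(3)[of k] by (auto simp: detour_nth axis_def)
  qed fact
  have off: "f e' \<in> span (?S t)"
    if "j \<noteq> i" "detour y t s $ j < e' $ j"
      "\<And>k. detour y t s $ k \<le> e' $ k" "weight e' = d" for j e'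
    using up[of j e'] down[of j e'] that by (cases j i rule: linorder_cases) auto
  show ?case
  proof (cases "supp y t \<and> supp s t")
    case False
    then obtain j where "(j < i \<and> t $ j < max (y $ j) (s $ j)) \<or> (i < j \<and> min (y $ j) (s $ j) < t $ j)"
      unfolding supp_def i_def by (auto simp: not_le less_max_iff_disj min_less_iff_disj)
    then show ?thesis using up[of j e] down[of j e] less.prems by blast
  next
    case True
    then have t: "t \<in> tops y s" using less.prems by (simp add: tops_def)
    consider "e = detour y t s" | j where "j \<noteq> i" "detour y t s $ j < e $ j"
      | "\<And>j. j \<noteq> i \<Longrightarrow> detour y t s $ j = e $ j" "detour y t s $ i < e $ i"
      using less.prems(2) by (metis le_neq_implies_less vec_eq_iff)
    then show ?thesis
    proof cases
      case 1
      then have "f e \<in> ?S t" using t less.prems(3) by auto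
      then show ?thesis by (rule span_base)
    next
      case 2
      then show ?thesis using off less.prems by blast
    next
      case 3
      \<comment> \<open>The only surplus is in direction \<open>i\<close>, in which the facet of
        \<open>t\<close> does not extend. The relation trades one factor u_i for the other u_k, and
        each of these gives a surplus at some \<open>k \<noteq> i\<close>.\<close>
      define n where "n = e - axis i 1"
      have e: "e = n + axis i 1"
        using 3(2) by (auto simp: n_def vec_eq_iff axis_def)
      have nd: "weight n + 1 = d" using e less.prems(3) by simp
      have "f (n + axis k 1) \<in> span (?S t)" if "k \<noteq> i" for k
      proof (rule off[OF that])
        show "detour y t s $ k < (n + axis k 1) $ k"
          using 3(1)[OF that] that by (simp add: n_def axis_def)
        show "detour y t s $ j \<le> (n + axis k 1) $ j" for j
          using 3(1)[of j] 3(2) by (cases "j = i") (auto simp: n_def axis_def)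
        show "weight (n + axis k 1) = d" using nd by simp
      qed
      then have "(\<Sum>k\<in>UNIV - {i}. f (n + axis k 1)) \<in> span (?S t)"
        by (intro span_sum) auto
      moreover have "(\<Sum>k\<in>UNIV. f (n + axis k 1)) \<in> span (?S t)"
        using rel[OF nd] by (intro span_base) auto
      moreover have "f e = (\<Sum>k\<in>UNIV. f (n + axis k 1)) - (\<Sum>k\<in>UNIV - {i}. f (n + axis k 1))"
        by (subst sum.remove[of UNIV i]) (simp_all add: e)
      ultimately show ?thesis by (simp add: span_diff)
    qed
  qed
qed


text \<open>A facet of the boundary of \<open>I\<close> in direction \<open>i\<close> is a point of \<open>I\<close> whose translate by the
  \<open>i\<close>-th unit vector leaves \<open>I\<close>. So the number of facets in a region is a sum of differences
  of the indicator function of \<open>I\<close>, to which a discrete divergence theorem applies; only the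
  points of \<open>I\<close> below both \<open>y\<close> and \<open>s\<close> survive.\<close>

lemma card_tops:
  assumes y: "y \<in> X" and s: "s \<in> X"
  shows "card {t \<in> tops y s. weight (detour y t s) = d} + card {n :: (nat, 'r) vec. weight n + 1 = d}
    = card {n :: (nat, 'r) vec. weight n = d}"
proof -
  define M m where "M j = max (y $ j) (s $ j)" and "m j = min (y $ j) (s $ j)" for j
  have mM: "m j \<le> M j" for j by (simp add: m_def M_def)
  \<comment> \<open>Here \<open>w\<close> stands for \<open>t + before i\<close>, whose coordinates
    below \<open>i\<close> are raised by one; the \<open>- 1\<close> undoes this. Coordinate
    \<open>i\<close> was not raised, which is why \<open>A\<close> adds
    \<open>of_bool (M i < w $ i)\<close>.\<close>
  define c where "c w j = nat (w $ j - 1 - M j) + nat (m j - w $ j)" for w :: "(int, 'r) vec" and j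
  define e where "e w = (\<Sum>j\<in>UNIV. c w j)" for w
  \<comment> \<open>\<open>K\<close> lists the coordinates beyond both \<open>y\<close> and
    \<open>s\<close>; all others are at or below both. The variant \<open>P'\<close> counts weight
    \<open>d - 1\<close> and produces the correction term of the formula.\<close>
  define P where "P K = {w \<in> I. (\<forall>j\<in>K. M j < w $ j) \<and> (\<forall>j\<in>-K. w $ j \<le> m j) \<and> e w = d}" for K
  define P' where "P' K = {w \<in> I. (\<forall>j\<in>K. M j < w $ j) \<and> (\<forall>j\<in>-K. w $ j \<le> m j) \<and> e w + 1 = d}" for K
  define region where "region i w \<longleftrightarrow> (\<forall>j<i. M j < w $ j) \<and> (\<forall>j>i. w $ j \<le> m j)" for i w
  define A where "A i = {w \<in> I. region i w \<and> e w + of_bool (M i < w $ i) = d}" for i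
  define B where "B i = {w \<in> I. region i w \<and> e w + of_bool (w $ i \<le> m i) = d}" for i
  define Mid where "Mid i = {w \<in> I. region i w \<and> m i < w $ i \<and> w $ i \<le> M i \<and> e w = d}" for i
  have fin: "finite {w. e w \<le> d}"
  proof -
    have "{w. e w \<le> d} \<subseteq> {w. \<forall>j. m j - int d \<le> w $ j \<and> w $ j \<le> M j + 1 + int d}"
    proof (intro subsetI CollectI allI)
      fix w j assume "w \<in> {w. e w \<le> d}"
      then have "c w j \<le> d"
        using member_le_sum[of j UNIV "c w"] by (simp add: e_def)
      then show "m j - int d \<le> w $ j \<and> w $ j \<le> M j + 1 + int d"
        unfolding c_def by linarith
    qed
    then show ?thesis by (rule finite_subset) (rule finite_box)
  qed
  have finA: "finite (A i)" and finB: "finite (B i)" for i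
    by (rule finite_subset[OF _ fin]; auto simp: A_def B_def)+
  \<comment> \<open>The three parts have \<open>w $ i\<close> above both bounds, between them, or
    below both. The middle part is common to \<open>A\<close> and \<open>B\<close> and cancels in
    their difference.\<close>
  have cA: "card (A i) = card (P' {..i}) + card (Mid i) + card (P {..<i})" for i
  proof (rule card_disjoint_Un3[OF finA])
    have *: "(\<forall>j\<in>{..i}. M j < w $ j) \<longleftrightarrow> (\<forall>j<i. M j < w $ j) \<and> M i < w $ i"
      "(\<forall>j\<in>-{..<i}. w $ j \<le> m j) \<longleftrightarrow> (\<forall>j>i. w $ j \<le> m j) \<and> w $ i \<le> m i" for w
      by (auto simp: le_less)
    show "A i = P' {..i} \<union> Mid i \<union> P {..<i}"
      unfolding A_def P_def P'_def Mid_def region_def *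
      using mM[of i] by (auto simp: of_bool_def split: if_splits)
  qed (auto simp: P_def P'_def Mid_def dest: order.strict_trans2)
  have cB: "card (B i) = card (P {..i}) + card (Mid i) + card (P' {..<i})" for i
  proof (rule card_disjoint_Un3[OF finB])
    have *: "(\<forall>j\<in>{..i}. M j < w $ j) \<longleftrightarrow> (\<forall>j<i. M j < w $ j) \<and> M i < w $ i"
      "(\<forall>j\<in>-{..<i}. w $ j \<le> m j) \<longleftrightarrow> (\<forall>j>i. w $ j \<le> m j) \<and> w $ i \<le> m i" for w
      by (auto simp: le_less)
    show "B i = P {..i} \<union> Mid i \<union> P' {..<i}"
      unfolding B_def P_def P'_def Mid_def region_def *
      using mM[of i] by (auto simp: of_bool_def split: if_splits)
  qed (auto simp: P_def P'_def Mid_def dest: order.strict_trans2)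
  have shift: "e (w + axis i 1) + of_bool (w $ i + 1 \<le> m i) = e w + of_bool (M i < w $ i)" for w i
  proof -
    have "e (w + axis i 1) = c (w + axis i 1) i + (\<Sum>j\<in>UNIV - {i}. c w j)"
      unfolding e_def by (subst sum.remove[of UNIV i]) (auto simp: c_def axis_def intro: sum.cong)
    moreover have "e w = c w i + (\<Sum>j\<in>UNIV - {i}. c w j)"
      unfolding e_def by (simp add: sum.remove)
    moreover have "c (w + axis i 1) i + of_bool (w $ i + 1 \<le> m i) = c w i + of_bool (M i < w $ i)"
      using mM[of i] by (auto simp: c_def axis_def)
    ultimately show ?thesis by simp
  qed
  have region_axis: "region i (w + axis i 1) \<longleftrightarrow> region i w" for i w
    by (auto simp: region_def axis_def)
  \<comment> \<open>Points of \<open>A i\<close> that are not at the boundary are translated by one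
    step. The correction in \<open>B\<close> restores the detour weight from before the
    translation.\<close>
  have inside: "card {w \<in> A i. w + axis i 1 \<in> I} = card (B i)" for i
  proof (rule bij_betw_same_card)
    show "bij_betw (\<lambda>w. w + axis i 1) {w \<in> A i. w + axis i 1 \<in> I} (B i)"
    proof (rule bij_betwI[where g = "\<lambda>w. w - axis i 1"])
      show "(\<lambda>w. w + axis i 1) \<in> {w \<in> A i. w + axis i 1 \<in> I} \<rightarrow> B i"
        using shift[of _ i] by (auto simp: A_def B_def region_axis)
      show "(\<lambda>w. w - axis i 1) \<in> B i \<rightarrow> {w \<in> A i. w + axis i 1 \<in> I}"
      proof
        fix w assume w: "w \<in> B i"
        have "w - axis i 1 \<in> I"
          by (rule idealD[of w]) (use w in \<open>auto simp: B_def axis_def\<close>)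
        then show "w - axis i 1 \<in> {w \<in> A i. w + axis i 1 \<in> I}"
          using w shift[of "w - axis i 1" i] region_axis[of i "w - axis i 1"]
          by (auto simp: A_def B_def)
      qed
    qed auto
  qed
  have facet: "card {t \<in> tops y s. weight (detour y t s) = d \<and> dir t = i}
      = card {w \<in> A i. w + axis i 1 \<notin> I}" for i
  proof (rule bij_betw_same_card)
    have wt: "weight (detour y t s) = e (t + before i) + of_bool (M i < (t + before i) $ i)"
      if "region i (t + before i)" for t
    proof -
      have "detour y t s $ j = c (t + before i) j + (if j = i then of_bool (M i < (t + before i) $ i) else 0)" for j
        using that mM[of j] unfolding region_def c_def detour_nth M_def[symmetric] m_def[symmetric]
        by (cases j i rule: linorder_cases) (force+)
      then show ?thesis by (simp add: weight_def e_def sum.distrib)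
    qed
    have reg: "supp y t \<and> supp s t \<longleftrightarrow> region i (t + before i)" if "dir t = i" for t
      unfolding supp_def region_def that M_def m_def by auto
    show "bij_betw (\<lambda>t. t + before i) {t \<in> tops y s. weight (detour y t s) = d \<and> dir t = i}
        {w \<in> A i. w + axis i 1 \<notin> I}"
    proof (rule bij_betwI[where g = "\<lambda>w. w - before i"])
      show "(\<lambda>t. t + before i) \<in> {t \<in> tops y s. weight (detour y t s) = d \<and> dir t = i}
          \<rightarrow> {w \<in> A i. w + axis i 1 \<notin> I}"
      proof
        fix t assume t: "t \<in> {t \<in> tops y s. weight (detour y t s) = d \<and> dir t = i}"
        then have "region i (t + before i)" "has_dir t i"
          using reg[of t] dir[of t] by (auto simp: tops_def)
        then show "t + before i \<in> {w \<in> A i. w + axis i 1 \<notin> I}"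
          using t wt[of t] by (simp add: A_def has_dir_def)
      qed
      show "(\<lambda>w. w - before i) \<in> {w \<in> A i. w + axis i 1 \<notin> I}
          \<rightarrow> {t \<in> tops y s. weight (detour y t s) = d \<and> dir t = i}"
      proof
        fix w assume w: "w \<in> {w \<in> A i. w + axis i 1 \<notin> I}"
        then have h: "has_dir (w - before i) i"
          by (auto simp: has_dir_def A_def)
        then show "w - before i \<in> {t \<in> tops y s. weight (detour y t s) = d \<and> dir t = i}"
          using w wt[of "w - before i"] reg[of "w - before i"] has_dir_X[OF h] dir_eq[OF h]
          by (auto simp: tops_def A_def)
      qed
    qed auto
  qed
  have split: "card (A i) = card {w \<in> A i. w + axis i 1 \<in> I} + card {w \<in> A i. w + axis i 1 \<notin> I}" for i
    using finA[of i] by (subst card_Un_disjoint[symmetric]) (auto intro: arg_cong[of _ _ card])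
  have facets: "int (card {t \<in> tops y s. weight (detour y t s) = d \<and> dir t = i})
      = (int (card (P {..<i})) - int (card (P' {..<i}))) - (int (card (P {..i})) - int (card (P' {..i})))" for i
    using inside[of i] facet[of i] split[of i] cA[of i] cB[of i] by linarith
  have fint: "finite {t \<in> tops y s. weight (detour y t s) = d}"
    by (rule finite_subset[OF _ finite_detour[of y s d]]) auto
  have "{t \<in> tops y s. weight (detour y t s) = d}
      = (\<Union>i. {t \<in> tops y s. weight (detour y t s) = d \<and> dir t = i})" by auto
  then have "card {t \<in> tops y s. weight (detour y t s) = d}
      = (\<Sum>i\<in>UNIV. card {t \<in> tops y s. weight (detour y t s) = d \<and> dir t = i})"
    using fint by (simp only:) (rule card_UN_disjoint, auto intro: finite_subset)
  then have "int (card {t \<in> tops y s. weight (detour y t s) = d})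
      = (\<Sum>i\<in>UNIV. (int (card (P {..<i})) - int (card (P' {..<i}))) - (int (card (P {..i})) - int (card (P' {..i}))))"
    using facets by simp
  also have "\<dots> = (int (card (P {})) - int (card (P' {}))) - (int (card (P UNIV)) - int (card (P' UNIV)))"
    by (rule sum_telescope_atMost)
  finally have count: "int (card {t \<in> tops y s. weight (detour y t s) = d})
      = (int (card (P {})) - int (card (P' {}))) - (int (card (P UNIV)) - int (card (P' UNIV)))" .
  \<comment> \<open>A point strictly beyond \<open>y\<close> in every coordinate lies above
    \<open>y + vec 1\<close>, hence outside \<open>I\<close>.\<close>
  have "P UNIV = {}" "P' UNIV = {}"
  proof -
    have "w \<notin> I" if "\<forall>j. M j < w $ j" for w
    proof
      assume "w \<in> I"
      moreover have "(y + vec 1) $ j \<le> w $ j" for j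
        using that[rule_format, of j] by (simp add: M_def)
      ultimately have "y + vec 1 \<in> I" using idealD by blast
      then show False using y by (simp add: mem_X)
    qed
    then show "P UNIV = {}" "P' UNIV = {}" by (auto simp: P_def P'_def)
  qed
  \<comment> \<open>Points below both \<open>y\<close> and \<open>s\<close> are automatically in the
    ideal, so they form a full orthant and are counted by all exponents.\<close>
  have low: "card {w \<in> I. (\<forall>j. w $ j \<le> m j) \<and> Q (e w)} = card {n :: (nat, 'r) vec. Q (weight n)}" for Q
  proof (rule bij_betw_same_card)
    have ew: "e w = weight (\<chi> j. nat (m j - w $ j))" if "\<forall>j. w $ j \<le> m j" for w
    proof -
      have "c w j = nat (m j - w $ j)" for j
        using that[rule_format, of j] mM[of j] by (simp add: c_def)
      then show ?thesis by (simp add: e_def weight_def)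
    qed
    show "bij_betw (\<lambda>w. \<chi> j. nat (m j - w $ j)) {w \<in> I. (\<forall>j. w $ j \<le> m j) \<and> Q (e w)} {n. Q (weight n)}"
    proof (rule bij_betwI[where g = "\<lambda>n. \<chi> j. m j - int (n $ j)"])
      show "(\<lambda>w. \<chi> j. nat (m j - w $ j)) \<in> {w \<in> I. (\<forall>j. w $ j \<le> m j) \<and> Q (e w)} \<rightarrow> {n. Q (weight n)}"
        using ew by auto
      show "(\<lambda>n. \<chi> j. m j - int (n $ j)) \<in> {n. Q (weight n)} \<rightarrow> {w \<in> I. (\<forall>j. w $ j \<le> m j) \<and> Q (e w)}"
      proof
        fix n :: "(nat, 'r) vec" assume n: "n \<in> {n. Q (weight n)}"
        have "(\<chi> j. m j - int (n $ j)) \<in> I"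
          by (rule idealD[of y]) (use y in \<open>auto simp: mem_X m_def\<close>)
        then show "(\<chi> j. m j - int (n $ j)) \<in> {w \<in> I. (\<forall>j. w $ j \<le> m j) \<and> Q (e w)}"
          using n ew[of "\<chi> j. m j - int (n $ j)"] by simp
      qed
    qed (auto simp: vec_eq_iff)
  qed
  have "card (P {}) = card {n :: (nat, 'r) vec. weight n = d}"
    using low[of "\<lambda>a. a = d"] by (simp add: P_def)
  moreover have "card (P' {}) = card {n :: (nat, 'r) vec. weight n + 1 = d}"
    using low[of "\<lambda>a. a + 1 = d"] by (simp add: P'_def)
  ultimately show ?thesis
    using count \<open>P UNIV = {}\<close> \<open>P' UNIV = {}\<close> by simp
qed

text \<open>The monomials of the detours span the degree \<open>d\<close> part of $k[u]/(\sum_j u_j)$, and by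
  \<open>card_tops\<close> there are at most as many of them as its dimension, so they are independent.\<close>

lemma detour_dual:
  assumes y: "y \<in> X" and s: "s \<in> X" and t: "t \<in> tops y s"
  obtains l :: "(nat, 'r) vec \<Rightarrow> 'k::field"
  where "\<And>n. (\<Sum>i\<in>UNIV. l (n + axis i 1)) = 0"
    and "\<And>u. u \<in> tops y s \<Longrightarrow> l (detour y u s) = of_bool (u = t)"
proof -
  \<comment> \<open>Finitely supported functions on exponents model k[u] as a vector space, with the
    monomials \<open>\<delta> n\<close> as its basis.\<close>
  define scal where "scal c f = Poly_Mapping.map ((*) c) f" for c :: 'k and f :: "(nat, 'r) vec \<Rightarrow>\<^sub>0 'k"
  have lookup_scal: "Poly_Mapping.lookup (scal c f) n = c * Poly_Mapping.lookup f n" for c f n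
    unfolding scal_def by transfer (simp add: when_def)
  interpret vector_space scal
    by standard (rule poly_mapping_eqI, simp add: lookup_scal lookup_add algebra_simps)+
  define \<delta> where "\<delta> n = Poly_Mapping.single n (1 :: 'k)" for n :: "(nat, 'r) vec"
  have inj_\<delta>: "inj \<delta>"
    by (rule injI) (metis \<delta>_def lookup_single_eq lookup_single_not_eq zero_neq_one)
  have indep_\<delta>: "independent (range \<delta>)"
    unfolding independent_explicit_module
  proof (intro allI impI)
    fix T u v
    assume T: "finite T" "T \<subseteq> range \<delta>" "(\<Sum>v\<in>T. scal (u v) v) = 0" "v \<in> T"
    then obtain n where n: "v = \<delta> n" by blast
    have "0 = Poly_Mapping.lookup (\<Sum>v\<in>T. scal (u v) v) n" using T(3) by simp
    also have "\<dots> = (\<Sum>v\<in>T. u v * Poly_Mapping.lookup v n)"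
      by (simp add: lookup_sum lookup_scal)
    also have "\<dots> = (\<Sum>w\<in>T. if w = v then u v else 0)"
    proof (rule sum.cong)
      fix w assume "w \<in> T"
      then obtain n' where "w = \<delta> n'" using T(2) by blast
      then show "u w * Poly_Mapping.lookup w n = (if w = v then u v else 0)"
        using n injD[OF inj_\<delta>, of n' n] by (auto simp: \<delta>_def lookup_single when_def)
    qed simp
    finally show "u v = 0" using T by simp
  qed
  define d where "d = weight (detour y t s)"
  define N where "N = {n :: (nat, 'r) vec. weight n = d}"
  define N' where "N' = {n :: (nat, 'r) vec. weight n + 1 = d}"
  define D where "D = {u \<in> tops y s. weight (detour y u s) = d}"
  define b where "b u = \<delta> (detour y u s)" for u
  define z where "z n = (\<Sum>i\<in>UNIV. \<delta> (n + axis i 1))" for n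
  have fin: "finite N" "finite N'" "finite D"
  proof -
    show "finite N" unfolding N_def by (rule finite_weight)
    have "N' \<subseteq> {n. weight n = d - 1}" by (auto simp: N'_def)
    then show "finite N'" using finite_weight finite_subset by blast
    show "finite D"
      unfolding D_def by (rule finite_subset[OF _ finite_detour[of y s d]]) auto
  qed
  have cards: "card D + card N' = card N"
    unfolding D_def N_def N'_def by (rule card_tops[OF y s])
  let ?W = "span (\<delta> ` N)"
  have dimW: "dim ?W = card N"
    using indep_\<delta> inj_\<delta> independent_mono[of "range \<delta>" "\<delta> ` N"]
    by (simp add: dim_eq_card_independent card_image inj_on_subset image_mono)
  have sub: "b ` D \<union> z ` N' \<subseteq> ?W"
  proof -
    have "z n \<in> ?W" if "n \<in> N'" for n
      unfolding z_def by (intro span_sum span_base imageI) (use that in \<open>simp add: N_def N'_def\<close>)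
    moreover have "b u \<in> ?W" if "u \<in> D" for u
      unfolding b_def by (intro span_base imageI) (use that in \<open>simp add: N_def D_def\<close>)
    ultimately show ?thesis by blast
  qed
  have spans: "?W \<subseteq> span (b ` D \<union> z ` N')"
  proof (rule span_minimal)
    show "\<delta> ` N \<subseteq> span (b ` D \<union> z ` N')"
    proof clarify
      fix n assume n: "n \<in> N"
      \<comment> \<open>Starting the rewriting at \<open>t = s\<close> imposes no condition on
        \<open>n\<close>, since the detour through the endpoint \<open>s\<close> is zero.\<close>
      have "\<delta> n \<in> span ({\<delta> (detour y u s) | u. u \<in> tops y s \<and> (u = s \<or> below u s) \<and> weight (detour y u s) = d} \<union> z ` N')"
        by (rule monomial_in_span[OF vector_space_axioms _ s])
          (use n in \<open>auto simp: z_def N_def N'_def detour_nth\<close>)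
      moreover have "{\<delta> (detour y u s) | u. u \<in> tops y s \<and> (u = s \<or> below u s) \<and> weight (detour y u s) = d} \<subseteq> b ` D"
        by (auto simp: b_def D_def)
      ultimately show "\<delta> n \<in> span (b ` D \<union> z ` N')"
        using span_mono[of _ "b ` D \<union> z ` N'"] by (meson Un_mono order_refl subsetD)
    qed
  qed simp
  have fin2: "finite (b ` D \<union> z ` N')" using fin by simp
  have le: "card (b ` D \<union> z ` N') \<le> card (b ` D) + card (z ` N')" "card (b ` D) \<le> card D" "card (z ` N') \<le> card N'"
    using fin by (simp_all add: card_Un_le card_image_le)
  \<comment> \<open>By \<open>cards\<close> the upper bounds in \<open>le\<close> add up to
    \<open>card N\<close>. All these estimates are therefore equalities: the family has no
    repetitions and is a basis.\<close>
  have ge: "card N \<le> card (b ` D \<union> z ` N')"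
    using dim_le_card[OF spans fin2] dimW by simp
  have indep: "independent (b ` D \<union> z ` N')"
  proof -
    obtain B where B: "B \<subseteq> b ` D \<union> z ` N'" "independent B"
      "b ` D \<union> z ` N' \<subseteq> span B" "card B = dim (b ` D \<union> z ` N')"
      by (rule basis_exists)
    have "span (b ` D \<union> z ` N') \<subseteq> ?W"
      by (rule span_minimal[OF sub]) simp
    then have eq: "span (b ` D \<union> z ` N') = ?W"
      using spans by blast
    have "card B = dim (span (b ` D \<union> z ` N'))"
      by (simp only: B(4) dim_span)
    then have "card B = card N"
      by (simp only: eq dimW)
    then have "B = b ` D \<union> z ` N'"
      using card_seteq[OF fin2 B(1)] le cards by linarith
    then show ?thesis using B(2) by simp
  qed
  have "card (b ` D) = card D" "card (b ` D \<inter> z ` N') = 0"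
    using card_Un_Int[OF finite_imageI[OF fin(3)] finite_imageI[OF fin(2)], of b z] le ge cards
    by linarith+
  then have inj: "inj_on b D" and disj: "b ` D \<inter> z ` N' = {}"
    using fin by (auto intro: eq_card_imp_inj_on)
  have tD: "t \<in> D" using t by (simp add: D_def d_def)
  let ?r = "\<lambda>v. representation (b ` D \<union> z ` N') v (b t)"
  \<comment> \<open>The coordinate along \<open>b t\<close>, extended by zero to the other degrees.
    It annihilates the multiples of the sum of the u_j because those of degree \<open>d\<close> are
    the other basis vectors.\<close>
  define l where "l n = (if weight n = d then ?r (\<delta> n) else 0)" for n
  have W: "\<delta> n \<in> span (b ` D \<union> z ` N')" if "weight n = d" for n
    using spans span_base[of "\<delta> n" "\<delta> ` N"] that by (auto simp: N_def)
  show ?thesis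
  proof
    fix n :: "(nat, 'r) vec"
    show "(\<Sum>i\<in>UNIV. l (n + axis i 1)) = 0"
    proof (cases "weight n + 1 = d")
      case True
      then have "(\<Sum>i\<in>UNIV. l (n + axis i 1)) = (\<Sum>i\<in>UNIV. ?r (\<delta> (n + axis i 1)))"
        by (simp add: l_def)
      also have "\<dots> = ?r (\<Sum>i\<in>UNIV. \<delta> (n + axis i 1))"
        by (subst representation_sum[OF indep]) (use True in \<open>auto intro!: W\<close>)
      also have "\<dots> = ?r (z n)"
        by (simp only: z_def)
      also have "\<dots> = 0"
        using True disj tD by (subst representation_basis[OF indep]) (auto simp: N'_def)
      finally show ?thesis .
    next
      case False
      then show ?thesis by (simp add: l_def)
    qed
  next
    fix u assume "u \<in> tops y s"
    then show "l (detour y u s) = of_bool (u = t)"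
      using indep tD inj_onD[OF inj, of u t] representation_basis[OF indep, of "b u"]
      by (auto simp: l_def b_def[symmetric] D_def d_def)
  qed
qed

end

section \<open>Monomials in $V_r$\<close>

text \<open>Additively, the ideal is generated by the multiples of relators by monomials on both
  sides; in this form linear maps can be tested on it.\<close>

lemma relation_ideal_induct:
  assumes f: "f \<in> relation_ideal" and zero: "P 0" and add: "\<And>f g. P f \<Longrightarrow> P g \<Longrightarrow> P (f + g)"
    and monomial: "\<And>p c r q d. r \<in> relators \<Longrightarrow>
      P (Poly_Mapping.single p c \<odot> r \<odot> Poly_Mapping.single q d)"
  shows "P f"
proof -
  have sum: "P (sum h S)" if "\<And>x. x \<in> S \<Longrightarrow> P (h x)" for h :: "'a path \<Rightarrow> _" and S
    using that by (induction S rule: infinite_finite_induct) (auto intro: zero add)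
  \<comment> \<open>With both factors arbitrary, the rules \<open>mult_left\<close> and
    \<open>mult_right\<close> are absorbed into \<open>g\<close> and \<open>h\<close>.\<close>
  have *: "\<forall>g h. P (g \<odot> f \<odot> h)"
    using f
  proof induction
    case (relator f)
    show ?case
    proof (intro allI)
      fix g h
      show "P (g \<odot> f \<odot> h)"
        by (subst path_algebra_expand[of g], subst path_algebra_expand[of h])
          (auto simp only: pmult_sum_left pmult_sum_right intro!: sum monomial relator)
    qed
  next
    case (mult_left f g')
    then show ?case by (metis pmult_assoc)
  next
    case (mult_right f h')
    then show ?case by (metis pmult_assoc)
  next
    case (scale f c)
    have "g \<odot> pscale c f \<odot> h = pscale c g \<odot> f \<odot> h" for g h
      by (simp add: pmult_scale_left pmult_scale_right)
    then show ?case using scale by metis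
  qed (auto simp: pmult_add_left pmult_add_right zero intro: add)
  \<comment> \<open>The path algebra has no unit, as there are infinitely many vertices. The sum
    \<open>u\<close> acts as a unit on the finitely many paths in \<open>f\<close> and exhibits
    \<open>f\<close> as a two-sided multiple of itself.\<close>
  define S where "S = source ` Poly_Mapping.keys f \<union> target ` Poly_Mapping.keys f"
  define u where "u = (\<Sum>x\<in>S. pvertex x :: ('a, 'b) path_algebra)"
  have u: "u \<odot> Poly_Mapping.single p c = Poly_Mapping.single p c"
    "Poly_Mapping.single p c \<odot> u = Poly_Mapping.single p c" if "p \<in> Poly_Mapping.keys f" for p c
  proof -
    have S: "finite S" "source p \<in> S" "target p \<in> S" using that by (auto simp: S_def)
    have "pvertex x \<odot> Poly_Mapping.single p c = (if x = source p then Poly_Mapping.single p c else 0)"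
      "Poly_Mapping.single p c \<odot> pvertex x = (if x = target p then Poly_Mapping.single p c else 0)" for x
      by (auto simp: pvertex_def pmult_single target_def source_def)
    then show "u \<odot> Poly_Mapping.single p c = Poly_Mapping.single p c"
      "Poly_Mapping.single p c \<odot> u = Poly_Mapping.single p c"
      using S by (simp_all add: u_def pmult_sum_left pmult_sum_right)
  qed
  have "u \<odot> (\<Sum>p\<in>Poly_Mapping.keys f. Poly_Mapping.single p (Poly_Mapping.lookup f p)) \<odot> u
      = (\<Sum>p\<in>Poly_Mapping.keys f. Poly_Mapping.single p (Poly_Mapping.lookup f p))"
    by (simp add: pmult_sum_left pmult_sum_right u)
  then have "u \<odot> f \<odot> u = f"
    by (simp only: path_algebra_expand[symmetric])
  then show ?thesis using * by metis
qed

lemma class_V_eq_iff: "class_V f = class_V g \<longleftrightarrow> f - g \<in> relation_ideal"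
  by (rule V.abs_eq_iff)

lemma class_rep_V [simp]: "class_V (rep_V v) = v"
  using Quotient_V by (rule Quotient_abs_rep)

section \<open>Path classes and their commutation\<close>

definition path_class :: "(int, 'r::finite) vec \<Rightarrow> 'r label list \<Rightarrow> ('r, 'k::field) V" where
  "path_class y l = class_V (Poly_Mapping.single (y, l) 1)"

lemma class_V_sum: "class_V (sum h S) = (\<Sum>s\<in>S. class_V (h s))"
  by (induction S rule: infinite_finite_induct)
    (simp_all flip: plus_V.abs_eq zero_V.abs_eq)

lemma class_V_expand:
  "class_V f = (\<Sum>p\<in>Poly_Mapping.keys f. V_scale (Poly_Mapping.lookup f p) (path_class (fst p) (snd p)))"
  by (subst path_algebra_expand) (simp add: class_V_sum path_class_def V_scale.abs_eq pscale_eqs)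

lemma V_path_induct:
  assumes "\<And>c y l. P (V_scale c (path_class y l))" "P 0" "\<And>v w. P v \<Longrightarrow> P w \<Longrightarrow> P (v + w)"
  shows "P (v :: ('r::finite, 'k::field) V)"
proof -
  have sum: "P (sum h S)" if "\<And>x. x \<in> S \<Longrightarrow> P (h x)" for h :: "'r path \<Rightarrow> ('r, 'k) V" and S
    using that by (induction S rule: infinite_finite_induct) (auto intro: assms)
  show ?thesis
    by (subst class_rep_V[symmetric], subst class_V_expand) (rule sum, rule assms(1))
qed

lemma path_class_mult:
  "path_class y l * path_class z m = (if target (y, l) = z then path_class y (l @ m) else 0)"
  by (auto simp: path_class_def times_V.abs_eq pmult_single source_def zero_V.abs_eq)

lemma V_idem_path_class: "V_idem x = path_class x []"
  by (simp add: V_idem.abs_eq path_class_def pvertex_def)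

lemma target_Nil [simp]: "target (y, []) = y"
  by (simp add: target_def)

lemma V_scale_mult_left: "V_scale c v * w = V_scale c (v * w)"
  by transfer (simp add: pmult_scale_left relation_ideal.zero)

lemma V_scale_mult_right: "v * V_scale c w = V_scale c (v * w)"
  by transfer (simp add: pmult_scale_right relation_ideal.zero)

text \<open>The mixed relators include \<open>i = j\<close>. Those for two alphas or two betas
  exclude it, but there the two words coincide.\<close>

lemma path_class_swap:
  "path_class y [a, b] = (path_class y [b, a] :: ('r::finite, 'k::field) V)"
proof -
  have relator: "path_class y [a, b] = (path_class y [b, a] :: ('r, 'k) V)"
    if "Poly_Mapping.single (y, [a, b]) 1 - Poly_Mapping.single (y, [b, a]) 1
      \<in> (relators :: ('r, 'k) path_algebra set)" for y a b
    using relation_ideal.relator[OF that] by (simp add: path_class_def class_V_eq_iff)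
  have AB: "path_class y [Alpha i, Beta j] = (path_class y [Beta j, Alpha i] :: ('r, 'k) V)" for i j
    by (rule relator) (auto simp: relators_def alpha_def beta_def pmult_single target_def source_def)
  have AA: "path_class y [Alpha i, Alpha j] = (path_class y [Alpha j, Alpha i] :: ('r, 'k) V)" for i j
  proof (cases "i = j")
    case False
    then show ?thesis
      by (intro relator) (force simp: relators_def alpha_def beta_def pmult_single target_def source_def)
  qed simp
  have BB: "path_class y [Beta i, Beta j] = (path_class y [Beta j, Beta i] :: ('r, 'k) V)" for i j
  proof (cases "i = j")
    case False
    then show ?thesis
      by (intro relator) (force simp: relators_def alpha_def beta_def pmult_single target_def source_def)
  qed simp
  show ?thesis
    using AA BB AB by (cases a; cases b) auto
qed

lemma path_class_Cons: "path_class y (a # l) = path_class y [a] * path_class (move y a) l"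
  by (simp add: path_class_mult target_def)

lemma path_class_move_front:
  "path_class y (l @ a # m) = (path_class y (a # l @ m) :: ('r::finite, 'k::field) V)"
proof (induction l arbitrary: y)
  case (Cons b l)
  have "(path_class y ((b # l) @ a # m) :: ('r, 'k) V) = path_class y [b] * path_class (move y b) (a # l @ m)"
    by (simp only: append_Cons path_class_Cons[of y b "l @ a # m"] Cons)
  also have "\<dots> = path_class y [b, a] * path_class (move (move y b) a) (l @ m)"
    by (simp add: path_class_mult target_def)
  also have "\<dots> = path_class y [a, b] * path_class (move (move y a) b) (l @ m)"
  proof -
    have "move (move y b) a = move (move y a) b"
      by (cases a; cases b) (simp_all add: algebra_simps)
    then show ?thesis by (simp only: path_class_swap[of y b a])
  qed
  also have "\<dots> = path_class y (a # (b # l) @ m)"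
    by (simp add: path_class_mult target_def)
  finally show ?case .
qed simp

text \<open>Since neighbouring labels commute, only the number of occurrences of each label matters.
  This makes exponents sufficient to describe \<open>f_y V_r f_s\<close>.\<close>

lemma path_class_mset:
  "mset l = mset m \<Longrightarrow> path_class y l = (path_class y m :: ('r::finite, 'k::field) V)"
proof (induction l arbitrary: y m)
  case (Cons a l)
  then obtain m1 m2 where m: "m = m1 @ a # m2"
    by (metis in_set_conv_decomp list.set_intros(1) set_mset_mset)
  then have "mset l = mset (m1 @ m2)" using Cons.prems by simp
  then have "path_class (move y a) l = (path_class (move y a) (m1 @ m2) :: ('r, 'k) V)" by (rule Cons.IH)
  then show ?case
    by (simp only: m path_class_move_front path_class_Cons[of y a l] path_class_Cons[of y a "m1 @ m2"])
qed simp

lemma sum_path_class_Beta_Alpha: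
  "(\<Sum>i\<in>UNIV. path_class y [Beta i, Alpha i]) = (0 :: ('r::finite, 'k::field) V)"
proof -
  have "(\<Sum>i\<in>UNIV. Poly_Mapping.single (y, [Beta i, Alpha i]) 1) \<in> (relators :: ('r, 'k) path_algebra set)"
    by (auto simp: relators_def alpha_def beta_def pmult_single target_def source_def)
  from relation_ideal.relator[OF this]
  have "class_V (\<Sum>i\<in>UNIV. Poly_Mapping.single (y, [Beta i, Alpha i]) 1) = (0 :: ('r, 'k) V)"
    by (simp add: zero_V.abs_eq class_V_eq_iff)
  then show ?thesis by (simp add: class_V_sum path_class_def)
qed

lemma target_nth:
  "target (y, l) $ j = y $ j + int (count (mset l) (Alpha j)) - int (count (mset l) (Beta j))"
proof (induction l arbitrary: y)
  case (Cons a l)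
  have "target (y, a # l) = target (move y a, l)" by (simp add: target_def)
  then show ?case using Cons by (cases a) (auto simp: axis_def)
qed simp

definition label_mset :: "(int, 'r::finite) vec \<Rightarrow> (int, 'r) vec \<Rightarrow> (nat, 'r) vec \<Rightarrow> 'r label multiset" where
  "label_mset y s n = (\<Sum>j\<in>UNIV. replicate_mset (nat (s $ j - y $ j) + n $ j) (Alpha j)
    + replicate_mset (nat (y $ j - s $ j) + n $ j) (Beta j))"

lemma count_label_mset:
  "count (label_mset y s n) (Alpha j) = nat (s $ j - y $ j) + n $ j"
  "count (label_mset y s n) (Beta j) = nat (y $ j - s $ j) + n $ j"
  by (simp_all add: label_mset_def count_sum)

text \<open>The class of any path from \<open>y\<close> to \<open>s\<close> that contains a geodesic and \<open>n $ j\<close> further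
  pairs of opposite arrows in direction \<open>j\<close>.\<close>

definition mon :: "(int, 'r::finite) vec \<Rightarrow> (int, 'r) vec \<Rightarrow> (nat, 'r) vec \<Rightarrow> ('r, 'k::field) V" where
  "mon y s n = path_class y (SOME l. mset l = label_mset y s n)"

lemma label_mset_list:
  obtains l where "mset l = label_mset y s n" "mon y s n = (path_class y l :: ('r::finite, 'k::field) V)"
    "target (y, l) = s" "length l = dist1 y s + 2 * weight n"
proof -
  define l where "l = (SOME l. mset l = label_mset y s n)"
  have l: "mset l = label_mset y s n"
    unfolding l_def by (rule someI_ex) (metis ex_mset)
  have "length l = size (label_mset y s n)" using l by (metis size_mset)
  also have "\<dots> = (\<Sum>j\<in>UNIV. nat \<bar>y $ j - s $ j\<bar> + 2 * n $ j)"
    unfolding label_mset_def size_multiset_sum by (rule sum.cong) auto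
  finally have "length l = dist1 y s + 2 * weight n"
    by (simp add: dist1_def weight_def sum.distrib sum_distrib_left)
  moreover have "target (y, l) = s"
    by (simp add: vec_eq_iff target_nth l count_label_mset)
  ultimately show ?thesis using that[OF l] by (simp add: mon_def l_def)
qed

lemma label_eqI:
  assumes "\<And>j. count A (Alpha j) = count B (Alpha j)" "\<And>j. count A (Beta j) = count B (Beta j)"
  shows "A = B"
proof (rule multiset_eqI)
  fix a show "count A a = count B a" using assms by (cases a) auto
qed

text \<open>The difference of the two counts in direction \<open>j\<close> is fixed by the
  endpoints; their minimum is the number of surplus pairs of opposite arrows.\<close>

lemma path_class_eq_mon:
  "path_class y l = (mon y (target (y, l)) (\<chi> j. min (count (mset l) (Alpha j)) (count (mset l) (Beta j))) :: ('r::finite, 'k::field) V)"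
  (is "_ = mon y ?s ?n")
proof -
  obtain m where m: "mset m = label_mset y ?s ?n" "(mon y ?s ?n :: ('r, 'k) V) = path_class y m" "target (y, m) = ?s"
    "length m = dist1 y ?s + 2 * weight ?n" by (rule label_mset_list)
  have "mset l = mset m"
    by (rule label_eqI; simp add: m count_label_mset target_nth)
  then show ?thesis unfolding m(2) by (rule path_class_mset)
qed

lemma mon_eqI:
  assumes "target (y, l) = s" "\<And>j. min (count (mset l) (Alpha j)) (count (mset l) (Beta j)) = n $ j"
  shows "path_class y l = (mon y s n :: ('r::finite, 'k::field) V)"
proof -
  have n: "(\<chi> j. min (count (mset l) (Alpha j)) (count (mset l) (Beta j))) = n"
    by (simp only: vec_eq_iff vec_lambda_beta assms(2)) simp
  show ?thesis by (simp only: path_class_eq_mon[of y l] assms(1) n)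
qed

lemma target_append: "target (y, l @ m) = target (target (y, l), m)"
  by (simp add: target_def)

text \<open>In each coordinate, two geodesics in succession run back and forth exactly as far as
  \<open>t\<close> lies outside the interval between \<open>y\<close> and \<open>s\<close>. These
  pairs of opposite arrows make up the detour.\<close>

lemma mon_mult:
  "mon y t n * mon t s n' = (mon y s (n + n' + detour y t s) :: ('r::finite, 'k::field) V)"
proof -
  obtain l where l: "mset l = label_mset y t n" "(mon y t n :: ('r, 'k) V) = path_class y l" "target (y, l) = t"
    "length l = dist1 y t + 2 * weight n" by (rule label_mset_list)
  obtain m where m: "mset m = label_mset t s n'" "(mon t s n' :: ('r, 'k) V) = path_class t m" "target (t, m) = s"
    "length m = dist1 t s + 2 * weight n'" by (rule label_mset_list)
  have "(mon y t n :: ('r, 'k) V) * mon t s n' = path_class y (l @ m)"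
    using l m by (simp add: path_class_mult)
  also have "\<dots> = mon y s (n + n' + detour y t s)"
    by (rule mon_eqI, simp add: target_append l m, simp add: l m count_label_mset detour_nth, linarith)
  finally show ?thesis .
qed

lemma mon_mult_other:
  assumes "t \<noteq> t'"
  shows "mon y t n * mon t' s n' = (0 :: ('r::finite, 'k::field) V)"
proof -
  obtain l where l: "mset l = label_mset y t n" "(mon y t n :: ('r, 'k) V) = path_class y l" "target (y, l) = t"
    "length l = dist1 y t + 2 * weight n" by (rule label_mset_list)
  obtain m where m: "mset m = label_mset t' s n'" "(mon t' s n' :: ('r, 'k) V) = path_class t' m" "target (t', m) = s"
    "length m = dist1 t' s + 2 * weight n'" by (rule label_mset_list)
  show ?thesis using assms by (simp add: l m path_class_mult)
qed

lemma V_idem_mon: "V_idem x = mon x x 0"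
  unfolding V_idem_path_class by (rule mon_eqI) simp_all

lemma sum_mon_axis: "(\<Sum>i\<in>UNIV. mon y s (n + axis i 1)) = (0 :: ('r::finite, 'k::field) V)"
proof -
  obtain l where l: "mset l = label_mset y s n" "(mon y s n :: ('r, 'k) V) = path_class y l" "target (y, l) = s"
    "length l = dist1 y s + 2 * weight n" by (rule label_mset_list)
  have "mon y s (n + axis i 1) = (mon y s n :: ('r, 'k) V) * path_class s [Beta i, Alpha i]" for i
  proof -
    have "(mon y s n :: ('r, 'k) V) * path_class s [Beta i, Alpha i] = path_class y (l @ [Beta i, Alpha i])"
      using l by (simp add: path_class_mult)
    also have "\<dots> = mon y s (n + axis i 1)"
      by (rule mon_eqI) (auto simp: vec_eq_iff target_nth l count_label_mset axis_def)
    finally show ?thesis by simp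
  qed
  then show ?thesis
    by (simp add: sum_path_class_Beta_Alpha flip: sum_distrib_left)
qed

lemma V_mon_induct:
  assumes "\<And>c y s n. P (V_scale c (mon y s n))" "P 0" "\<And>v w. P v \<Longrightarrow> P w \<Longrightarrow> P (v + w)"
  shows "P (v :: ('r::finite, 'k::field) V)"
  by (rule V_path_induct) (simp_all add: assms path_class_eq_mon)

lemma relators_cases:
  assumes "r \<in> (relators :: ('r::finite, 'k::field) path_algebra set)"
  shows "(\<exists>x a b. r = Poly_Mapping.single (x, [a, b]) 1 - Poly_Mapping.single (x, [b, a]) 1) \<or>
    (\<exists>x. r = (\<Sum>i\<in>UNIV. Poly_Mapping.single (x, [Beta i, Alpha i]) 1))"
  using assms unfolding relators_def alpha_def beta_def
  by (elim UnE) (auto simp: pmult_single target_def source_def)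

text \<open>Since every $f_yV_rf_s$ is a copy of $k[u]/(\sum_j u_j)$, a linear functional on $k[u]$ that
  vanishes on the multiples of $\sum_j u_j$ extends to $V_r$.\<close>

lemma V_functional:
  fixes l :: "(nat, 'r::finite) vec \<Rightarrow> 'k::field"
  assumes l: "\<And>n. (\<Sum>i\<in>UNIV. l (n + axis i 1)) = 0"
  obtains L :: "('r, 'k) V \<Rightarrow> 'k"
  where "\<And>v w. L (v + w) = L v + L w" "\<And>c v. L (V_scale c v) = c * L v" "\<And>n. L (mon y s n) = l n"
proof -
  \<comment> \<open>A path from \<open>y\<close> to \<open>s\<close> is evaluated by the exponent of
    its monomial; all other paths are sent to zero.\<close>
  define F where "F p = (if source p = y \<and> target p = s
      then l (\<chi> j. min (count (mset (snd p)) (Alpha j)) (count (mset (snd p)) (Beta j))) else 0)" for p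
  define ev where "ev f = (\<Sum>p\<in>Poly_Mapping.keys f. F p * Poly_Mapping.lookup f p)"
    for f :: "('r, 'k) path_algebra"
  have ev_add: "ev (f + g) = ev f + ev g" for f g
    unfolding ev_def by (rule setsum_keys_plus_distrib) (simp_all add: algebra_simps)
  have ev_single: "ev (Poly_Mapping.single p c) = F p * c" for p c
    by (simp add: ev_def)
  have ev_0: "ev 0 = 0" by (simp add: ev_def)
  have ev_minus: "ev (f - g) = ev f - ev g" for f g
    using ev_add[of "f - g" g] by simp
  have ev_sum: "ev (sum h S) = (\<Sum>x\<in>S. ev (h x))" for h :: "'r \<Rightarrow> _" and S
    by (induction S rule: infinite_finite_induct) (simp_all add: ev_0 ev_add)
  have ev_scale: "ev (pscale c f) = c * ev f" for c f
  proof -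
    have "ev (pscale c f) = (\<Sum>p\<in>Poly_Mapping.keys f. F p * Poly_Mapping.lookup (pscale c f) p)"
      unfolding ev_def by (rule sum.mono_neutral_left) (auto simp: in_keys_iff)
    then show ?thesis by (simp add: ev_def sum_distrib_left algebra_simps)
  qed
  have F_eq: "F (x, a @ b @ d) = F (x, a @ b' @ d)" if "mset b = mset b'" for x a b b' d
  proof -
    have "target (x, a @ b @ d) = target (x, a @ b' @ d)"
      using that by (simp add: vec_eq_iff target_nth)
    then show ?thesis using that by (cases "x = y") (auto simp: F_def source_def)
  qed
  have zero: "ev f = 0" if "f \<in> relation_ideal" for f
    using that
  proof (rule relation_ideal_induct)
    fix p q :: "'r path" and c d :: 'k and r :: "('r, 'k) path_algebra"
    assume "r \<in> relators"
    then consider x a b where "r = Poly_Mapping.single (x, [a, b]) 1 - Poly_Mapping.single (x, [b, a]) 1"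
      | x where "r = (\<Sum>i\<in>UNIV. Poly_Mapping.single (x, [Beta i, Alpha i]) 1)"
      by (blast dest: relators_cases)
    then show "ev (Poly_Mapping.single p c \<odot> r \<odot> Poly_Mapping.single q d) = 0"
    proof cases
      case 1
      have "target (x, [a, b]) = target (x, [b, a])"
        by (simp add: vec_eq_iff target_nth)
      moreover have "target (source p, snd p @ [a, b]) = target (source p, snd p @ [b, a])"
        by (simp add: vec_eq_iff target_nth)
      ultimately show ?thesis
        using F_eq[of "[a, b]" "[b, a]" "source p" "snd p" "snd q"]
        by (auto simp: 1 pmult_minus_left pmult_minus_right pmult_single ev_minus ev_single ev_0 source_def)
    next
      case 2
      \<comment> \<open>Inserting a beta and an alpha of the same direction \<open>i\<close> keeps
        the endpoints and adds \<open>axis i 1\<close> to the exponent, so the values on the relator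
        add up to the hypothesis on \<open>l\<close>.\<close>
      define n where "n = (\<chi> j. min (count (mset (snd p @ snd q)) (Alpha j)) (count (mset (snd p @ snd q)) (Beta j)))"
      have "target (x, [Beta i, Alpha i]) = x" "target (source p, snd p @ [Beta i, Alpha i]) = target p" for i
        by (simp_all add: target_def source_def)
      then have prod: "Poly_Mapping.single p c \<odot> Poly_Mapping.single (x, [Beta i, Alpha i]) 1 \<odot> Poly_Mapping.single q d
          = (if target p = x \<and> x = source q
             then Poly_Mapping.single (source p, snd p @ [Beta i, Alpha i] @ snd q) (c * d) else 0)" for i
        by (auto simp: pmult_single source_def)
      have "target (source p, snd p @ [Beta i, Alpha i] @ snd q) = target (source p, snd p @ snd q)" for i
        by (simp add: target_def)
      moreover have "(\<chi> j. min (count (mset (snd p @ [Beta i, Alpha i] @ snd q)) (Alpha j))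
          (count (mset (snd p @ [Beta i, Alpha i] @ snd q)) (Beta j))) = n + axis i 1" for i
        by (auto simp: n_def vec_eq_iff axis_def)
      ultimately have F: "F (source p, snd p @ [Beta i, Alpha i] @ snd q)
          = (if source p = y \<and> target (source p, snd p @ snd q) = s then l (n + axis i 1) else 0)" for i
        unfolding F_def by (simp only: snd_conv) (simp add: source_def)
      have "ev (Poly_Mapping.single p c \<odot> Poly_Mapping.single (x, [Beta i, Alpha i]) 1 \<odot> Poly_Mapping.single q d)
          = l (n + axis i 1) * (if target p = x \<and> x = source q \<and> source p = y \<and> target (source p, snd p @ snd q) = s
            then c * d else 0)" for i
      proof (cases "target p = x \<and> x = source q")
        case True
        then show ?thesis unfolding prod if_P[OF True] ev_single F by auto
      next
        case False
        then show ?thesis unfolding prod if_not_P[OF False] ev_0 by auto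
      qed
      then show ?thesis
        unfolding 2 pmult_sum_left pmult_sum_right ev_sum
        by (simp only: sum_distrib_right[symmetric] l) simp
    qed
  qed (simp_all add: ev_0 ev_add)
  define L where "L v = ev (rep_V v)" for v
  have L: "L (class_V f) = ev f" for f
  proof -
    have "rep_V (class_V f) - f \<in> relation_ideal"
      using class_rep_V[of "class_V f"] by (simp only: class_V_eq_iff)
    then show ?thesis using zero ev_minus by (metis L_def right_minus_eq)
  qed
  show ?thesis
  proof
    show "L (v + w) = L v + L w" for v w
      by (metis L L_def ev_add class_rep_V plus_V.abs_eq)
    show "L (V_scale c v) = c * L v" for c v
      by (metis L L_def ev_scale class_rep_V V_scale.abs_eq)
    fix n
    obtain m where m: "mset m = label_mset y s n" "(mon y s n :: ('r, 'k) V) = path_class y m" "target (y, m) = s"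
      "length m = dist1 y s + 2 * weight n" by (rule label_mset_list)
    have "(\<chi> j. min (count (mset m) (Alpha j)) (count (mset m) (Beta j))) = n"
      by (simp add: vec_eq_iff m(1) count_label_mset) linarith
    then show "L (mon y s n) = l n"
      by (simp add: m(2,3) path_class_def L ev_single F_def source_def)
  qed
qed

section \<open>The grading by path length\<close>

lemma V_compI: "class_V f \<in> V_comp n" if "\<And>p. p \<in> Poly_Mapping.keys f \<Longrightarrow> length (snd p) = n"
  using that by (auto simp: V_comp_def)

lemma subspace_V_comp: "V.subspace (V_comp n)"
  unfolding V.subspace_def
proof (intro conjI ballI allI)
  show "0 \<in> V_comp n" by (auto simp: zero_V.abs_eq intro: V_compI)
next
  fix v w :: "('r::finite, 'k::field) V" assume "v \<in> V_comp n" "w \<in> V_comp n"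
  then obtain f g where "v = class_V f" "w = class_V g"
    "\<forall>p\<in>Poly_Mapping.keys f. length (snd p) = n" "\<forall>p\<in>Poly_Mapping.keys g. length (snd p) = n"
    by (auto simp: V_comp_def)
  then show "v + w \<in> V_comp n"
    using Poly_Mapping.keys_add[of f g] by (auto simp: plus_V.abs_eq intro!: V_compI)
next
  fix c :: "'k::field" and v :: "('r::finite, 'k) V" assume "v \<in> V_comp n"
  then obtain f where "v = class_V f" "\<forall>p\<in>Poly_Mapping.keys f. length (snd p) = n"
    by (auto simp: V_comp_def)
  then show "V_scale c v \<in> V_comp n"
    by (auto simp: V_scale.abs_eq in_keys_iff intro!: V_compI)
qed

lemma path_class_V_comp: "path_class y l \<in> V_comp (length l)"
  unfolding path_class_def by (rule V_compI) (simp add: keys_single split: if_splits)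

lemma mon_V_comp: "mon y s n \<in> (V_comp (dist1 y s + 2 * weight n) :: ('r::finite, 'k::field) V set)"
proof -
  obtain m where m: "mset m = label_mset y s n" "(mon y s n :: ('r, 'k) V) = path_class y m" "target (y, m) = s"
      "length m = dist1 y s + 2 * weight n" by (rule label_mset_list)
  show ?thesis unfolding m(2) m(4)[symmetric] by (rule path_class_V_comp)
qed

lemma V_comp_span: "V_comp n = V.span {path_class y l | y l. length l = n}"
proof
  show "V.span {path_class y l | y l. length l = n} \<subseteq> V_comp n"
    by (rule V.span_minimal) (auto simp: subspace_V_comp path_class_V_comp)
  show "V_comp n \<subseteq> V.span {path_class y l | y l. length l = n}"
  proof
    fix v :: "('r::finite, 'k::field) V" assume "v \<in> V_comp n"
    then obtain f where f: "v = class_V f" "\<forall>p\<in>Poly_Mapping.keys f. length (snd p) = n"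
      by (auto simp: V_comp_def)
    have "path_class (fst p) (snd p) \<in> V.span {path_class y l | y l. length l = n}"
      if "p \<in> Poly_Mapping.keys f" for p
      using f(2) that by (intro V.span_base) blast
    then show "v \<in> V.span {path_class y l | y l. length l = n}"
      unfolding f(1) class_V_expand by (intro V.span_sum V.span_scale)
  qed
qed

lemma V_comp_mult:
  assumes "v \<in> V_comp m" "w \<in> V_comp n"
  shows "v * w \<in> V_comp (m + n)"
proof -
  have 1: "path_class y l * w \<in> V_comp (length l + n)" if "w \<in> V_comp n" for y l and w :: "('a, 'b) V"
    using that unfolding V_comp_span[of n]
  proof (induction rule: V.span_induct_alt)
    case base
    then show ?case by (simp add: V.subspace_0 subspace_V_comp)
  next
    case (step c x w)
    then obtain z k where zk: "x = path_class z k" "length k = n" by auto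
    have "(path_class y (l @ k) :: ('a, 'b) V) \<in> V_comp (length l + n)"
      by (metis length_append path_class_V_comp zk(2))
    then have "path_class y l * x \<in> V_comp (length l + n)"
      by (simp add: zk path_class_mult V.subspace_0 subspace_V_comp)
    then show ?case using step.IH
      by (simp add: distrib_left V_scale_mult_right V.subspace_add V.subspace_scale subspace_V_comp)
  qed
  show ?thesis
    using assms(1) unfolding V_comp_span[of m]
  proof (induction rule: V.span_induct_alt)
    case base
    then show ?case by (simp add: V.subspace_0 subspace_V_comp)
  next
    case (step c x v)
    then show ?case using 1[OF assms(2)]
      by (auto simp: distrib_right V_scale_mult_left V.subspace_add V.subspace_scale subspace_V_comp)
  qed
qed

text \<open>All relators are homogeneous of length 2, so the ideal contains the homogeneous parts of
  its elements, and the grading of the path algebra descends to the quotient.\<close>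

lemma V_comp_independent:
  assumes "finite S" "\<And>i. i \<in> S \<Longrightarrow> v i \<in> V_comp i" "(\<Sum>i\<in>S. v i) = 0" "i \<in> S"
  shows "v i = (0 :: ('r::finite, 'k::field) V)"
proof -
  define part where "part n f = Poly_Mapping.mapp (\<lambda>p c. if length (snd p) = n then c else 0) f"
    for n and f :: "('r, 'k) path_algebra"
  have lookup_part: "Poly_Mapping.lookup (part n f) p = (if length (snd p) = n then Poly_Mapping.lookup f p else 0)"
    for n f p by (simp add: part_def lookup_mapp when_def in_keys_iff)
  have part_add: "part n (f + g) = part n f + part n g" for n f g
    by (rule poly_mapping_eqI) (simp add: lookup_part lookup_add)
  have part_zero: "part n 0 = 0" for n
    by (rule poly_mapping_eqI) (simp add: lookup_part)
  have part_sum: "part n (sum h T) = (\<Sum>x\<in>T. part n (h x))" for n T and h :: "nat \<Rightarrow> _"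
    by (induction T rule: infinite_finite_induct) (simp_all add: part_zero part_add)
  have part_homogeneous: "part n f = (if n = m then f else 0)"
    if "\<And>p. p \<in> Poly_Mapping.keys f \<Longrightarrow> length (snd p) = m" for n m f
    by (rule poly_mapping_eqI) (use that in \<open>auto simp: lookup_part in_keys_iff\<close>)
  have keys_pmult: "length (snd p) = a + b"
    if "p \<in> Poly_Mapping.keys (f \<odot> g)" "\<And>p. p \<in> Poly_Mapping.keys f \<Longrightarrow> length (snd p) = a"
      "\<And>p. p \<in> Poly_Mapping.keys g \<Longrightarrow> length (snd p) = b"
    for f g :: "('r, 'k) path_algebra" and p a b
  proof -
    let ?h = "\<lambda>p q. if target p = source q then Poly_Mapping.single (source p, snd p @ snd q)
      (Poly_Mapping.lookup f p * Poly_Mapping.lookup g q) else 0"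
    have "p \<in> Poly_Mapping.keys (\<Sum>p'\<in>Poly_Mapping.keys f. \<Sum>q\<in>Poly_Mapping.keys g. ?h p' q)"
      using that(1) by (simp only: pmult_def)
    from subsetD[OF Poly_Mapping.keys_sum this]
    obtain p' where p': "p' \<in> Poly_Mapping.keys f"
      "p \<in> Poly_Mapping.keys (\<Sum>q\<in>Poly_Mapping.keys g. ?h p' q)" by (rule UN_E)
    from subsetD[OF Poly_Mapping.keys_sum this(2)]
    obtain q where "q \<in> Poly_Mapping.keys g" "p \<in> Poly_Mapping.keys (?h p' q)" by (rule UN_E)
    then show ?thesis
      using that(2)[OF p'(1)] that(3)[of q] by (auto split: if_splits)
  qed
  have "\<forall>n. part n f \<in> relation_ideal" if "f \<in> relation_ideal" for f
    using that
  proof (rule relation_ideal_induct)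
    fix p q :: "'r path" and c d :: 'k and r :: "('r, 'k) path_algebra"
    assume r: "r \<in> relators"
    have r2: "length (snd p) = 2" if "p \<in> Poly_Mapping.keys r" for p
      using relators_cases[OF r]
    proof (elim disjE exE)
      fix x a b assume "r = Poly_Mapping.single (x, [a, b]) 1 - Poly_Mapping.single (x, [b, a]) 1"
      then show ?thesis
        using that by (auto simp: in_keys_iff lookup_minus lookup_single when_def split: if_splits)
    next
      fix x assume "r = (\<Sum>i\<in>UNIV. Poly_Mapping.single (x, [Beta i, Alpha i]) 1)"
      then have "p \<in> Poly_Mapping.keys (\<Sum>i\<in>UNIV. Poly_Mapping.single (x, [Beta i, Alpha i]) (1 :: 'k))"
        using that by (simp only:)
      from subsetD[OF Poly_Mapping.keys_sum this] show ?thesis by auto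
    qed
    have "length (snd p') = length (snd p) + 2 + length (snd q)"
      if "p' \<in> Poly_Mapping.keys (Poly_Mapping.single p c \<odot> r \<odot> Poly_Mapping.single q d)" for p'
      using that by (rule keys_pmult[OF _ keys_pmult[OF _ _ r2]]) (auto split: if_splits)
    from part_homogeneous[OF this] r
    show "\<forall>n. part n (Poly_Mapping.single p c \<odot> r \<odot> Poly_Mapping.single q d) \<in> relation_ideal"
      by (simp add: relation_ideal.intros)
  qed (simp_all add: part_zero part_add relation_ideal.zero relation_ideal.add)
  moreover have "\<exists>f. v i = class_V f \<and> (\<forall>p\<in>Poly_Mapping.keys f. length (snd p) = i)" if "i \<in> S" for i
    using assms(2)[OF that] by (auto simp: V_comp_def)
  then obtain f where f: "\<And>i. i \<in> S \<Longrightarrow> v i = class_V (f i)"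
    "\<And>i p. i \<in> S \<Longrightarrow> p \<in> Poly_Mapping.keys (f i) \<Longrightarrow> length (snd p) = i"
    by metis
  moreover have "sum f S \<in> relation_ideal"
  proof -
    have "class_V (sum f S) = class_V 0"
      using assms(3) f(1) by (simp add: class_V_sum zero_V.abs_eq)
    then show ?thesis by (simp add: class_V_eq_iff)
  qed
  ultimately have "part i (sum f S) \<in> relation_ideal" by blast
  moreover have "part i (sum f S) = f i"
    using f(2) assms(1,4) by (simp add: part_sum part_homogeneous)
  ultimately show ?thesis
    using f(1)[OF assms(4)] by (simp add: zero_V.abs_eq class_V_eq_iff)
qed

section \<open>Graded algebras with a basis adapted to the standard modules\<close>

context graded_algebra
begin

section \<open>Homogeneous elements and graded submodules\<close>

lemma sum_comp_zero:
  assumes "finite S" "\<And>i. i \<in> S \<Longrightarrow> v i \<in> comp i" "(\<Sum>i\<in>S. v i) = 0" "i \<in> S"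
  shows "v i = 0"
proof -
  define d where "d i = (if i \<in> S then v i else 0)" for i
  have "{i. d i \<noteq> 0} \<subseteq> S" by (auto simp: d_def)
  then have fin: "finite {i. d i \<noteq> 0}" and "(\<Sum>i | d i \<noteq> 0. d i) = (\<Sum>i\<in>S. d i)"
    using assms(1) by (auto intro: finite_subset sum.mono_neutral_left)
  then have "0 = (\<Sum>i | d i \<noteq> 0. d i)" using assms(3) by (simp add: d_def)
  moreover have "\<forall>i. d i \<in> comp i"
    using assms(2) subspace_0[OF subspace_comp] by (simp add: d_def)
  moreover have "\<forall>i. (0 :: 'a) \<in> comp i" using subspace_0[OF subspace_comp] by simp
  ultimately have "d = (\<lambda>i. 0)"
    using comp_direct[OF subspace_0[OF subspace_A]] fin by (elim ex1E) (metis (mono_tags, lifting) empty_Collect_eq finite.emptyI sum.empty)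
  then show ?thesis using assms(4) by (metis d_def)
qed

text \<open>Collecting terms by degree gives a second decomposition of \<open>x\<close>, which must
  agree with the trivial one. This lets surjectivity be checked on generators of a single
  degree.\<close>

lemma span_homogeneous:
  assumes H: "H \<subseteq> (\<Union>i. comp i)" and x: "x \<in> span H" "x \<in> comp n"
  shows "x \<in> span (H \<inter> comp n)"
proof -
  have "\<exists>S d. finite S \<and> (\<forall>i\<in>S. d i \<in> span (H \<inter> comp i)) \<and> x = (\<Sum>i\<in>S. d i)"
    using x(1)
  proof (induction rule: span_induct_alt)
    case base
    then show ?case by (intro exI[of _ "{}"]) simp
  next
    case (step c h y)
    obtain j where j: "h \<in> comp j" using H step.hyps by blast
    obtain S d where S: "finite S" "\<forall>i\<in>S. d i \<in> span (H \<inter> comp i)" "y = (\<Sum>i\<in>S. d i)"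
      using step.IH by blast
    define d' where "d' i = (if i = j then scale c h else 0) + (if i \<in> S then d i else 0)" for i
    have "scale c h \<in> span (H \<inter> comp j)"
      using j step.hyps by (intro span_scale span_base) simp
    then have "\<forall>i\<in>insert j S. d' i \<in> span (H \<inter> comp i)"
      using S(2) by (auto simp: d'_def intro: span_add span_zero)
    moreover have "scale c h + y = (\<Sum>i\<in>insert j S. d' i)"
    proof -
      have "(\<Sum>i\<in>insert j S. d' i) = scale c h + (\<Sum>i\<in>insert j S. if i \<in> S then d i else 0)"
        using S(1) by (simp add: d'_def sum.distrib)
      also have "(\<Sum>i\<in>insert j S. if i \<in> S then d i else 0) = (\<Sum>i\<in>S. d i)"
        using S(1) by (intro sum.mono_neutral_cong_right) auto
      finally show ?thesis using S(3) by simp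
    qed
    ultimately show ?case using S(1) by blast
  qed
  then obtain S d where S: "finite S" "\<And>i. i \<in> S \<Longrightarrow> d i \<in> span (H \<inter> comp i)" "x = (\<Sum>i\<in>S. d i)"
    by blast
  have dc: "d i \<in> comp i" if "i \<in> S" for i
    using S(2)[OF that] span_minimal[OF _ subspace_comp, of "H \<inter> comp i" i] by blast
  define e where "e i = (if i \<in> S then d i else 0) - (if i = n then x else 0)" for i
  have "e i \<in> comp i" for i
    using dc x(2) subspace_neg[OF subspace_comp, of x n] subspace_diff[OF subspace_comp, of "d n" n x]
      subspace_0[OF subspace_comp] by (auto simp: e_def)
  moreover have "(\<Sum>i\<in>insert n S. e i) = 0"
  proof -
    have "(\<Sum>i\<in>insert n S. if i \<in> S then d i else 0) = x"
      unfolding S(3) using S(1) by (intro sum.mono_neutral_cong_right) auto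
    then show ?thesis using S(1) by (simp add: e_def sum_subtractf)
  qed
  ultimately have "e n = 0"
    using sum_comp_zero[of "insert n S" e n] S(1) by simp
  then have "x = (if n \<in> S then d n else 0)" by (simp add: e_def)
  then show ?thesis using S(2)[of n] by (auto simp: span_zero)
qed

lemma comp_unique:
  assumes x: "x \<in> comp i" "x \<in> comp j" "x \<noteq> 0"
  shows "i = j"
proof (rule ccontr)
  assume ij: "i \<noteq> j"
  have "(if i = i then x else - x) = 0"
  proof (rule sum_comp_zero[of "{i, j}" "\<lambda>l. if l = i then x else - x" i])
    show "(if l = i then x else - x) \<in> comp l" if "l \<in> {i, j}" for l
      using that x(1) ij subspace_neg[OF subspace_comp x(2)] by auto
  qed (use ij in auto)
  then show False using x(3) by simp
qed

lemma e_in_comp: "s \<in> R \<Longrightarrow> e s \<in> comp 0"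
  using span_e span_base[of "e s" "e ` R"] by blast

lemma e_in_A: "s \<in> R \<Longrightarrow> e s \<in> A"
  using e_in_comp comp_subset by blast

lemma graded_submodule_span:
  assumes H: "H \<subseteq> (\<Union>i. comp i)" and mult: "\<And>a h. a \<in> A \<Longrightarrow> h \<in> H \<Longrightarrow> a * h \<in> span H"
  shows "graded_submodule (span H)"
  unfolding graded_submodule_def
proof (intro conjI ballI)
  have HA: "H \<subseteq> A" using H comp_subset by blast
  show sub: "span H \<subseteq> A" by (rule span_minimal[OF HA subspace_A])
  show "subspace (span H)" by simp
  have "H \<subseteq> (\<Union>i. span H \<inter> comp i)" using H span_superset by blast
  then show "span H = span (\<Union>i. span H \<inter> comp i)"
    by (intro antisym span_mono span_minimal) auto
  fix a x assume a: "a \<in> A" and x: "x \<in> span H"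
  show "a * x \<in> span H"
    using x
  proof (induction rule: span_induct_alt)
    case base
    then show ?case by (simp add: span_zero)
  next
    case (step c h y)
    then show ?case
      using mult[OF a] HA a by (simp add: distrib_left scale_mult_right subset_iff span_add span_scale)
  qed
qed

section \<open>Cosets and isomorphisms of subquotients\<close>

lemma elt_set_plus_eq_iff:
  assumes "subspace N"
  shows "x +o N = y +o N \<longleftrightarrow> x - y \<in> N"
proof
  assume "x +o N = y +o N"
  moreover have "x \<in> x +o N" using subspace_0[OF assms] by (force simp: elt_set_plus_def)
  ultimately obtain n where "n \<in> N" "x = y + n" by (auto simp: elt_set_plus_def)
  then show "x - y \<in> N" by simp
next
  assume d: "x - y \<in> N"
  have "x + n = y + (x - y + n)" "y + n = x + (n - (x - y))" for n by simp_all
  then show "x +o N = y +o N"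
    using subspace_add[OF assms d] subspace_diff[OF assms _ d]
    unfolding elt_set_plus_def by blast
qed

lemma coset_add:
  assumes "subspace N"
  shows "(x +o N) + (y +o N) = (x + y) +o N"
proof
  show "(x +o N) + (y +o N) \<subseteq> (x + y) +o N"
    using subspace_add[OF assms] by (auto simp: elt_set_plus_def set_plus_def algebra_simps)
  show "(x + y) +o N \<subseteq> (x +o N) + (y +o N)"
  proof
    fix z assume "z \<in> (x + y) +o N"
    then obtain n where "n \<in> N" "z = (x + n) + (y + 0)" by (auto simp: elt_set_plus_def algebra_simps)
    then show "z \<in> (x +o N) + (y +o N)"
      using subspace_0[OF assms] unfolding elt_set_plus_def set_plus_def by blast
  qed
qed

text \<open>The image of a coset need not be a full coset; under the scalar 0 it is a single point.
  This is why the operations of \<open>subquotient\<close> add \<open>N\<close>.\<close>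

lemma coset_image_add:
  assumes N: "subspace N" and f: "\<And>n. n \<in> N \<Longrightarrow> f (x + n) - f x \<in> N"
  shows "f ` (x +o N) + N = f x +o N"
proof
  show "f ` (x +o N) + N \<subseteq> f x +o N"
  proof
    fix z assume "z \<in> f ` (x +o N) + N"
    then obtain n m where nm: "n \<in> N" "m \<in> N" "z = f (x + n) + m"
      by (auto simp: elt_set_plus_def set_plus_def)
    then have "z = f x + ((f (x + n) - f x) + m)" by simp
    then show "z \<in> f x +o N"
      using subspace_add[OF N f[OF nm(1)] nm(2)] unfolding elt_set_plus_def by blast
  qed
  show "f x +o N \<subseteq> f ` (x +o N) + N"
  proof
    fix z assume "z \<in> f x +o N"
    then obtain n where "n \<in> N" "z = f (x + 0) + n" by (auto simp: elt_set_plus_def)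
    moreover have "x + 0 \<in> x +o N" using subspace_0[OF N] unfolding elt_set_plus_def by blast
    ultimately show "z \<in> f ` (x +o N) + N" unfolding set_plus_def by blast
  qed
qed

text \<open>As cosets are sets, the inverse of the isomorphism \<open>P / K \<rightarrow> M / N\<close> given by right
  multiplication by \<open>g\<close> is easier to write down.\<close>

lemma graded_iso_right_mult:
  assumes sub: "graded_submodule M" "graded_submodule N" "graded_submodule P" "graded_submodule K"
    and g: "g \<in> A" and KP: "K \<subseteq> P"
    and into: "\<And>v. v \<in> P \<Longrightarrow> v * g \<in> M" and onto: "\<And>x. x \<in> M \<Longrightarrow> \<exists>v\<in>P. v * g - x \<in> N"
    and ker: "\<And>v. v \<in> P \<Longrightarrow> v * g \<in> N \<longleftrightarrow> v \<in> K"
    and deg: "\<And>i v. v \<in> P \<inter> comp i \<Longrightarrow> v * g \<in> comp (i + n)"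
    and low: "\<And>i x. i < n \<Longrightarrow> x \<in> M \<inter> comp i \<Longrightarrow> x \<in> N"
    and high: "\<And>i x. x \<in> M \<inter> comp (i + n) \<Longrightarrow> \<exists>v\<in>P \<inter> comp i. v * g - x \<in> N"
  shows "graded_iso A (subquotient M N) ((subquotient P K)\<langle>int n\<rangle>)"
proof -
  have ss: "subspace M" "subspace N" "subspace P" "subspace K"
    and PA: "P \<subseteq> A" and MA: "M \<subseteq> A" and NA: "N \<subseteq> A" and KA: "K \<subseteq> A"
    and act: "\<And>a x. a \<in> A \<Longrightarrow> x \<in> M \<Longrightarrow> a * x \<in> M" "\<And>a x. a \<in> A \<Longrightarrow> x \<in> N \<Longrightarrow> a * x \<in> N"
      "\<And>a x. a \<in> A \<Longrightarrow> x \<in> P \<Longrightarrow> a * x \<in> P" "\<And>a x. a \<in> A \<Longrightarrow> x \<in> K \<Longrightarrow> a * x \<in> K"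
    using sub by (auto simp: graded_submodule_def)
  define \<phi> where "\<phi> C = {v \<in> P. v * g \<in> C}" for C
  have \<phi>: "\<phi> (x +o N) = v +o K" if "v \<in> P" "v * g - x \<in> N" for x v
  proof (intro set_eqI iffI)
    fix w assume "w \<in> \<phi> (x +o N)"
    then have w: "w \<in> P" "w * g - x \<in> N" by (auto simp: \<phi>_def elt_set_plus_def)
    then have "(w - v) * g \<in> N"
      using subspace_diff[OF ss(2) w(2) that(2)] by (simp add: left_diff_distrib)
    then have "w - v \<in> K" using ker[of "w - v"] subspace_diff[OF ss(3) w(1) that(1)] by simp
    then show "w \<in> v +o K" unfolding elt_set_plus_def by (intro CollectI bexI[of _ "w - v"]) auto
  next
    fix w assume "w \<in> v +o K"
    then obtain k where k: "k \<in> K" "w = v + k" by (auto simp: elt_set_plus_def)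
    have "w * g - x = (v * g - x) + k * g" by (simp add: k distrib_right)
    moreover have "k * g \<in> N" using ker[of k] k(1) KP by blast
    ultimately have "w * g - x \<in> N" using subspace_add[OF ss(2) that(2)] by metis
    then have "w * g \<in> x +o N" unfolding elt_set_plus_def by (intro CollectI bexI[of _ "w * g - x"]) auto
    moreover have "w \<in> P" using k KP that(1) subspace_add[OF ss(3)] by blast
    ultimately show "w \<in> \<phi> (x +o N)" by (simp add: \<phi>_def)
  qed
  have \<phi>_mult: "\<phi> (v * g +o N) = v +o K" if "v \<in> P" for v
    using that subspace_0[OF ss(2)] by (intro \<phi>) simp_all
  have bij: "bij_betw \<phi> ((\<lambda>x. x +o N) ` M) ((\<lambda>x. x +o K) ` P)"
    unfolding bij_betw_def
  proof
    show "inj_on \<phi> ((\<lambda>x. x +o N) ` M)"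
    proof (rule inj_onI, clarify)
      fix x x' assume x: "x \<in> M" "x' \<in> M" "\<phi> (x +o N) = \<phi> (x' +o N)"
      obtain v v' where v: "v \<in> P" "v * g - x \<in> N" "v' \<in> P" "v' * g - x' \<in> N"
        using onto x by blast
      then have "v - v' \<in> K"
        using x(3) elt_set_plus_eq_iff[OF ss(4)] by (simp add: \<phi>)
      then have "(v - v') * g \<in> N"
        using ker[of "v - v'"] KP by blast
      moreover have "x - x' = (v - v') * g - (v * g - x) + (v' * g - x')"
        by (simp add: algebra_simps)
      ultimately have "x - x' \<in> N"
        using v subspace_add[OF ss(2)] subspace_diff[OF ss(2)] by metis
      then show "x +o N = x' +o N" using elt_set_plus_eq_iff[OF ss(2)] by simp
    qed
    show "\<phi> ` (\<lambda>x. x +o N) ` M = (\<lambda>x. x +o K) ` P"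
    proof
      show "\<phi> ` (\<lambda>x. x +o N) ` M \<subseteq> (\<lambda>x. x +o K) ` P"
        using \<phi> onto by blast
      show "(\<lambda>x. x +o K) ` P \<subseteq> \<phi> ` (\<lambda>x. x +o N) ` M"
        using \<phi>_mult into by blast
    qed
  qed
  have add: "\<phi> ((x +o N) + (y +o N)) = \<phi> (x +o N) + \<phi> (y +o N)" if xy: "x \<in> M" "y \<in> M" for x y
  proof -
    obtain v w where v: "v \<in> P" "v * g - x \<in> N" "w \<in> P" "w * g - y \<in> N"
      using onto[OF xy(1)] onto[OF xy(2)] by blast
    have eq: "(v + w) * g - (x + y) = (v * g - x) + (w * g - y)"
      by (simp add: algebra_simps)
    have "v + w \<in> P" "(v + w) * g - (x + y) \<in> N"
      unfolding eq using v subspace_add[OF ss(3)] subspace_add[OF ss(2)] by blast+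
    then show ?thesis using v by (simp add: coset_add ss \<phi>)
  qed
  have scale: "\<phi> (scale c ` (x +o N) + N) = scale c ` \<phi> (x +o N) + K" if x: "x \<in> M" for c x
  proof -
    obtain v where v: "v \<in> P" "v * g - x \<in> N" using onto[OF x] by blast
    moreover have "scale c v * g - scale c x = scale c (v * g - x)"
      using v(1) PA g by (simp add: scale_mult_left scale_right_diff_distrib subset_iff)
    ultimately have "scale c v \<in> P" "scale c v * g - scale c x \<in> N"
      using subspace_scale[OF ss(3)] subspace_scale[OF ss(2)] by simp_all
    then show ?thesis
      using v by (simp add: coset_image_add ss \<phi> scale_right_distrib subspace_scale)
  qed
  have mult: "\<phi> ((*) a ` (x +o N) + N) = (*) a ` \<phi> (x +o N) + K" if ax: "a \<in> A" "x \<in> M" for a x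
  proof -
    obtain v where v: "v \<in> P" "v * g - x \<in> N" using onto[OF ax(2)] by blast
    moreover have "a * v * g - a * x = a * (v * g - x)"
      by (simp add: right_diff_distrib mult.assoc)
    ultimately have "a * v \<in> P" "a * v * g - a * x \<in> N"
      using act ax by simp_all
    then show ?thesis
      using v act(2,4) ax by (simp add: coset_image_add ss \<phi> distrib_left)
  qed
  have comp: "\<phi> ` (\<lambda>x. x +o N) ` (if i < 0 then {0} else M \<inter> comp (nat i))
      = (\<lambda>x. x +o K) ` (if i - int n < 0 then {0} else P \<inter> comp (nat (i - int n)))" for i
  \<comment> \<open>Below the shift the target has only its zero coset, and \<open>low\<close> puts
    the source in the zero coset as well. Negative \<open>i\<close> belong to this case.\<close>
  proof (cases "i - int n < 0")
    case True
    let ?S = "if i < 0 then {0} else M \<inter> comp (nat i)"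
    have "0 \<in> ?S" using subspace_0[OF ss(1)] subspace_0[OF subspace_comp] by simp
    moreover have "x \<in> N" if "x \<in> ?S" for x
      using that low[of "nat i" x] True subspace_0[OF ss(2)] by (auto split: if_splits)
    moreover have "\<phi> (x +o N) = 0 +o K" if "x \<in> N" for x
      using that subspace_0[OF ss(3)] subspace_neg[OF ss(2)] by (intro \<phi>) simp_all
    ultimately have "(\<lambda>x. \<phi> (x +o N)) ` ?S = {0 +o K}" by blast
    then show ?thesis using True by (simp only: image_image if_True image_insert image_empty)
  next
    case False
    define k where "k = nat (i - int n)"
    have i: "\<not> i < 0" "nat i = k + n" using False by (auto simp: k_def)
    have "(\<lambda>x. \<phi> (x +o N)) ` (M \<inter> comp (k + n)) = (\<lambda>x. x +o K) ` (P \<inter> comp k)"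
    proof
      show "(\<lambda>x. \<phi> (x +o N)) ` (M \<inter> comp (k + n)) \<subseteq> (\<lambda>x. x +o K) ` (P \<inter> comp k)"
        using \<phi> high by blast
      show "(\<lambda>x. x +o K) ` (P \<inter> comp k) \<subseteq> (\<lambda>x. \<phi> (x +o N)) ` (M \<inter> comp (k + n))"
        using \<phi>_mult into deg by blast
    qed
    then show ?thesis using False i by (simp add: image_image k_def)
  qed
  show ?thesis
    unfolding graded_iso_def
  proof (intro exI[of _ \<phi>] conjI)
    show "\<forall>i. \<phi> ` mcomp (subquotient M N) i = mcomp (subquotient P K)\<langle>int n\<rangle> i"
      using comp by (simp add: subquotient_def mshift_def)
  qed (use bij add scale mult in \<open>auto simp: subquotient_def mshift_def\<close>)
qed

end


text \<open>Here \<open>supp y t\<close> means that the standard module of \<open>t\<close> is nonzero at \<open>y\<close>, where it is spanned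
  by the class of \<open>g y t\<close>. The strict total order \<open>below\<close> is opposite to a refinement of \<open>ord\<close>.\<close>

locale standard_basis = graded_algebra scale A comp R e
  for scale :: "'k::field \<Rightarrow> 'a::ring \<Rightarrow> 'a" and A :: "'a set" and comp :: "nat \<Rightarrow> 'a set"
    and R :: "'s set" and e :: "'s \<Rightarrow> 'a" +
  fixes ord :: "'s rel" and below supp :: "'s \<Rightarrow> 's \<Rightarrow> bool"
    and g :: "'s \<Rightarrow> 's \<Rightarrow> 'a" and dg :: "'s \<Rightarrow> 's \<Rightarrow> nat"
  assumes partial_order: "partial_order_on R ord"
    and below_irrefl: "\<not> below s s"
    and below_trans: "below s t \<Longrightarrow> below t u \<Longrightarrow> below s u"
    and ord_below: "(s, t) \<in> ord \<Longrightarrow> s \<noteq> t \<Longrightarrow> below t s"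
    and supp_ord: "y \<in> R \<Longrightarrow> t \<in> R \<Longrightarrow> supp y t \<Longrightarrow> (y, t) \<in> ord"
    and supp_refl: "supp s s"
    and has_top: "T \<subseteq> {t \<in> R. supp s t} \<Longrightarrow> T \<noteq> {} \<Longrightarrow> \<exists>t\<in>T. \<forall>u\<in>T. u = t \<or> below u t"
    and g_comp: "y \<in> R \<Longrightarrow> t \<in> R \<Longrightarrow> g y t \<in> comp (dg y t)"
    and e_g: "y \<in> R \<Longrightarrow> t \<in> R \<Longrightarrow> e y * g y t = g y t"
    and g_e: "y \<in> R \<Longrightarrow> t \<in> R \<Longrightarrow> g y t * e t = g y t"
    and g_refl: "s \<in> R \<Longrightarrow> g s s = e s"
    and factor_span: "\<lbrakk>y \<in> R; t \<in> R; s \<in> R; a \<in> A; b \<in> A\<rbrakk> \<Longrightarrow>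
      e y * a * e t * b * e s \<in> span {g y u * g u s | u. u \<in> R \<and> (u = t \<or> below u t) \<and> supp y u \<and> supp s u}"
    and g_indep: "\<lbrakk>y \<in> R; s \<in> R; finite T; T \<subseteq> {t \<in> R. supp y t \<and> supp s t};
      (\<Sum>t\<in>T. scale (c t) (g y t * g t s)) = 0; t \<in> T\<rbrakk> \<Longrightarrow> c t = 0"
begin

section \<open>Layers spanned by products with prescribed tops\<close>

lemma g_in_A: "y \<in> R \<Longrightarrow> t \<in> R \<Longrightarrow> g y t \<in> A"
  using g_comp comp_subset by blast

definition tops :: "'s \<Rightarrow> 's set" where
  "tops s = {t \<in> R. supp s t}"

definition index :: "'s set \<Rightarrow> ('s \<times> 's) set" where
  "index \<Gamma> = {(y, t). y \<in> R \<and> t \<in> \<Gamma> \<and> supp y t}"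

definition basis :: "'s \<Rightarrow> 's \<times> 's \<Rightarrow> 'a" where
  "basis s = (\<lambda>(y, t). g y t * g t s)"

definition layer :: "'s \<Rightarrow> 's set \<Rightarrow> 'a set" where
  "layer s \<Gamma> = span (basis s ` index \<Gamma>)"

text \<open>Applied to two-element sets, \<open>has_top\<close> makes \<open>below\<close> total on
  \<open>tops s\<close>. So these lower sets form a chain, and their layers can form a
  filtration.\<close>

definition down_closed :: "'s \<Rightarrow> 's set \<Rightarrow> bool" where
  "down_closed s \<Gamma> \<longleftrightarrow> \<Gamma> \<subseteq> tops s \<and> (\<forall>t\<in>\<Gamma>. \<forall>u\<in>tops s. below u t \<longrightarrow> u \<in> \<Gamma>)"

lemma basis_in_layer: "y \<in> R \<Longrightarrow> t \<in> \<Gamma> \<Longrightarrow> supp y t \<Longrightarrow> g y t * g t s \<in> layer s \<Gamma>"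
  unfolding layer_def by (rule span_base) (auto simp: index_def basis_def)

lemma layer_mono: "\<Gamma> \<subseteq> \<Gamma>' \<Longrightarrow> layer s \<Gamma> \<subseteq> layer s \<Gamma>'"
  unfolding layer_def by (intro span_mono image_mono) (auto simp: index_def)

lemma subspace_layer: "subspace (layer s \<Gamma>)"
  by (simp add: layer_def)

lemma factor_in_layer:
  assumes "down_closed s \<Gamma>" "y \<in> R" "s \<in> R" "a \<in> A" "b \<in> A" "t \<in> R"
    and "\<And>u. u \<in> tops s \<Longrightarrow> u = t \<or> below u t \<Longrightarrow> u \<in> \<Gamma>"
  shows "e y * a * e t * b * e s \<in> layer s \<Gamma>"
proof -
  have "{g y u * g u s | u. u \<in> R \<and> (u = t \<or> below u t) \<and> supp y u \<and> supp s u} \<subseteq> layer s \<Gamma>"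
    using assms by (auto intro!: basis_in_layer simp: tops_def)
  then show ?thesis
    using factor_span[of y t s a b] assms span_minimal[OF _ subspace_layer] by blast
qed

text \<open>The hypothesis \<open>g_indep\<close> concerns a single \<open>y\<close>; left
  multiplication by \<open>e y\<close> isolates the terms that belong to it.\<close>

lemma basis_sum_zero:
  assumes s: "s \<in> R" and S: "finite S" "S \<subseteq> index (tops s)"
    and zero: "(\<Sum>p\<in>S. scale (c p) (basis s p)) = 0" and p: "p \<in> S"
  shows "c p = 0"
proof -
  obtain y t where yt: "p = (y, t)" by (cases p)
  have y: "y \<in> R" using S(2) p yt by (auto simp: index_def)
  define T where "T = {u. (y, u) \<in> S}"
  have T: "finite T" "T \<subseteq> {t \<in> R. supp y t \<and> supp s t}"
  proof -
    show "finite T" unfolding T_def by (rule finite_surj[OF S(1), of _ snd]) force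
    show "T \<subseteq> {t \<in> R. supp y t \<and> supp s t}" using S(2) by (auto simp: T_def index_def tops_def)
  qed
  have scaled: "e y * scale (c q) (basis s q) = (if fst q = y then scale (c q) (basis s q) else 0)" if "q \<in> S" for q
  proof -
    obtain z u where q: "q = (z, u)" by (cases q)
    have zu: "z \<in> R" "u \<in> R" using S(2) that q by (auto simp: index_def tops_def)
    have "basis s q = e z * basis s q"
      using zu by (simp add: q basis_def e_g flip: mult.assoc)
    then have "e y * basis s q = (if z = y then basis s q else 0)"
      using zu y idempotent[OF y] orthogonal[OF y zu(1)] by (auto simp flip: mult.assoc) (metis mult.assoc mult_zero_left)
    moreover have "basis s q \<in> A" using zu s by (simp add: q basis_def g_in_A mult_closed)
    ultimately show ?thesis using e_in_A[OF y] by (simp add: scale_mult_right q)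
  qed
  have "0 = e y * (\<Sum>p\<in>S. scale (c p) (basis s p))" by (simp add: zero)
  also have "\<dots> = (\<Sum>q\<in>S. if fst q = y then scale (c q) (basis s q) else 0)"
    by (simp add: sum_distrib_left scaled)
  also have "\<dots> = (\<Sum>q\<in>Pair y ` T. scale (c q) (basis s q))"
    using S(1) by (intro sum.mono_neutral_cong_right) (auto simp: T_def)
  also have "\<dots> = (\<Sum>u\<in>T. scale (c (y, u)) (g y u * g u s))"
    by (subst sum.reindex) (auto simp: inj_on_def basis_def)
  finally show ?thesis
    using g_indep[OF y s T, of "\<lambda>u. c (y, u)" t] p yt by (simp add: T_def)
qed

text \<open>Independence is known for families indexed by pairs, so a repeated value would give a
  relation with coefficients 1 and -1.\<close>

lemma inj_basis: "s \<in> R \<Longrightarrow> inj_on (basis s) (index (tops s))"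
proof (rule inj_onI, rule ccontr)
  fix p q assume s: "s \<in> R" and pq: "p \<in> index (tops s)" "q \<in> index (tops s)" "basis s p = basis s q" "p \<noteq> q"
  have "(1 :: 'k) = 0"
    using basis_sum_zero[OF s, of "{p, q}" "\<lambda>r. if r = p then 1 else - 1" p] pq by simp
  then show False by simp
qed

lemma independent_basis:
  assumes s: "s \<in> R"
  shows "independent (basis s ` index (tops s))"
  unfolding independent_explicit_module
proof (intro allI impI)
  fix T u v
  assume T: "finite T" "T \<subseteq> basis s ` index (tops s)" "(\<Sum>v\<in>T. scale (u v) v) = 0" "v \<in> T"
  obtain S where S: "S \<subseteq> index (tops s)" "T = basis s ` S" using T(2) subset_imageE by blast
  have inj: "inj_on (basis s) S" using inj_on_subset[OF inj_basis[OF s] S(1)] .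
  have "(\<Sum>p\<in>S. scale (u (basis s p)) (basis s p)) = 0"
    using T(3) by (simp add: S(2) sum.reindex[OF inj])
  then show "u v = 0"
    using basis_sum_zero[OF s _ S(1), of "\<lambda>p. u (basis s p)"] T(1,4) S(2) finite_image_iff[OF inj] by auto
qed

text \<open>In coordinates a layer is described by vanishing conditions. In this form arbitrary
  intersections are harmless, whereas spans do not commute with intersections in general.\<close>

lemma layer_iff:
  assumes s: "s \<in> R" and \<Gamma>: "\<Gamma> \<subseteq> tops s"
  shows "x \<in> layer s \<Gamma> \<longleftrightarrow> x \<in> layer s (tops s) \<and>
    (\<forall>y t. y \<in> R \<and> t \<in> tops s - \<Gamma> \<and> supp y t \<longrightarrow>
      representation (basis s ` index (tops s)) x (g y t * g t s) = 0)"
    (is "_ \<longleftrightarrow> _ \<and> ?R")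
proof
  let ?B = "basis s ` index (tops s)" and ?B' = "basis s ` index \<Gamma>"
  have ind: "independent ?B" by (rule independent_basis[OF s])
  have sub: "index \<Gamma> \<subseteq> index (tops s)" using \<Gamma> by (auto simp: index_def)
  assume x: "x \<in> layer s \<Gamma>"
  have "representation ?B x = representation ?B' x"
    by (rule representation_extend[OF ind]) (use x sub in \<open>auto simp: layer_def\<close>)
  moreover have "g y t * g t s \<notin> ?B'" if "y \<in> R" "t \<in> tops s - \<Gamma>" "supp y t" for y t
  proof
    assume "g y t * g t s \<in> ?B'"
    then obtain q where q: "q \<in> index \<Gamma>" "basis s (y, t) = basis s q"
      by (auto simp: basis_def)
    have "(y, t) = q"
      by (rule inj_onD[OF inj_basis[OF s] q(2)]) (use that q sub in \<open>auto simp: index_def\<close>)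
    then show False using q(1) that by (auto simp: index_def)
  qed
  ultimately show "x \<in> layer s (tops s) \<and> ?R"
    using x layer_mono[OF \<Gamma>] representation_ne_zero by (metis subsetD)
next
  let ?B = "basis s ` index (tops s)"
  assume x: "x \<in> layer s (tops s) \<and> ?R"
  have ind: "independent ?B" by (rule independent_basis[OF s])
  have "x = (\<Sum>b | representation ?B x b \<noteq> 0. scale (representation ?B x b) b)"
    using sum_nonzero_representation_eq[OF ind] x by (simp add: layer_def)
  also have "\<dots> \<in> layer s \<Gamma>"
  proof (rule subspace_sum[OF subspace_layer], rule subspace_scale[OF subspace_layer])
    fix b assume "b \<in> {b. representation ?B x b \<noteq> 0}"
    then have b: "representation ?B x b \<noteq> 0" by simp
    then obtain y t where yt: "y \<in> R" "t \<in> tops s" "supp y t" "b = g y t * g t s"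
      using representation_ne_zero[OF b] by (auto simp: index_def basis_def)
    then show "b \<in> layer s \<Gamma>" using x b by (auto intro: basis_in_layer)
  qed
  finally show "x \<in> layer s \<Gamma>" .
qed

lemma layer_Inter:
  assumes s: "s \<in> R" and G: "G \<noteq> {}" "\<And>\<Gamma>. \<Gamma> \<in> G \<Longrightarrow> \<Gamma> \<subseteq> tops s"
  shows "(\<Inter>\<Gamma>\<in>G. layer s \<Gamma>) = layer s (\<Inter>G)"
proof -
  have sub: "\<Inter>G \<subseteq> tops s" using G by blast
  have "(\<forall>\<Gamma>\<in>G. x \<in> layer s \<Gamma>) \<longleftrightarrow> x \<in> layer s (\<Inter>G)" for x
  proof -
    have "(\<forall>\<Gamma>\<in>G. x \<in> layer s \<Gamma>) \<longleftrightarrow> (\<forall>\<Gamma>\<in>G. x \<in> layer s (tops s) \<and>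
        (\<forall>y t. y \<in> R \<and> t \<in> tops s - \<Gamma> \<and> supp y t \<longrightarrow>
          representation (basis s ` index (tops s)) x (g y t * g t s) = 0))"
      by (rule ball_cong[OF refl layer_iff[OF s G(2)]])
    then show ?thesis
      unfolding layer_iff[OF s sub] using G(1) by blast
  qed
  then show ?thesis by blast
qed

lemma layer_empty: "layer s {} = {0}"
  by (simp add: layer_def index_def)

text \<open>As \<open>supp t t\<close> holds, every top \<open>t\<close> contributes a basis element
  at \<open>t\<close> itself, so the set of tops can be recovered from its layer.\<close>

lemma basis_in_layer_iff:
  assumes s: "s \<in> R" and \<Gamma>: "\<Gamma> \<subseteq> tops s" and t: "t \<in> tops s"
  shows "g t t * g t s \<in> layer s \<Gamma> \<longleftrightarrow> t \<in> \<Gamma>"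
proof
  have tR: "t \<in> R" using t by (simp add: tops_def)
  assume "g t t * g t s \<in> layer s \<Gamma>"
  moreover have "g t t * g t s \<in> basis s ` index (tops s)"
    using t tR supp_refl by (force simp: index_def basis_def)
  then have "representation (basis s ` index (tops s)) (g t t * g t s) (g t t * g t s) = 1"
    using representation_basis[OF independent_basis[OF s]] by simp
  ultimately show "t \<in> \<Gamma>"
    unfolding layer_iff[OF s \<Gamma>] using t tR supp_refl by (metis DiffI zero_neq_one)
next
  assume "t \<in> \<Gamma>"
  then show "g t t * g t s \<in> layer s \<Gamma>"
    using t supp_refl by (intro basis_in_layer) (auto simp: tops_def)
qed

lemma layer_subset_iff:
  assumes s: "s \<in> R" and "\<Gamma> \<subseteq> tops s" "\<Gamma>' \<subseteq> tops s"
  shows "layer s \<Gamma> \<subseteq> layer s \<Gamma>' \<longleftrightarrow> \<Gamma> \<subseteq> \<Gamma>'"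
proof
  assume sub: "layer s \<Gamma> \<subseteq> layer s \<Gamma>'"
  show "\<Gamma> \<subseteq> \<Gamma>'"
  proof
    fix t assume "t \<in> \<Gamma>"
    then show "t \<in> \<Gamma>'"
      using sub basis_in_layer_iff[OF s assms(2), of t] basis_in_layer_iff[OF s assms(3), of t] assms(2)
      by blast
  qed
qed (rule layer_mono)

lemma basis_nonzero:
  assumes "s \<in> R" "y \<in> R" "t \<in> tops s" "supp y t"
  shows "g y t * g t s \<noteq> 0"
proof -
  have "basis s (y, t) \<in> basis s ` index (tops s)" using assms by (auto simp: index_def)
  then have "g y t * g t s \<in> basis s ` index (tops s)" by (simp add: basis_def)
  then show ?thesis
    using dependent_zero independent_basis[OF assms(1)] by force
qed

lemma basis_homogeneous: "s \<in> R \<Longrightarrow> \<Gamma> \<subseteq> R \<Longrightarrow> basis s ` index \<Gamma> \<subseteq> (\<Union>i. comp i)"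
  using comp_mult[OF g_comp g_comp] by (fastforce simp: index_def basis_def)

text \<open>The Peirce decomposition takes the place of a unit: since \<open>x * e s = x\<close>,
  only the right component at \<open>s\<close> survives, and the finitely many left components can
  be treated separately.\<close>

lemma span_via_idempotents:
  assumes W: "subspace W" and x: "x \<in> A" "x * e s = x" and s: "s \<in> R"
    and xW: "\<And>p. p \<in> R \<Longrightarrow> e p * x \<in> W"
  shows "x \<in> W"
proof -
  obtain S where S: "finite S" "S \<subseteq> R" "x = (\<Sum>p\<in>S. \<Sum>q\<in>S. e p * x * e q)"
    using Peirce[OF x(1)] by blast
  have "e p * x * e q \<in> W" if "p \<in> S" "q \<in> S" for p q
  proof (cases "q = s")
    case True
    then show ?thesis using xW[of p] x(2) S(2) that by (auto simp: mult.assoc)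
  next
    case False
    have "e p * x * e q = e p * (x * (e s * e q))"
      using x(2) by (simp flip: mult.assoc)
    also have "\<dots> = 0" using orthogonal[of s q] False s S(2) that by auto
    finally show ?thesis using subspace_0[OF W] by simp
  qed
  then show ?thesis by (subst S(3)) (intro subspace_sum[OF W])
qed

text \<open>After multiplication by \<open>a\<close> a product with top \<open>t\<close> still
  factors through \<open>t\<close>, so \<open>factor_span\<close> rewrites it with tops equal to or
  below \<open>t\<close>; these stay in a lower set.\<close>

lemma graded_submodule_layer:
  assumes s: "s \<in> R" and \<Gamma>: "down_closed s \<Gamma>"
  shows "graded_submodule (layer s \<Gamma>)"
  unfolding layer_def
proof (rule graded_submodule_span)
  have \<Gamma>R: "\<Gamma> \<subseteq> R" using \<Gamma> by (auto simp: down_closed_def tops_def)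
  show "basis s ` index \<Gamma> \<subseteq> (\<Union>i. comp i)" by (rule basis_homogeneous[OF s \<Gamma>R])
  fix a h assume a: "a \<in> A" and "h \<in> basis s ` index \<Gamma>"
  then obtain y t where yt: "y \<in> R" "t \<in> \<Gamma>" "supp y t" "h = g y t * g t s"
    by (auto simp: index_def basis_def)
  then have t: "t \<in> R" using \<Gamma>R by blast
  have "a * h \<in> layer s \<Gamma>"
  proof (rule span_via_idempotents[OF subspace_layer _ _ s])
    show "a * h \<in> A" using a yt t s by (simp add: g_in_A mult_closed)
    show "a * h * e s = a * h" using yt t s by (simp add: mult.assoc g_e)
    fix p assume p: "p \<in> R"
    have "e p * (a * g y t) * e t * g t s * e s \<in> layer s \<Gamma>"
      by (rule factor_in_layer[OF \<Gamma> p s])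
        (use a yt t s \<Gamma> in \<open>auto simp: g_in_A mult_closed down_closed_def\<close>)
    also have "e p * (a * g y t) * e t * g t s * e s = e p * (a * h)"
    proof -
      have "e p * (a * g y t) * e t * g t s * e s = e p * a * (g y t * e t) * (g t s * e s)"
        by (simp add: mult.assoc)
      then show ?thesis using yt t s by (simp add: g_e mult.assoc)
    qed
    finally show "e p * (a * h) \<in> layer s \<Gamma>" .
  qed
  then show "a * h \<in> span (basis s ` index \<Gamma>)" by (simp add: layer_def)
qed

section \<open>Projectives, standard kernels and sections as layers\<close>

lemma down_closed_tops: "down_closed s (tops s)" "down_closed s {}"
  by (auto simp: down_closed_def)

lemma down_closed_remove_top:
  assumes "down_closed s \<Gamma>" "\<And>u. u \<in> \<Gamma> \<Longrightarrow> u = t \<or> below u t"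
  shows "down_closed s (\<Gamma> - {t})"
proof -
  have "\<not> below t u" if "u \<in> \<Gamma> - {t}" for u
    using assms(2)[of u] that below_trans[of t u t] below_irrefl by blast
  then show ?thesis using assms(1) unfolding down_closed_def by blast
qed

lemma tops_below: "s \<in> R \<Longrightarrow> t \<in> tops s \<Longrightarrow> t = s \<or> below t s"
  using supp_ord[of s t] ord_below[of s t] by (auto simp: tops_def)

lemma self_in_tops: "s \<in> R \<Longrightarrow> s \<in> tops s"
  by (simp add: tops_def supp_refl)

lemma down_closed_strict: "s \<in> R \<Longrightarrow> down_closed s (tops s - {s})"
  using tops_below below_trans below_irrefl unfolding down_closed_def by blast

lemma proj_eq_layer:
  assumes s: "s \<in> R"
  shows "proj s = layer s (tops s)"
proof
  show "proj s \<subseteq> layer s (tops s)"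
  proof
    fix x assume "x \<in> proj s"
    then obtain a where a: "a \<in> A" "x = a * e s" by (auto simp: proj_def)
    show "x \<in> layer s (tops s)"
    proof (rule span_via_idempotents[OF subspace_layer _ _ s])
      show "x \<in> A" using a s by (simp add: e_in_A mult_closed)
      show "x * e s = x" using a s by (simp add: mult.assoc idempotent)
      fix p assume p: "p \<in> R"
      have "e p * a * e s * e s * e s \<in> layer s (tops s)"
        by (rule factor_in_layer[OF down_closed_tops(1) p s]) (use a s in \<open>auto simp: e_in_A\<close>)
      then show "e p * x \<in> layer s (tops s)"
        using a s by (simp add: mult.assoc idempotent)
    qed
  qed
  have "subspace (proj s)"
    unfolding subspace_def
  proof (intro conjI ballI allI)
    show "0 \<in> proj s" using subspace_0[OF subspace_A] by (force simp: proj_def)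
    show "x + y \<in> proj s" if "x \<in> proj s" "y \<in> proj s" for x y
      using that subspace_add[OF subspace_A] by (auto simp: proj_def) (metis distrib_right)
    show "scale c x \<in> proj s" if "x \<in> proj s" for c x
      using that subspace_scale[OF subspace_A] e_in_A[OF s] by (auto simp: proj_def) (metis scale_mult_left)
  qed
  moreover have "basis s ` index (tops s) \<subseteq> proj s"
  proof clarify
    fix y t assume "(y, t) \<in> index (tops s)"
    then have yt: "y \<in> R" "t \<in> R" by (auto simp: index_def tops_def)
    then have "basis s (y, t) = g y t * g t s * e s" "g y t * g t s \<in> A"
      using s by (simp_all add: basis_def mult.assoc g_e g_in_A mult_closed)
    then show "basis s (y, t) \<in> proj s" by (auto simp: proj_def)
  qed
  ultimately show "layer s (tops s) \<subseteq> proj s"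
    unfolding layer_def by (intro span_minimal)
qed

text \<open>Factoring through a \<open>t\<close> strictly above \<open>s\<close> in
  \<open>ord\<close> means factoring through a \<open>t\<close> below \<open>s\<close>, which
  excludes the top \<open>s\<close>. Conversely, a product with top \<open>t \<noteq> s\<close>
  visibly factors through \<open>t\<close>.\<close>

lemma standard_kernel_eq_layer:
  assumes s: "s \<in> R"
  shows "standard_kernel ord s = layer s (tops s - {s})"
proof
  show "standard_kernel ord s \<subseteq> layer s (tops s - {s})"
    unfolding standard_kernel_def
  proof (rule span_minimal[OF _ subspace_layer], clarify)
    fix a t b assume ab: "a \<in> A" "b \<in> A" and t: "t \<in> R" "(s, t) \<in> ord" "t \<noteq> s"
    have bt: "below t s" using ord_below t by blast
    show "a * e t * b * e s \<in> layer s (tops s - {s})"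
    proof (rule span_via_idempotents[OF subspace_layer _ _ s])
      show "a * e t * b * e s \<in> A" using ab t s by (simp add: e_in_A mult_closed)
      show "a * e t * b * e s * e s = a * e t * b * e s" using s by (simp add: mult.assoc idempotent)
      fix p assume p: "p \<in> R"
      have "e p * a * e t * b * e s \<in> layer s (tops s - {s})"
        by (rule factor_in_layer[OF down_closed_strict[OF s] p s])
          (use ab t bt below_trans below_irrefl in auto)
      then show "e p * (a * e t * b * e s) \<in> layer s (tops s - {s})" by (simp add: mult.assoc)
    qed
  qed
  show "layer s (tops s - {s}) \<subseteq> standard_kernel ord s"
    unfolding layer_def standard_kernel_def
  proof (rule span_mono, clarify)
    fix y t assume "(y, t) \<in> index (tops s - {s})"
    then have yt: "y \<in> R" "t \<in> R" "supp s t" "t \<noteq> s" by (auto simp: index_def tops_def)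
    then have "basis s (y, t) = g y t * e t * g t s * e s"
      using s by (simp add: basis_def mult.assoc g_e)
    then show "\<exists>a t' b. basis s (y, t) = a * e t' * b * e s \<and> a \<in> A \<and> b \<in> A \<and> t' \<in> R \<and> (s, t') \<in> ord \<and> t' \<noteq> s"
      using yt s supp_ord by (blast intro: g_in_A)
  qed
qed

lemma right_mult_span:
  assumes W: "subspace W" and H: "H \<subseteq> A" "\<And>h. h \<in> H \<Longrightarrow> h * c \<in> W" and c: "c \<in> A" and x: "x \<in> span H"
  shows "x * c \<in> W"
  using x
proof (induction rule: span_induct_alt)
  case base
  then show ?case using subspace_0[OF W] by simp
next
  case (step a h y)
  then show ?case
    using H c subspace_add[OF W] subspace_scale[OF W] by (simp add: distrib_right scale_mult_left subset_iff)
qed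

lemma basis_in_A: "s \<in> R \<Longrightarrow> \<Gamma> \<subseteq> R \<Longrightarrow> basis s ` index \<Gamma> \<subseteq> A"
  using basis_homogeneous comp_subset by blast

lemma layer_insert:
  assumes "t \<in> \<Gamma>" "x \<in> layer s \<Gamma>"
  obtains v w where "v \<in> layer s {t}" "w \<in> layer s (\<Gamma> - {t})" "x = v + w"
proof -
  have "index \<Gamma> = index {t} \<union> index (\<Gamma> - {t})" using assms(1) by (auto simp: index_def)
  then show ?thesis using assms(2) that by (auto simp: layer_def image_Un span_Un)
qed

text \<open>Right multiplication by \<open>g t s\<close> sends the generators \<open>g y t\<close>
  of the standard module of \<open>t\<close> to the basis elements with top \<open>t\<close>.
  Elements of the standard kernel of \<open>t\<close> factor through points below \<open>t\<close>
  and land in the layer of \<open>\<Gamma> - {t}\<close>.\<close>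

lemma graded_iso_section:
  assumes s: "s \<in> R" and \<Gamma>: "down_closed s \<Gamma>" and t: "t \<in> \<Gamma>" and top: "\<And>u. u \<in> \<Gamma> \<Longrightarrow> u = t \<or> below u t"
  shows "graded_iso A (subquotient (layer s \<Gamma>) (layer s (\<Gamma> - {t}))) ((standard ord t)\<langle>int (dg t s)\<rangle>)"
proof -
  have tR: "t \<in> R" and ts: "t \<in> tops s" and \<Gamma>R: "\<Gamma> \<subseteq> R" and \<Gamma>s: "\<Gamma> \<subseteq> tops s"
    using \<Gamma> t by (auto simp: down_closed_def tops_def)
  have \<Gamma>': "down_closed s (\<Gamma> - {t})"
    by (rule down_closed_remove_top[OF \<Gamma> top])
  have low: "v \<in> \<Gamma> - {t}" if "v \<in> tops s" "v = u \<or> below v u" "below u t" for u v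
    using that \<Gamma> t below_trans below_irrefl unfolding down_closed_def by blast
  have gt: "g y t * g t t = g y t" if "y \<in> R" for y
    using that tR by (simp add: g_refl g_e)
  have gA: "g t s \<in> A" using g_in_A tR s by simp
  have topsR: "tops t \<subseteq> R" "{t} \<subseteq> R" "tops t - {t} \<subseteq> R" using tR by (auto simp: tops_def)
  have K_into: "v * g t s \<in> layer s (\<Gamma> - {t})" if "v \<in> layer t (tops t - {t})" for v
  proof (rule right_mult_span[OF subspace_layer basis_in_A[OF tR topsR(3)] _ gA that[unfolded layer_def]])
    fix h assume "h \<in> basis t ` index (tops t - {t})"
    then obtain y u where yu: "y \<in> R" "u \<in> tops t" "u \<noteq> t" "h = g y u * g u t"
      by (auto simp: index_def basis_def)
    have ut: "below u t" "u \<in> R" using tops_below[OF tR yu(2)] yu(2,3) by (auto simp: tops_def)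
    have "e y * g y u * e u * (g u t * g t s) * e s \<in> layer s (\<Gamma> - {t})"
      by (rule factor_in_layer[OF \<Gamma>' yu(1) s])
        (use yu ut tR s low in \<open>auto simp: g_in_A mult_closed\<close>)
    also have "e y * g y u * e u * (g u t * g t s) * e s = h * g t s"
    proof -
      have "e y * g y u * e u * (g u t * g t s) * e s = e y * (g y u * e u) * g u t * (g t s * e s)"
        by (simp add: mult.assoc)
      then show ?thesis using yu ut tR s by (simp add: g_e e_g)
    qed
    finally show "h * g t s \<in> layer s (\<Gamma> - {t})" .
  qed
  have t_into: "v * g t s \<in> layer s {t}" if "v \<in> layer t {t}" for v
  proof (rule right_mult_span[OF subspace_layer basis_in_A[OF tR topsR(2)] _ gA that[unfolded layer_def]])
    fix h assume "h \<in> basis t ` index {t}"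
    then obtain y where y: "y \<in> R" "supp y t" "h = g y t"
      by (auto simp: index_def basis_def gt)
    then show "h * g t s \<in> layer s {t}" by (simp add: basis_in_layer)
  qed
  \<comment> \<open>The generators \<open>g y t\<close> go to distinct elements of the basis for
    \<open>s\<close>, so all coefficients must vanish.\<close>
  have inj: "w = 0" if w: "w \<in> layer t {t}" "w * g t s = 0" for w
  proof -
    obtain T c where T: "finite T" "T \<subseteq> basis t ` index {t}" "w = (\<Sum>b\<in>T. scale (c b) b)"
      using w(1) by (auto simp: layer_def span_explicit)
    obtain S where S: "S \<subseteq> index {t}" "inj_on (basis t) S" "T = basis t ` S"
      using T(2) by (metis subset_image_inj)
    have fS: "finite S" using T(1) S(2,3) by (simp add: finite_image_iff)
    have w_eq: "w = (\<Sum>p\<in>S. scale (c (basis t p)) (basis t p))"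
      by (simp add: T(3) S(3) sum.reindex[OF S(2)])
    have "scale (c (basis t p)) (basis t p) * g t s = scale (c (basis t p)) (basis s p)" if p: "p \<in> S" for p
    proof -
      obtain y where y: "p = (y, t)" "y \<in> R" using S(1) p by (auto simp: index_def)
      then have "basis t p = g y t" "basis s p = g y t * g t s" by (simp_all add: basis_def gt)
      then show ?thesis using y tR gA by (simp add: scale_mult_left g_in_A)
    qed
    then have "(\<Sum>p\<in>S. scale (c (basis t p)) (basis s p)) = 0"
      using w(2) by (simp add: w_eq sum_distrib_right)
    moreover have "S \<subseteq> index (tops s)" using S(1) ts by (auto simp: index_def)
    ultimately have "c (basis t p) = 0" if "p \<in> S" for p
      using basis_sum_zero[OF s fS, of "\<lambda>p. c (basis t p)" p] that by blast
    then show "w = 0" by (simp add: w_eq)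
  qed
  have mono: "layer s {t} \<subseteq> layer s \<Gamma>" "layer s (\<Gamma> - {t}) \<subseteq> layer s \<Gamma>"
    "layer t {t} \<subseteq> layer t (tops t)" "layer t (tops t - {t}) \<subseteq> layer t (tops t)"
    using t self_in_tops[OF tR] by (auto intro!: layer_mono)
  have split: "(\<exists>y\<in>R. supp y t \<and> h = g y t * g t s) \<or> h \<in> layer s (\<Gamma> - {t})" if "h \<in> basis s ` index \<Gamma>" for h
    using that by (auto simp: index_def basis_def intro: basis_in_layer)
  \<comment> \<open>Being a basis element, the product is nonzero and so has only one
    degree.\<close>
  have degree: "i = dg y t + dg t s" if "y \<in> R" "supp y t" "g y t * g t s \<in> comp i" for y i
    using comp_unique[OF that(3) comp_mult[OF g_comp g_comp]] basis_nonzero[OF s] that tR s ts by blast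
  have g_layer: "g y t \<in> layer t {t}" if "y \<in> R" "supp y t" for y
    using basis_in_layer[of y t "{t}" t] that by (simp add: gt)
  \<comment> \<open>Used twice: with \<open>Q\<close> the whole projective module for surjectivity,
    and with \<open>Q\<close> its part of degree \<open>i\<close> for surjectivity in each
    degree.\<close>
  have lift: "\<exists>v\<in>Q. v * g t s - x \<in> layer s (\<Gamma> - {t})"
    if Q: "subspace Q" "Q \<subseteq> A" and H: "\<And>h. h \<in> H \<Longrightarrow> \<exists>v\<in>Q. v * g t s - h \<in> layer s (\<Gamma> - {t})"
      and x: "x \<in> span H" for Q H x
    using x
  proof (induction rule: span_induct_alt)
    case base
    then show ?case
      using subspace_0[OF Q(1)] subspace_0[OF subspace_layer] by (intro bexI[of _ 0]) simp_all
  next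
    case (step c h y)
    obtain v w where vw: "v \<in> Q" "v * g t s - h \<in> layer s (\<Gamma> - {t})" "w \<in> Q" "w * g t s - y \<in> layer s (\<Gamma> - {t})"
      using step.IH H[OF step.hyps] by blast
    have "v \<in> A" using vw(1) Q(2) by blast
    then have "(scale c v + w) * g t s - (scale c h + y) = scale c (v * g t s - h) + (w * g t s - y)"
      using gA by (simp add: scale_mult_left scale_right_diff_distrib distrib_right)
    moreover have "scale c (v * g t s - h) + (w * g t s - y) \<in> layer s (\<Gamma> - {t})"
      using vw by (intro subspace_add[OF subspace_layer] subspace_scale[OF subspace_layer])
    moreover have "scale c v + w \<in> Q"
      using vw by (intro subspace_add[OF Q(1)] subspace_scale[OF Q(1)])
    ultimately show ?case by metis
  qed
  have lift_zero: "\<exists>v\<in>Q. v * g t s - h \<in> layer s (\<Gamma> - {t})"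
    if "subspace Q" "h \<in> layer s (\<Gamma> - {t})" for Q h
    using subspace_0[OF that(1)] subspace_neg[OF subspace_layer that(2)] by (intro bexI[of _ 0]) simp_all
  have lift_g: "\<exists>v\<in>Q. v * g t s - h \<in> layer s (\<Gamma> - {t})"
    if "h = g y t * g t s" "g y t \<in> Q" for Q h y
    using that subspace_0[OF subspace_layer] by (intro bexI[of _ "g y t"]) simp_all
  have Q: "layer t (tops t) \<subseteq> A" "subspace (layer t (tops t) \<inter> comp i)" for i
    using graded_submodule_layer[OF tR down_closed_tops(1)] subspace_inter[OF subspace_layer subspace_comp]
    by (auto simp: graded_submodule_def)
  show ?thesis
    unfolding standard_def proj_eq_layer[OF tR] standard_kernel_eq_layer[OF tR]
  proof (rule graded_iso_right_mult)
    show "graded_submodule (layer s \<Gamma>)" "graded_submodule (layer s (\<Gamma> - {t}))"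
      "graded_submodule (layer t (tops t))" "graded_submodule (layer t (tops t - {t}))"
      by (intro graded_submodule_layer s tR \<Gamma> \<Gamma>' down_closed_tops down_closed_strict)+
    show "g t s \<in> A" by (rule gA)
    show "layer t (tops t - {t}) \<subseteq> layer t (tops t)" by (rule mono)
    show "v * g t s \<in> layer s \<Gamma>" if v: "v \<in> layer t (tops t)" for v
    proof -
      obtain w k where wk: "w \<in> layer t {t}" "k \<in> layer t (tops t - {t})" "v = w + k"
        using layer_insert[OF self_in_tops[OF tR] v] .
      show ?thesis
        unfolding wk(3) distrib_right
        by (intro subspace_add[OF subspace_layer] subsetD[OF mono(1) t_into] subsetD[OF mono(2) K_into] wk)
    qed
    show "v * g t s \<in> layer s (\<Gamma> - {t}) \<longleftrightarrow> v \<in> layer t (tops t - {t})" if v: "v \<in> layer t (tops t)" for v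
    proof
      assume vN: "v * g t s \<in> layer s (\<Gamma> - {t})"
      obtain w k where wk: "w \<in> layer t {t}" "k \<in> layer t (tops t - {t})" "v = w + k"
        using layer_insert[OF self_in_tops[OF tR] v] .
      have "w * g t s = v * g t s - k * g t s" by (simp add: wk(3) distrib_right)
      then have "w * g t s \<in> layer s (\<Gamma> - {t})"
        using subspace_diff[OF subspace_layer vN K_into[OF wk(2)]] by simp
      \<comment> \<open>Layers of disjoint sets of tops meet only in zero.\<close>
      moreover have "(\<Inter>\<Gamma>\<in>{{t}, \<Gamma> - {t}}. layer s \<Gamma>) = layer s (\<Inter>{{t}, \<Gamma> - {t}})"
        by (rule layer_Inter[OF s]) (use ts \<Gamma>s in auto)
      ultimately have "w * g t s = 0"
        using t_into[OF wk(1)] by (auto simp: layer_empty)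
      then have "w = 0" using inj wk(1) by blast
      then show "v \<in> layer t (tops t - {t})" using wk by simp
    qed (rule K_into)
    show "v * g t s \<in> comp (i + dg t s)" if "v \<in> layer t (tops t) \<inter> comp i" for i v
      using that comp_mult[OF _ g_comp[OF tR s]] by blast
    show "\<exists>v\<in>layer t (tops t). v * g t s - x \<in> layer s (\<Gamma> - {t})" if x: "x \<in> layer s \<Gamma>" for x
    proof (rule lift[OF subspace_layer Q(1) _ x[unfolded layer_def]])
      show "\<exists>v\<in>layer t (tops t). v * g t s - h \<in> layer s (\<Gamma> - {t})" if "h \<in> basis s ` index \<Gamma>" for h
        using split[OF that]
      proof
        assume "\<exists>y\<in>R. supp y t \<and> h = g y t * g t s"
        then obtain y where y: "y \<in> R" "supp y t" "h = g y t * g t s" by blast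
        then show ?thesis by (intro lift_g[OF y(3)] subsetD[OF mono(3) g_layer])
      qed (rule lift_zero[OF subspace_layer])
    qed
    show "\<exists>v\<in>layer t (tops t) \<inter> comp i. v * g t s - x \<in> layer s (\<Gamma> - {t})"
      if x: "x \<in> layer s \<Gamma> \<inter> comp (i + dg t s)" for i x
    proof (rule lift[OF Q(2)])
      show "x \<in> span (basis s ` index \<Gamma> \<inter> comp (i + dg t s))"
        by (rule span_homogeneous[OF basis_homogeneous[OF s \<Gamma>R]]) (use x in \<open>auto simp: layer_def\<close>)
      fix h assume h: "h \<in> basis s ` index \<Gamma> \<inter> comp (i + dg t s)"
      then consider y where "y \<in> R" "supp y t" "h = g y t * g t s" | "h \<in> layer s (\<Gamma> - {t})"
        using split by blast
      then show "\<exists>v\<in>layer t (tops t) \<inter> comp i. v * g t s - h \<in> layer s (\<Gamma> - {t})"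
      proof cases
        case 1
        then have "g y t \<in> comp i" using degree[of y "i + dg t s"] g_comp[OF 1(1) tR] h by simp
        then show ?thesis using g_layer[OF 1(1,2)] mono(3) by (intro lift_g[OF 1(3)]) blast
      next
        case 2
        then show ?thesis by (rule lift_zero[OF Q(2)])
      qed
    qed (use Q(1) in blast)
    show "x \<in> layer s (\<Gamma> - {t})" if i: "i < dg t s" and x: "x \<in> layer s \<Gamma> \<inter> comp i" for i x
    proof -
      have "x \<in> span (basis s ` index \<Gamma> \<inter> comp i)"
        by (rule span_homogeneous[OF basis_homogeneous[OF s \<Gamma>R]]) (use x in \<open>auto simp: layer_def\<close>)
      moreover have "basis s ` index \<Gamma> \<inter> comp i \<subseteq> layer s (\<Gamma> - {t})"
      proof
        fix h assume h: "h \<in> basis s ` index \<Gamma> \<inter> comp i"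
        have "h \<noteq> g y t * g t s" if "y \<in> R" "supp y t" for y
          using degree[OF that, of i] h i by auto
        then show "h \<in> layer s (\<Gamma> - {t})" using split[of h] h by blast
      qed
      ultimately show ?thesis using span_minimal[OF _ subspace_layer] by blast
    qed
  qed
qed

text \<open>Modulo the kernel only products with top \<open>s\<close> survive, and they live at
  points \<open>y\<close> with \<open>supp y s\<close>, hence below \<open>s\<close> in
  \<open>ord\<close>.\<close>

lemma standard_zero:
  assumes s: "s \<in> R" and t: "t \<in> R" and ts: "(t, s) \<notin> ord" and x: "x \<in> mcarrier (standard ord s)"
  shows "mact (standard ord s) (e t) x = mzero (standard ord s)"
proof -
  let ?K = "layer s (tops s - {s})"
  obtain v where v: "v \<in> layer s (tops s)" "x = v +o ?K"
    using x s by (auto simp: standard_def subquotient_def proj_eq_layer standard_kernel_eq_layer)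
  have "e t * v \<in> ?K"
    using v(1) unfolding layer_def[of s "tops s"]
  proof (induction rule: span_induct_alt)
    case base
    then show ?case using subspace_0[OF subspace_layer] by simp
  next
    case (step c h w)
    obtain y u where yu: "y \<in> R" "u \<in> R" "u \<in> tops s" "supp y u" "h = g y u * g u s"
      using step.hyps by (auto simp: index_def basis_def tops_def)
    have "e y * h = e y * g y u * g u s" by (simp only: yu(5) mult.assoc)
    then have h: "e y * h = h" by (simp only: e_g[OF yu(1,2)] yu(5))
    have "e t * h \<in> ?K"
    proof (cases "t = y")
      case True
      have "u \<noteq> s" using ts supp_ord[OF t s] yu(4) True by auto
      then have "h \<in> ?K" using yu by (simp add: basis_in_layer)
      then show ?thesis using True h by simp
    next
      case False
      have "e t * h = e t * e y * h" by (simp only: mult.assoc h)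
      then show ?thesis
        using orthogonal[OF t yu(1) False] subspace_0[OF subspace_layer] by simp
    qed
    moreover have "h \<in> A" using yu s by (simp add: g_in_A mult_closed)
    ultimately show ?case
      using step.IH e_in_A[OF t] subspace_add[OF subspace_layer] subspace_scale[OF subspace_layer]
      by (simp add: distrib_left scale_mult_right)
  qed
  moreover have "graded_submodule ?K"
    by (rule graded_submodule_layer[OF s down_closed_strict[OF s]])
  then have "(*) (e t) ` x + ?K = (e t * v) +o ?K"
    unfolding v(2) using e_in_A[OF t]
    by (intro coset_image_add[OF subspace_layer]) (auto simp: distrib_left graded_submodule_def)
  moreover have "(e t * v) +o ?K = ?K \<longleftrightarrow> e t * v \<in> ?K"
    using elt_set_plus_eq_iff[OF subspace_layer[of s "tops s - {s}"], of "e t * v" 0] by simp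
  ultimately show ?thesis
    using s by (simp add: standard_def subquotient_def standard_kernel_eq_layer)
qed

lemma standard_kernel_filtration:
  assumes s: "s \<in> R"
  shows "\<exists>\<F>. filtration \<F> (standard_kernel ord s) \<and>
    (\<forall>M N. consecutive \<F> M N \<longrightarrow> (\<exists>t\<in>R. \<exists>n. (s, t) \<in> ord \<and> t \<noteq> s \<and>
      graded_iso A (subquotient M N) ((standard ord t)\<langle>n\<rangle>)))"
proof -
  define D where "D = {\<Gamma>. down_closed s \<Gamma> \<and> \<Gamma> \<subseteq> tops s - {s}}"
  have D: "\<Gamma> \<subseteq> tops s" "down_closed s \<Gamma>" if "\<Gamma> \<in> D" for \<Gamma> using that by (auto simp: D_def)
  have top: "\<exists>t\<in>\<Gamma>. \<forall>u\<in>\<Gamma>. u = t \<or> below u t" if "\<Gamma> \<subseteq> tops s" "\<Gamma> \<noteq> {}" for \<Gamma>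
    using has_top that by (simp add: tops_def)
  have "filtration (layer s ` D) (standard_kernel ord s)"
    unfolding filtration_def standard_kernel_eq_layer[OF s]
  proof (intro conjI allI impI)
    show "\<forall>M\<in>layer s ` D. graded_submodule M \<and> M \<subseteq> layer s (tops s - {s})"
      using graded_submodule_layer[OF s] layer_mono by (auto simp: D_def)
    show "layer s (tops s - {s}) \<in> layer s ` D"
      using down_closed_strict[OF s] by (auto simp: D_def)
    show "{0} \<in> layer s ` D"
      unfolding layer_empty[of s, symmetric] using down_closed_tops(2) by (auto simp: D_def)
    fix G assume "G \<subseteq> layer s ` D" "G \<noteq> {}"
    then obtain E where E: "E \<subseteq> D" "G = layer s ` E" "E \<noteq> {}" by (metis image_is_empty subset_image_iff)
    show "\<Inter>G \<in> layer s ` D"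
    proof -
      have "\<Inter>G = layer s (\<Inter>E)"
        unfolding E(2) using E(1,3) D(1) by (intro layer_Inter[OF s]) auto
      moreover have "\<Inter>E \<in> D" using E(1,3) unfolding D_def down_closed_def by blast
      ultimately show ?thesis by blast
    qed
    \<comment> \<open>The greatest element of the union lies in some member of \<open>E\<close>, and
      being a lower set that member contains all the others.\<close>
    show "\<Union>G \<in> G"
    proof (cases "\<Union>E = {}")
      case True
      then have "E = {{}}" using E(3) by auto
      then show ?thesis by (simp add: E(2))
    next
      case False
      then obtain t where t: "t \<in> \<Union>E" "\<forall>u\<in>\<Union>E. u = t \<or> below u t"
        using top[of "\<Union>E"] E(1) D(1) by blast
      then obtain \<Gamma> where \<Gamma>: "\<Gamma> \<in> E" "t \<in> \<Gamma>" by blast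
      have "\<Gamma>' \<subseteq> \<Gamma>" if "\<Gamma>' \<in> E" for \<Gamma>'
      proof
        fix u assume u: "u \<in> \<Gamma>'"
        then have "u \<in> tops s" using that E(1) D(1) by blast
        moreover have "u = t \<or> below u t" using t(2) u that by blast
        moreover have "down_closed s \<Gamma>" using \<Gamma>(1) E(1) D(2) by blast
        ultimately show "u \<in> \<Gamma>" using \<Gamma>(2) by (auto simp: down_closed_def)
      qed
      then have "\<Union>G = layer s \<Gamma>"
        using \<Gamma>(1) layer_mono unfolding E(2) by blast
      then show ?thesis using E(2) \<Gamma>(1) by blast
    qed
  qed
  moreover have "\<exists>t\<in>R. \<exists>n. (s, t) \<in> ord \<and> t \<noteq> s \<and> graded_iso A (subquotient M N) ((standard ord t)\<langle>n\<rangle>)"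
    if "consecutive (layer s ` D) M N" for M N
  proof -
    obtain \<Gamma> \<Gamma>' where \<Gamma>: "\<Gamma> \<in> D" "M = layer s \<Gamma>" "\<Gamma>' \<in> D" "N = layer s \<Gamma>'" "layer s \<Gamma>' \<subset> layer s \<Gamma>"
      and no: "\<not> (\<exists>L\<in>layer s ` D. layer s \<Gamma>' \<subset> L \<and> L \<subset> layer s \<Gamma>)"
      using \<open>consecutive (layer s ` D) M N\<close> by (auto simp: consecutive_def)
    have strict: "layer s \<Gamma>1 \<subset> layer s \<Gamma>2 \<longleftrightarrow> \<Gamma>1 \<subset> \<Gamma>2" if "\<Gamma>1 \<in> D" "\<Gamma>2 \<in> D" for \<Gamma>1 \<Gamma>2
      using layer_subset_iff[OF s] D(1) that by (simp add: less_le_not_le)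
    have sub: "\<Gamma>' \<subset> \<Gamma>" using strict \<Gamma> by blast
    then obtain t where t: "t \<in> \<Gamma>" "\<forall>u\<in>\<Gamma>. u = t \<or> below u t"
      using top[of \<Gamma>] D(1)[OF \<Gamma>(1)] by blast
    have t': "t \<notin> \<Gamma>'"
    proof
      assume "t \<in> \<Gamma>'"
      have "\<Gamma> \<subseteq> \<Gamma>'"
      proof
        fix u assume u: "u \<in> \<Gamma>"
        then have "u \<in> tops s" "u = t \<or> below u t" using D(1)[OF \<Gamma>(1)] t(2) by auto
        then show "u \<in> \<Gamma>'"
          using D(2)[OF \<Gamma>(3)] \<open>t \<in> \<Gamma>'\<close> by (auto simp: down_closed_def)
      qed
      then show False using sub by blast
    qed
    have "\<Gamma> - {t} \<in> D"
      using \<Gamma>(1) t(2) down_closed_remove_top[of s \<Gamma> t] unfolding D_def by blast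
    \<comment> \<open>A lower set that is properly contained in \<open>\<Gamma>\<close> misses the
      top \<open>t\<close>, so \<open>\<Gamma> - {t}\<close> lies between the two; they are
      consecutive.\<close>
    then have "\<Gamma>' = \<Gamma> - {t}"
      using no strict[of \<Gamma>' "\<Gamma> - {t}"] strict[of "\<Gamma> - {t}" \<Gamma>] \<Gamma>(1,3) sub t(1) t' by blast
    moreover have "t \<in> R" "t \<noteq> s" "(s, t) \<in> ord"
      using \<Gamma>(1) t(1) supp_ord[OF s] by (auto simp: D_def tops_def)
    ultimately show ?thesis
      using graded_iso_section[OF s D(2)[OF \<Gamma>(1)] t(1)] t(2) \<Gamma>(2,4) by blast
  qed
  ultimately show ?thesis by blast
qed

lemma highest_weight: "graded_highest_weight_category scale A comp R e ord"
  by unfold_locales (fact partial_order standard_zero standard_kernel_filtration)+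

end

section \<open>The algebra $V_{\mathcal X}$\<close>

lemma detour_self [simp]: "detour x x s = 0" "detour y s s = 0"
  by (simp_all add: vec_eq_iff detour_nth)

lemma V_idem_mult_mon: "V_idem x * mon y s n = (if x = y then mon y s n else (0 :: ('r::finite, 'k::field) V))"
  by (simp add: V_idem_mon mon_mult mon_mult_other)

lemma mon_mult_V_idem: "mon y s n * V_idem x = (if x = s then mon y s n else (0 :: ('r::finite, 'k::field) V))"
  by (auto simp: V_idem_mon mon_mult mon_mult_other)

text \<open>The functional that reads off the coefficient of the exponent zero annihilates all
  multiples of the sum of the u_j and takes the value 1 at the idempotent.\<close>

lemma V_idem_nonzero: "V_idem x \<noteq> (0 :: ('r::finite, 'k::field) V)"
proof
  assume zero: "V_idem x = (0 :: ('r, 'k) V)"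
  define l where "l n = (if n = 0 then 1 else 0 :: 'k)" for n :: "(nat, 'r) vec"
  have "n + axis i 1 \<noteq> 0" for n :: "(nat, 'r) vec" and i
    by (auto simp: vec_eq_iff axis_def)
  then have l: "(\<Sum>i\<in>UNIV. l (n + axis i 1)) = 0" for n by (simp add: l_def)
  obtain L :: "('r, 'k) V \<Rightarrow> 'k" where L: "\<And>v w. L (v + w) = L v + L w"
    "\<And>c v. L (V_scale c v) = c * L v" "\<And>n. L (mon x x n) = l n"
    using V_functional[of l x x] l by blast
  have "L 0 = 0" using L(2)[of 0 0] by simp
  then show False using L(3)[of 0] zero by (simp add: V_idem_mon l_def)
qed

lemma V_Cubist_eq: "V_Cubist X = (V.span {mon x y n | x y n. x \<in> X \<and> y \<in> X} :: ('r::finite, 'k::field) V set)"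
proof
  let ?W = "V.span {mon x y n | x y n. x \<in> X \<and> y \<in> X} :: ('r::finite, 'k::field) V set"
  have "V_idem x * v * V_idem y \<in> ?W" if "x \<in> X" "y \<in> X" for x y v
  proof (induction v rule: V_mon_induct)
    case (1 c a b n)
    have "V_idem x * V_scale c (mon a b n) * V_idem y = (if x = a \<and> y = b then V_scale c (mon a b n) else 0 :: ('r, 'k) V)"
      by (simp add: V_scale_mult_left V_scale_mult_right V_idem_mult_mon mon_mult_V_idem)
    moreover have "V_scale c (mon a b n) \<in> ?W" if "a \<in> X" "b \<in> X"
      using that by (intro V.span_scale V.span_base) blast
    ultimately show ?case
      using that by (auto simp: V.span_zero)
  qed (simp_all add: distrib_left distrib_right V.span_zero V.span_add)
  then show "V_Cubist X \<subseteq> ?W"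
    unfolding V_Cubist_def by (intro V.span_minimal) auto
  have "mon x y n = (V_idem x * mon x y n * V_idem y :: ('r, 'k) V)" for x y n
    by (simp add: V_idem_mult_mon mon_mult_V_idem)
  then show "?W \<subseteq> V_Cubist X"
    unfolding V_Cubist_def by (intro V.span_mono) blast
qed

lemma mon_in_V_Cubist: "x \<in> X \<Longrightarrow> y \<in> X \<Longrightarrow> mon x y n \<in> V_Cubist X"
  unfolding V_Cubist_eq by (rule V.span_base) blast

lemma V_Cubist_induct [consumes 1, case_names base step]:
  assumes "v \<in> V_Cubist X" "P 0"
    "\<And>c x y n w. x \<in> X \<Longrightarrow> y \<in> X \<Longrightarrow> w \<in> V_Cubist X \<Longrightarrow> P w \<Longrightarrow> P (V_scale c (mon x y n) + w)"
  shows "P (v :: ('r::finite, 'k::field) V)"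
proof -
  have "v \<in> V_Cubist X \<and> P v"
    using assms(1) unfolding V_Cubist_eq
  proof (induction rule: V.span_induct_alt)
    case base
    then show ?case using assms(2) V.span_zero by blast
  next
    case (step c m w)
    then obtain x y n where m: "m = mon x y n" "x \<in> X" "y \<in> X" by blast
    have "w \<in> V_Cubist X" using step.IH by (simp only: V_Cubist_eq)
    then have "P (V_scale c m + w)"
      unfolding m(1) using assms(3)[OF m(2,3)] step.IH by blast
    moreover have "V_scale c m + w \<in> V.span {mon x y n | x y n. x \<in> X \<and> y \<in> X}"
      by (rule V.span_add[OF V.span_scale[OF V.span_base[OF step.hyps]] conjunct1[OF step.IH]])
    ultimately show ?case by simp
  qed
  then show ?thesis by blast
qed

lemma V_Cubist_mult:
  assumes "v \<in> V_Cubist X" "w \<in> V_Cubist X"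
  shows "v * w \<in> (V_Cubist X :: ('r::finite, 'k::field) V set)"
proof -
  have sub: "V.subspace (V_Cubist X :: ('r, 'k) V set)" by (simp add: V_Cubist_def)
  have 1: "mon x y n * w \<in> V_Cubist X" if "x \<in> X" "y \<in> X" for x y n
    using assms(2)
  proof (induction rule: V_Cubist_induct)
    case base
    then show ?case using V.subspace_0[OF sub] by simp
  next
    case (step c a b m w)
    have "mon x y n * mon a b m \<in> (V_Cubist X :: ('r, 'k) V set)"
      using that step.hyps V.subspace_0[OF sub]
      by (cases "y = a") (simp_all add: mon_mult mon_mult_other mon_in_V_Cubist)
    then show ?case
      using step.IH by (simp add: distrib_left V_scale_mult_right V.subspace_add[OF sub] V.subspace_scale[OF sub])
  qed
  show ?thesis
    using assms(1)
  proof (induction rule: V_Cubist_induct)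
    case base
    then show ?case using V.subspace_0[OF sub] by simp
  next
    case (step c a b m v)
    then show ?case
      using 1 by (simp add: distrib_right V_scale_mult_left V.subspace_add[OF sub] V.subspace_scale[OF sub])
  qed
qed

lemma V_Cubist_homogeneous_parts:
  assumes "v \<in> V_Cubist X"
  shows "\<exists>S d. finite S \<and> (\<forall>i\<in>S. d i \<in> V_Cubist_comp X i) \<and> v = (\<Sum>i\<in>S. d i :: ('r::finite, 'k::field) V)"
  using assms
proof (induction rule: V_Cubist_induct)
  case base
  then show ?case by (intro exI[of _ "{}"]) simp
next
  case (step c x y n w)
  define j where "j = dist1 x y + 2 * weight n"
  have sub: "V.subspace (V_Cubist_comp X i :: ('r, 'k) V set)" for i
    by (simp add: V_Cubist_comp_def V_Cubist_def V.subspace_inter subspace_V_comp)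
  have m: "V_scale c (mon x y n) \<in> V_Cubist_comp X j"
    using step.hyps V.subspace_scale[OF sub, of "mon x y n" j c]
    by (simp add: V_Cubist_comp_def j_def mon_in_V_Cubist mon_V_comp)
  obtain S d where S: "finite S" "\<forall>i\<in>S. d i \<in> V_Cubist_comp X i" "w = (\<Sum>i\<in>S. d i)"
    using step.IH by blast
  define d' where "d' i = (if i = j then V_scale c (mon x y n) else 0) + (if i \<in> S then d i else 0)" for i
  have "\<forall>i\<in>insert j S. d' i \<in> V_Cubist_comp X i"
    using S(2) m V.subspace_0[OF sub] by (auto simp: d'_def intro: V.subspace_add[OF sub])
  moreover have "(\<Sum>i\<in>insert j S. if i \<in> S then d i else 0) = w"
    unfolding S(3) using S(1) by (intro sum.mono_neutral_cong_right) auto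
  then have "V_scale c (mon x y n) + w = (\<Sum>i\<in>insert j S. d' i)"
    using S(1) by (simp add: d'_def sum.distrib)
  ultimately show ?case using S(1) by blast
qed

lemma V_Cubist_direct:
  assumes "a \<in> V_Cubist X"
  shows "\<exists>!d. (\<forall>i. d i \<in> V_Cubist_comp X i) \<and> finite {i. d i \<noteq> 0} \<and>
    a = (\<Sum>i | d i \<noteq> 0. d i :: ('r::finite, 'k::field) V)"
proof -
  have zero: "0 \<in> (V_Cubist_comp X i :: ('r, 'k) V set)" for i
    by (simp add: V_Cubist_comp_def V_Cubist_def V.span_zero V.subspace_0 subspace_V_comp)
  obtain S d where S: "finite S" "\<forall>i\<in>S. d i \<in> V_Cubist_comp X i" "a = (\<Sum>i\<in>S. d i)"
    using V_Cubist_homogeneous_parts[OF assms] by blast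
  define d' where "d' i = (if i \<in> S then d i else 0)" for i
  have sub: "{i. d' i \<noteq> 0} \<subseteq> S" by (auto simp: d'_def)
  show ?thesis
  proof (rule ex1I[of _ d'], intro conjI)
    show "\<forall>i. d' i \<in> V_Cubist_comp X i" using S(2) zero by (simp add: d'_def)
    show "finite {i. d' i \<noteq> 0}" using sub S(1) by (rule finite_subset)
    have "(\<Sum>i | d' i \<noteq> 0. d' i) = (\<Sum>i\<in>S. d' i)"
      using sub S(1) by (intro sum.mono_neutral_left) auto
    then show "a = (\<Sum>i | d' i \<noteq> 0. d' i)" by (simp add: S(3) d'_def)
  next
    fix f assume f: "(\<forall>i. f i \<in> V_Cubist_comp X i) \<and> finite {i. f i \<noteq> 0} \<and> a = (\<Sum>i | f i \<noteq> 0. f i)"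
    let ?T = "S \<union> {i. f i \<noteq> 0}"
    have T: "finite ?T" using S(1) f by blast
    have "(\<Sum>i | f i \<noteq> 0. f i) = (\<Sum>i\<in>?T. f i)"
      using T by (intro sum.mono_neutral_left) auto
    moreover have "(\<Sum>i\<in>S. d i) = (\<Sum>i\<in>?T. d' i)"
      using T by (intro sum.mono_neutral_cong_left) (auto simp: d'_def)
    ultimately have sum0: "(\<Sum>i\<in>?T. f i - d' i) = 0"
      using f S(3) by (simp add: sum_subtractf)
    have comp: "f i - d' i \<in> V_comp i" for i
      using f S(2) V.subspace_0[OF subspace_V_comp]
      by (auto simp: d'_def V_Cubist_comp_def intro: V.subspace_diff[OF subspace_V_comp])
    show "f = d'"
    proof
      fix i show "f i = d' i"
      proof (cases "i \<in> ?T")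
        case True
        then show ?thesis using V_comp_independent[OF T _ sum0 True] comp by simp
      qed (simp add: d'_def)
    qed
  qed
qed

lemma V_Cubist_Peirce:
  assumes "a \<in> V_Cubist X"
  shows "\<exists>S. finite S \<and> S \<subseteq> X \<and> a = (\<Sum>s\<in>S. \<Sum>t\<in>S. V_idem s * a * V_idem t :: ('r::finite, 'k::field) V)"
proof -
  \<comment> \<open>The identity is claimed for all finite sets containing \<open>S\<close>, so that
    one set can serve both summands in the induction.\<close>
  have "\<exists>S. finite S \<and> S \<subseteq> X \<and> (\<forall>T. finite T \<longrightarrow> S \<subseteq> T \<longrightarrow>
      a = (\<Sum>s\<in>T. \<Sum>t\<in>T. V_idem s * a * V_idem t))"
    using assms
  proof (induction rule: V_Cubist_induct)
    case base
    then show ?case by (intro exI[of _ "{}"]) simp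
  next
    case (step c x y n w)
    then obtain S where S: "finite S" "S \<subseteq> X"
      "\<And>T. finite T \<Longrightarrow> S \<subseteq> T \<Longrightarrow> w = (\<Sum>s\<in>T. \<Sum>t\<in>T. V_idem s * w * V_idem t)" by blast
    show ?case
    proof (intro exI[of _ "insert x (insert y S)"] conjI allI impI)
      fix T assume T: "finite T" "insert x (insert y S) \<subseteq> T"
      have "(\<Sum>s\<in>T. \<Sum>t\<in>T. V_idem s * V_scale c (mon x y n) * V_idem t)
          = (\<Sum>s\<in>T. \<Sum>t\<in>T. if s = x then if t = y then V_scale c (mon x y n) else 0 else (0 :: ('r, 'k) V))"
        by (intro sum.cong refl)
          (simp add: V_scale_mult_left V_scale_mult_right V_idem_mult_mon mon_mult_V_idem)
      also have "\<dots> = (\<Sum>s\<in>T. if s = x then \<Sum>t\<in>T. if t = y then V_scale c (mon x y n) else 0 else 0)"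
        by (intro sum.cong refl) simp
      also have "\<dots> = V_scale c (mon x y n)"
        using T by simp
      finally have m: "(\<Sum>s\<in>T. \<Sum>t\<in>T. V_idem s * V_scale c (mon x y n) * V_idem t) = V_scale c (mon x y n)" .
      have "(\<Sum>s\<in>T. \<Sum>t\<in>T. V_idem s * w * V_idem t) = w" using S(3)[of T] T by simp
      then show "V_scale c (mon x y n) + w
          = (\<Sum>s\<in>T. \<Sum>t\<in>T. V_idem s * (V_scale c (mon x y n) + w) * V_idem t)"
        using m by (simp only: distrib_left distrib_right sum.distrib)
    qed (use S step.hyps in auto)
  qed
  then show ?thesis by blast
qed

lemma finite_label: "finite (UNIV :: 'r::finite label set)"
proof -
  have "UNIV = range Alpha \<union> (range Beta :: 'r label set)"
    by (metis UNIV_eq_I Un_iff label.exhaust rangeI)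
  then show ?thesis by (metis finite_Un finite_imageI finite)
qed

lemma V_idem_V_Cubist_comp: "x \<in> X \<Longrightarrow> V_idem x \<in> (V_Cubist_comp X 0 :: ('r::finite, 'k::field) V set)"
  using mon_V_comp[of x x 0] mon_in_V_Cubist[of x X x 0]
  by (simp add: V_Cubist_comp_def V_idem_mon dist1_def weight_def)

lemma graded_algebra_V_Cubist:
  "graded_algebra (V_scale :: 'k::field \<Rightarrow> ('r::finite, 'k) V \<Rightarrow> ('r, 'k) V)
    (V_Cubist X) (V_Cubist_comp X) X V_idem"
proof
  show "V.subspace (V_Cubist X :: ('r, 'k) V set)" by (simp add: V_Cubist_def)
  show "V.subspace (V_Cubist_comp X i :: ('r, 'k) V set)" for i
    by (simp add: V_Cubist_comp_def V_Cubist_def V.subspace_inter subspace_V_comp)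
  show "V_Cubist_comp X i \<subseteq> (V_Cubist X :: ('r, 'k) V set)" for i
    by (simp add: V_Cubist_comp_def)
  show "a * b \<in> V_Cubist_comp X (i + j)" if "a \<in> V_Cubist_comp X i" "b \<in> V_Cubist_comp X j"
    for a b :: "('r, 'k) V" and i j
    using that by (simp add: V_Cubist_comp_def V_Cubist_mult V_comp_mult)
  show "V_idem s * V_idem s = (V_idem s :: ('r, 'k) V)" for s
    by (simp add: V_idem_mon mon_mult)
  show "V_idem s * V_idem t = (0 :: ('r, 'k) V)" if "s \<noteq> t" for s t
    using that by (simp add: V_idem_mon mon_mult_other)
  have idem: "V_idem s * V_idem t = (if s = t then V_idem s else (0 :: ('r, 'k) V))" for s t
    by (simp add: V_idem_mon mon_mult mon_mult_other)
  have inj: "inj (V_idem :: _ \<Rightarrow> ('r, 'k) V)"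
    by (rule injI) (metis V_idem_nonzero idem)
  then show "inj_on (V_idem :: _ \<Rightarrow> ('r, 'k) V) X" by (rule inj_on_subset) simp
  show "V.independent (V_idem ` X :: ('r, 'k) V set)"
    unfolding V.independent_explicit_module
  proof (intro allI impI)
    fix T u and v :: "('r, 'k) V"
    assume T: "finite T" "T \<subseteq> V_idem ` X" "(\<Sum>v\<in>T. V_scale (u v) v) = 0" "v \<in> T"
    then obtain x where x: "v = V_idem x" by blast
    have "V_idem x * V_scale (u w) w = (if w = v then V_scale (u v) v else 0)" if "w \<in> T" for w
      using that T(2) x inj by (auto simp: V_scale_mult_right idem inj_eq)
    then have "V_idem x * (\<Sum>v\<in>T. V_scale (u v) v) = (\<Sum>w\<in>T. if w = v then V_scale (u v) v else 0)"
      by (simp add: sum_distrib_left)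
    then have "V_scale (u v) v = 0" using T by simp
    then show "u v = 0" using V_idem_nonzero x by auto
  qed
  show "V.span (V_idem ` X) = (V_Cubist_comp X 0 :: ('r, 'k) V set)"
  proof
    show "V.span (V_idem ` X) \<subseteq> (V_Cubist_comp X 0 :: ('r, 'k) V set)"
    proof (rule V.span_minimal)
      show "V.subspace (V_Cubist_comp X 0 :: ('r, 'k) V set)"
        by (simp add: V_Cubist_comp_def V_Cubist_def V.subspace_inter subspace_V_comp)
    qed (auto simp: V_idem_V_Cubist_comp)
    show "V_Cubist_comp X 0 \<subseteq> (V.span (V_idem ` X) :: ('r, 'k) V set)"
    proof
      fix a :: "('r, 'k) V" assume a: "a \<in> V_Cubist_comp X 0"
      then obtain S where S: "finite S" "S \<subseteq> X" "a = (\<Sum>s\<in>S. \<Sum>t\<in>S. V_idem s * a * V_idem t)"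
        using V_Cubist_Peirce[of a X] by (auto simp: V_Cubist_comp_def)
      have "V_idem s * a * V_idem t \<in> V.span (V_idem ` X)" if "s \<in> X" for s t
      proof -
        have "a \<in> V.span {path_class y l | y l. length l = 0}"
          using a unfolding V_Cubist_comp_def V_comp_span by blast
        then show ?thesis
        proof (induction rule: V.span_induct_alt)
          case (step c p w)
          then obtain y where "p = V_idem y" by (auto simp: V_idem_path_class)
          then have "V_idem s * p * V_idem t \<in> V.span (V_idem ` X)"
            using that by (auto simp: idem V.span_zero intro: V.span_base)
          then show ?case
            using step.IH by (simp add: distrib_left distrib_right V_scale_mult_left V_scale_mult_right
                V.span_add V.span_scale)
        qed (simp add: V.span_zero)
      qed
      then show "a \<in> V.span (V_idem ` X)"
        by (subst S(3)) (use S(2) in \<open>blast intro: V.span_sum\<close>)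
    qed
  qed
  show "\<exists>B. finite B \<and> (*) (V_idem s) ` V_Cubist_comp X i \<subseteq> (V.span B :: ('r, 'k) V set)" for s i
  proof (intro exI conjI)
    \<comment> \<open>Only finitely many paths of length \<open>i\<close> start at a given
      vertex.\<close>
    let ?B = "path_class s ` {l. set l \<subseteq> UNIV \<and> length l = i} :: ('r, 'k) V set"
    show "finite ?B" by (intro finite_imageI finite_lists_length_eq finite_label)
    have "V_idem s * a \<in> V.span ?B" if "a \<in> V.span {path_class y l | y l. length l = i}" for a
      using that
    proof (induction rule: V.span_induct_alt)
      case (step c p w)
      then obtain y l where "p = path_class y l" "length l = i" by blast
      then have "V_idem s * p \<in> V.span ?B"
        by (auto simp: V_idem_path_class path_class_mult V.span_zero intro!: V.span_base)
      then show ?case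
        using step.IH by (simp add: distrib_left V_scale_mult_right V.span_add V.span_scale)
    qed (simp add: V.span_zero)
    then show "(*) (V_idem s) ` V_Cubist_comp X i \<subseteq> V.span ?B"
      unfolding V_Cubist_comp_def V_comp_span by blast
  qed
qed (simp_all add: V_scale_mult_left V_scale_mult_right V_Cubist_mult V_Cubist_direct V_Cubist_Peirce)

section \<open>Geodesics as an adapted basis\<close>

context cubist
begin

text \<open>The two substantial assumptions are \<open>factor_span\<close>, which is the rewriting
  of \<open>monomial_in_span\<close>, and \<open>g_indep\<close>, which follows from the count
  through \<open>detour_dual\<close> and \<open>V_functional\<close>.\<close>

lemma standard_basis_V_Cubist:
  "standard_basis (V_scale :: 'k::field \<Rightarrow> ('r, 'k) V \<Rightarrow> ('r, 'k) V) (V_Cubist X) (V_Cubist_comp X) X V_idem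
    ((standard_order X)\<inverse>) below supp (\<lambda>y t. mon y t 0) dist1"
proof (intro standard_basis.intro graded_algebra_V_Cubist standard_basis_axioms.intro)
  show "partial_order_on X ((standard_order X)\<inverse>)"
    using partial_order_standard_order by (simp add: partial_order_on_converse)
  show "below t s" if "(s, t) \<in> (standard_order X)\<inverse>" "s \<noteq> t" for s t
    using order_imp_below that by blast
  show "(y, t) \<in> (standard_order X)\<inverse>" if "y \<in> X" "t \<in> X" "supp y t" for y t
    using supp_imp_order[OF that] by blast
  show "mon y t 0 \<in> (V_Cubist_comp X (dist1 y t) :: ('r, 'k) V set)" if "y \<in> X" "t \<in> X" for y t
    using that mon_V_comp[of y t 0] by (simp add: V_Cubist_comp_def mon_in_V_Cubist weight_def)
  show "V_idem y * a * V_idem t * b * V_idem s \<in> V.span {mon y u 0 * mon u s 0 | u.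
      u \<in> X \<and> (u = t \<or> below u t) \<and> supp y u \<and> supp s u}" (is "_ \<in> ?W")
    if "y \<in> X" "t \<in> X" "s \<in> X" for y t s and a b :: "('r, 'k) V"
  proof -
    \<comment> \<open>In \<open>V_r\<close> the relation holds exactly, so \<open>Z\<close> is
      \<open>{0}\<close>; by \<open>mon_mult\<close> the detour monomials are the products of two
      geodesics.\<close>
    have mon: "mon y s e \<in> ?W" if "\<And>j. detour y t s $ j \<le> e $ j" for e
    proof -
      have "mon y s e \<in> V.span ({mon y s (detour y u s) | u.
          u \<in> tops y s \<and> (u = t \<or> below u t) \<and> weight (detour y u s) = weight e} \<union> {0 :: ('r, 'k) V})"
        by (rule monomial_in_span[OF V.vector_space_axioms _ \<open>t \<in> X\<close> that refl]) (simp add: sum_mon_axis[simplified])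
      also have "\<dots> \<subseteq> ?W"
        by (intro V.span_minimal V.subspace_span)
          (auto simp: tops_def mon_mult V.span_zero intro!: V.span_base)
      finally show ?thesis .
    qed
    have through: "mon y t n * b * V_idem s \<in> ?W" for n
    proof (induction b rule: V_mon_induct)
      case (1 c p q m)
      have "mon y t n * mon p q m * V_idem s
          = (if p = t \<and> q = s then mon y s (n + m + detour y t s) else (0 :: ('r, 'k) V))"
        by (cases "p = t"; cases "q = s") (simp_all add: mon_mult mon_mult_other mon_mult_V_idem)
      moreover have "mon y s (n + m + detour y t s) \<in> ?W" by (rule mon) simp
      ultimately have "mon y t n * mon p q m * V_idem s \<in> ?W"
        by (simp only: V.span_zero split: if_split) simp
      then show ?case by (simp add: V_scale_mult_left V_scale_mult_right V.span_scale)
    qed (simp_all add: distrib_left distrib_right V.span_zero V.span_add)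
    show ?thesis
    proof (induction a rule: V_mon_induct)
      case (1 c p q m)
      have "V_idem y * mon p q m * V_idem t
          = (if p = y \<and> q = t then mon y t m else (0 :: ('r, 'k) V))"
        by (auto simp: V_idem_mult_mon mon_mult_V_idem)
      then have "V_idem y * mon p q m * V_idem t * b * V_idem s \<in> ?W"
        using through[of m] by (simp only: V.span_zero mult_zero_left split: if_split) simp
      then show ?case by (simp add: V_scale_mult_left V_scale_mult_right V.span_scale)
    qed (simp_all add: distrib_left distrib_right V.span_zero V.span_add)
  qed
  show "c t = 0" if prems: "y \<in> X" "s \<in> X" "finite T" "T \<subseteq> {t \<in> X. supp y t \<and> supp s t}"
    "(\<Sum>t\<in>T. V_scale (c t) (mon y t 0 * mon t s 0)) = (0 :: ('r, 'k) V)" "t \<in> T" for y s T c t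
  proof -
    have T: "T \<subseteq> tops y s" using prems(4) by (simp add: tops_def)
    obtain l :: "(nat, 'r) vec \<Rightarrow> 'k" where l: "\<And>n. (\<Sum>i\<in>UNIV. l (n + axis i 1)) = 0"
      "\<And>u. u \<in> tops y s \<Longrightarrow> l (detour y u s) = of_bool (u = t)"
      using detour_dual[OF prems(1,2), of t] T prems(6) by blast
    obtain L :: "('r, 'k) V \<Rightarrow> 'k" where L: "\<And>v w. L (v + w) = L v + L w"
      "\<And>c v. L (V_scale c v) = c * L v" "\<And>n. L (mon y s n) = l n"
      using V_functional[of l y s] l(1) by blast
    have L0: "L 0 = 0" using L(2)[of 0 0] by simp
    have Lsum: "L (sum h T) = (\<Sum>x\<in>T. L (h x))" for h
      by (induction T rule: infinite_finite_induct) (simp_all add: L0 L(1))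
    \<comment> \<open>\<open>L\<close> takes the product with top \<open>u\<close> to
      \<open>l (detour y u s)\<close>, which is 1 for \<open>u = t\<close> and 0 for every other
      top.\<close>
    have "0 = L (\<Sum>t\<in>T. V_scale (c t) (mon y t 0 * mon t s 0))"
      using prems(5) L0 by (simp only:)
    also have "\<dots> = (\<Sum>u\<in>T. c u * l (detour y u s))"
      unfolding Lsum by (simp add: mon_mult L(2,3))
    also have "\<dots> = (\<Sum>u\<in>T. if u = t then c t else 0)"
      by (rule sum.cong) (use T l(2) in auto)
    also have "\<dots> = c t" using prems(3,6) by simp
    finally show ?thesis by simp
  qed
  show "\<not> below s s" for s by (rule below_irrefl)
  show "below s u" if "below s t" "below t u" for s t u using that by (rule below_trans)
  show "supp s s" for s by (rule supp_refl)
  show "\<exists>t\<in>T. \<forall>u\<in>T. u = t \<or> below u t" if "T \<subseteq> {t \<in> X. supp s t}" "T \<noteq> {}" for s T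
    using that by (rule supported_has_top)
qed (simp_all add: V_idem_mon mon_mult)

end

theorem theorem40:
  fixes X :: "(int ^ 'r::{finite,linorder}) set"
  assumes "Cubist X"
  shows "graded_highest_weight_category
    (V_scale :: 'k::field \<Rightarrow> ('r, 'k) V \<Rightarrow> ('r, 'k) V)
    (V_Cubist X) (V_Cubist_comp X) X V_idem ((standard_order X)\<inverse>)"
proof -
  obtain I where I: "is_ideal I" "X = I - shift (- 1) ` I"
    using assms by (auto simp: Cubist_def)
  have "x \<in> shift (- 1) ` I \<longleftrightarrow> x + vec 1 \<in> I" for x :: "(int, 'r) vec"
  proof
    assume "x \<in> shift (- 1) ` I"
    then obtain z where z: "z \<in> I" "x = z + vec (- 1)" by (auto simp: shift_def)
    have "x + vec 1 = z" unfolding z(2) by (simp add: vec_eq_iff)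
    then show "x + vec 1 \<in> I" using z(1) by simp
  next
    assume "x + vec 1 \<in> I"
    moreover have "x = shift (- 1) (x + vec 1)" by (simp add: shift_def vec_eq_iff)
    ultimately show "x \<in> shift (- 1) ` I" by blast
  qed
  then interpret cubist I X
    by unfold_locales (use I in auto)
  show ?thesis
    by (rule standard_basis.highest_weight[OF standard_basis_V_Cubist])
qed

end
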